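(* Fix a positive integer $k$ and let \[ f(h,k) := \frac{k+1}{k^2}\cdot \sqrt[k+1]{k}\cdot\left(\frac{h^k}{\log h}\right)^{\frac{1}{k+1}}. \] Then, as $h\to\infty$: (i) $E(h,k)\gtrsim f(h,k)$; (ii) the number $\underline{R}(k)$ satisfies $\underline{R}(k)\in(1/e,1]$, and \[ E(h,k)\lesssim \left(\frac{1}{\underline{R}(k)}\right)^{\frac{k}{k+1}} f(h,k). \]
   Context: Let $\mathbb{N}$ denote the set of positive integers. For a subset $A$ of an additive semigroup and a positive integer $h$, $hA$ is the set of all sums of exactly $h$ not necessarily distinct elements of $A$. We write $hA\sim\mathbb{N}$ if all but finitely many positive integers lie in $hA$. A set $A\subseteq\mathbb{N}$ is a basis of order $h$ if $hA\sim\mathbb{N}$ but $(h-1)A\not\sim\mathbb{N}$; $A$ is a basis if it is a basis of some order. If $A$ is a basis, a finite subset $E\subseteq A$ is an essential subset of $A$ if $A\setminus E$ is not a basis of any order and $E$ is minimal with this property. $E(h,k)$ denotes the maximum possible number of essential subsets of size $k$ in a basis of order $h$ (this is finite). For integers $N>k\ge 1$, let $h(N,k)$ be the smallest positive integer $h$ such that there is a $k$-element subset $A\subseteq\mathbb{Z}_N\setminus\{0\}$ with $h(A\cup\{0\})=\mathbb{Z}_N$. Define $\underline{R}(k):=\liminf_{N\to\infty} \frac{h(N,k)}{k\sqrt[k]{N}}$. For positive functions, $F(h)\gtrsim G(h)$ means $\liminf_{h\to\infty}F(h)/G(h)\ge 1$, and $F(h)\lesssim G(h)$ means $\limsup_{h\to\infty}F(h)/G(h)\le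 1$. *)

theory Defs
  imports "HOL-Analysis.Analysis"
begin

definition sumset :: "nat \<Rightarrow> nat set \<Rightarrow> nat set" where
  "sumset h A = {n. \<exists>f. (\<forall>i<h. f i \<in> A) \<and> n = (\<Sum>i<h. f i)}"

definition cofinite_pos :: "nat set \<Rightarrow> bool" where
  "cofinite_pos S \<longleftrightarrow> finite {n::nat. 0 < n \<and> n \<notin> S}"

definition basis_of_order :: "nat set \<Rightarrow> nat \<Rightarrow> bool" where
  "basis_of_order A h \<longleftrightarrow> 0 \<notin> A \<and> 0 < h \<and> cofinite_pos (sumset h A)
      \<and> \<not> cofinite_pos (sumset (h - 1) A)"

definition is_basis :: "nat set \<Rightarrow> bool" where
  "is_basis A \<longleftrightarrow> (\<exists>h. basis_of_order A h)"

definition essential_subset :: "nat set \<Rightarrow> nat set \<Rightarrow> bool" where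
  "essential_subset A E \<longleftrightarrow> is_basis A \<and> finite E \<and> E \<subseteq> A \<and> \<not> is_basis (A - E)
      \<and> (\<forall>E'. E' \<subset> E \<longrightarrow> is_basis (A - E'))"

definition E_max :: "nat \<Rightarrow> nat \<Rightarrow> nat" where
  "E_max h k = Sup {card {E. essential_subset A E \<and> card E = k} | A. basis_of_order A h}"

text \<open>h-fold sumset in Z_N, with Z_N represented by {0..<N} and addition mod N.\<close>
definition zsumset :: "nat \<Rightarrow> nat \<Rightarrow> nat set \<Rightarrow> nat set" where
  "zsumset N h B = {n. \<exists>f. (\<forall>i<h. f i \<in> B) \<and> n = (\<Sum>i<h. f i) mod N}"

definition h_cyc :: "nat \<Rightarrow> nat \<Rightarrow> nat" where
  "h_cyc N k = (LEAST h. 0 < h \<and> (\<exists>A. A \<subseteq> {1..<N} \<and> card A = k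
      \<and> zsumset N h (insert 0 A) = {0..<N}))"

definition R_low :: "nat \<Rightarrow> ereal" where
  "R_low k = liminf (\<lambda>N. ereal (real (h_cyc N k) / (real k * root k (real N))))"

definition f_hk :: "nat \<Rightarrow> nat \<Rightarrow> real" where
  "f_hk h k = (real k + 1) / (real k)^2 * root (k + 1) (real k)
      * ((real h) ^ k / ln (real h)) powr (1 / (real k + 1))"

end

(*
  Removing a finite set E from a basis A destroys it exactly when A - E lies in one residue class
  modulo some prime (Erdos-Graham), so an essential subset is the set of those elements of A that
  avoid the main residue class modulo a prime, and distinct essential subsets belong to distinct
  primes p_i.

  Upper bound: by the Chinese remainder theorem the h-fold sums of A realise every system of residues
  modulo the p_i.  Counting multiplicities shows that only few of the k-element essential subsets can
  meet another one.  The remaining ones are disjoint, and prescribing for each of them a residue of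
  maximal cost gives sum h(p_i, k) <= h.  Lower bound: conversely, for any primes with
  sum h(p, k) < h one glues optimal subsets of Z_p by the Chinese remainder theorem and adds multiples
  of the product of the primes; a thin set of multipliers tunes the order to be exactly h.

  Both bounds reduce the problem to how many primes fit into a budget for sum p^(1/k), which is
  settled by the prime number theorem.  The latter is equivalent to the case k = 1, and it is
  obtained by Newman's contour argument for sum (psi(n) - n) / n^2, whose coefficients
  (psi(n) - n) / n are bounded by Chebyshev's estimate.
*)
theory Submission
  imports Defs "HOL-Complex_Analysis.Complex_Analysis" "HOL-Number_Theory.Number_Theory"
    "HOL-Real_Asymp.Real_Asymp"
begin

section \<open>Sumsets, bases and essential subsets\<close>

text \<open>The main term is the number of primes that a budget h can buy when p costs about k
  p^(1/k); it has size h^(k/(k+1)) with a logarithmic saving. Counting multiplicities alone misses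
  this saving: q disjoint k-sets give q! <= C(h + kq, kq), that is q = O(h^(k/(k+1))). If each set
  meets another one, the union has at most (k - 1/2) q elements, the exponent falls to (2k-1)/(2k+1)
  < k/(k+1), and such sets are negligible. The costs h(p,k) can be added only over disjoint sets,
  where no summand serves two primes. The constant comes from two bounds for h(N,k): digits in base
  m with m^k >= N give h(N,k) <= k N^(1/k), hence the lower bound and R <= 1; counting gives k! N <=
  (h + k)^k, hence R > 1/e. The upper bound knows h(p,k) only through the liminf R, which is the
  source of the factor (1/R)^(k/(k+1)). In the construction the finite part needs T of the h
  summands in the worst case, so the multipliers form a set of order exactly h - T.\<close>

lemma sumset_0 [simp]: "sumset 0 A = {0}"
  by (auto simp: sumset_def)

lemma sumset_Suc: "sumset (Suc h) A = {s + a | s a. s \<in> sumset h A \<and> a \<in> A}"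
proof (intro Set.set_eqI iffI)
  fix n assume "n \<in> sumset (Suc h) A"
  then obtain f where "\<forall>i<Suc h. f i \<in> A" "n = (\<Sum>i<Suc h. f i)" by (auto simp: sumset_def)
  then have "(\<Sum>i<h. f i) \<in> sumset h A" unfolding sumset_def by (intro CollectI exI[of _ f]) simp
  moreover have "f h \<in> A" "n = (\<Sum>i<h. f i) + f h" using \<open>\<forall>i<Suc h. f i \<in> A\<close> \<open>n = _\<close> by auto
  ultimately show "n \<in> {s + a | s a. s \<in> sumset h A \<and> a \<in> A}" by blast
next
  fix n assume "n \<in> {s + a | s a. s \<in> sumset h A \<and> a \<in> A}"
  then obtain f a where f: "\<forall>i<h. f i \<in> A" "a \<in> A" "n = (\<Sum>i<h. f i) + a" by (auto simp: sumset_def)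
  then have "\<forall>i<Suc h. (f(h := a)) i \<in> A" "n = (\<Sum>i<Suc h. (f(h := a)) i)"
    by (auto simp: less_Suc_eq intro!: sum.cong)
  then show "n \<in> sumset (Suc h) A" unfolding sumset_def by blast
qed

lemma sumset_1 [simp]: "sumset (Suc 0) A = A"
  by (auto simp: sumset_Suc)

lemma sumset_add:
  assumes "x \<in> sumset h A" "y \<in> sumset k A"
  shows "x + y \<in> sumset (h + k) A"
  using assms(2)
proof (induction k arbitrary: y)
  case (Suc k)
  then obtain s a where "s \<in> sumset k A" "a \<in> A" "y = s + a" by (auto simp: sumset_Suc)
  then have "x + s \<in> sumset (h + k) A" "x + y = (x + s) + a" using Suc.IH by auto
  then show ?case using \<open>a \<in> A\<close> unfolding add_Suc_right sumset_Suc by blast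
qed (use assms in simp)

lemma sumset_mono: "A \<subseteq> B \<Longrightarrow> sumset h A \<subseteq> sumset h B"
  by (auto simp: sumset_def)

lemma sumset_sum:
  assumes "finite I" "\<And>i. i \<in> I \<Longrightarrow> v i \<in> sumset (m i) A"
  shows "(\<Sum>i\<in>I. v i) \<in> sumset (\<Sum>i\<in>I. m i) A"
  using assms by (induction I rule: finite_induct) (auto intro!: sumset_add)

lemma sumset_mult: "a \<in> A \<Longrightarrow> k * a \<in> sumset k A"
  by (induction k) (auto simp: sumset_Suc, metis add.commute)

lemma finite_sumset: "finite A \<Longrightarrow> finite (sumset h A)"
proof (induction h)
  case (Suc h)
  have "sumset (Suc h) A = (\<lambda>(s, a). s + a) ` (sumset h A \<times> A)" by (auto simp: sumset_Suc)
  then show ?case using Suc by simp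
qed simp

lemma not_cofinite_pos_finite: "finite S \<Longrightarrow> \<not> cofinite_pos S"
proof
  assume "finite S" "cofinite_pos S"
  then have "finite ({n. 0 < n \<and> n \<notin> S} \<union> S)" by (simp add: cofinite_pos_def)
  moreover have "{0<..} \<subseteq> {n. 0 < n \<and> n \<notin> S} \<union> S" by auto
  ultimately have "finite {0::nat<..}" by (rule rev_finite_subset)
  then show False using infinite_Ioi by blast
qed

text \<open>The least \<open>h\<close> with \<open>cofinite_pos (sumset h A)\<close> is the order,
  so later arguments only have to exhibit some \<open>h\<close>.\<close>

lemma is_basis_iff:
  assumes "0 \<notin> A"
  shows "is_basis A \<longleftrightarrow> (\<exists>h. cofinite_pos (sumset h A))"
proof
  assume "\<exists>h. cofinite_pos (sumset h A)"
  define h where "h = (LEAST h. cofinite_pos (sumset h A))"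
  have h: "cofinite_pos (sumset h A)" unfolding h_def by (rule LeastI_ex) fact
  \<comment> \<open>\<open>sumset 0 A = {0}\<close> is finite, so the least \<open>h\<close> is
    positive and \<open>h - 1\<close> is a genuine predecessor.\<close>
  then have "h > 0" using not_cofinite_pos_finite[of "{0}"] by (cases h) auto
  then have "\<not> cofinite_pos (sumset (h - 1) A)" unfolding h_def by (intro not_less_Least) simp
  then show "is_basis A" using h \<open>h > 0\<close> assms unfolding is_basis_def basis_of_order_def by blast
qed (auto simp: is_basis_def basis_of_order_def)

lemma is_basis_zero_notin: "is_basis A \<Longrightarrow> 0 \<notin> A"
  by (auto simp: is_basis_def basis_of_order_def)

lemma is_basis_infinite: "is_basis A \<Longrightarrow> infinite A"
  using finite_sumset not_cofinite_pos_finite by (auto simp: is_basis_def basis_of_order_def)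

section \<open>Residue classes and the Erdos-Graham criterion\<close>

lemma sumset_mod:
  assumes "\<And>b. b \<in> B \<Longrightarrow> b mod p = c mod p" "n \<in> sumset h B"
  shows "n mod p = (h * c) mod (p::nat)"
  using assms(2)
proof (induction h arbitrary: n)
  case (Suc h)
  then obtain s a where sa: "s \<in> sumset h B" "a \<in> B" "n = s + a" by (auto simp: sumset_Suc)
  then have "(s + a) mod p = (h * c + c) mod p"
    using Suc.IH[OF sa(1)] assms(1)[OF sa(2)] by (metis mod_add_cong)
  then show ?case using sa by (simp add: add.commute)
qed simp

text \<open>All \<open>h\<close>-fold sums lie in the class of \<open>h * c\<close>, so the class of
  \<open>h * c + 1\<close> is missed entirely, whatever \<open>h\<close> is.\<close>

lemma not_is_basis_residue_class:
  assumes "\<And>b. b \<in> B \<Longrightarrow> b mod p = c" "p > 1"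
  shows "\<not> is_basis B"
proof
  assume "is_basis B"
  then obtain h where h: "cofinite_pos (sumset h B)" by (auto simp: is_basis_def basis_of_order_def)
  have B: "b mod p = c mod p" if "b \<in> B" for b using assms(1)[OF that] by auto
  let ?r = "h * c + 1"
  have "(\<lambda>k. ?r + k * p) ` UNIV \<subseteq> {n. 0 < n \<and> n \<notin> sumset h B}"
  proof safe
    fix k assume "?r + k * p \<in> sumset h B"
    from sumset_mod[OF B this] have "(h * c + 1) mod p = (h * c) mod p" by simp
    then have "1 mod p = (0::nat)" by (metis add.right_neutral mod_add_left_eq nat_mod_eq_iff[symmetric] cong_add_lcancel_nat cong_def mod_0)
    then show False using assms(2) by simp
  qed simp
  moreover have "infinite ((\<lambda>k. ?r + k * p) ` (UNIV :: nat set))"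
    using assms(2) by (subst finite_image_iff) (auto simp: inj_on_def)
  ultimately show False using h finite_subset unfolding cofinite_pos_def by blast
qed

text \<open>A subgroup of the integers consists of the multiples of its least positive element
  \<open>d\<close>; a prime factor of \<open>d\<close> would divide all of \<open>G\<close>.\<close>

lemma int_subgroup_eq_UNIV:
  fixes G :: "int set"
  assumes "0 \<in> G" "\<And>x y. x \<in> G \<Longrightarrow> y \<in> G \<Longrightarrow> x - y \<in> G"
    and np: "\<And>p. prime p \<Longrightarrow> \<exists>x\<in>G. \<not> p dvd x"
  shows "G = UNIV"
proof -
  have neg: "- x \<in> G" if "x \<in> G" for x using assms(2)[OF assms(1) that] by simp
  have add: "x + y \<in> G" if "x \<in> G" "y \<in> G" for x y using assms(2)[OF that(1) neg[OF that(2)]] by simp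
  have muln: "int n * x \<in> G" if "x \<in> G" for x n
    by (induction n) (use add that assms(1) in \<open>auto simp: algebra_simps\<close>)
  have mul: "z * x \<in> G" if "x \<in> G" for x z
    using muln[OF that, of "nat z"] neg[OF muln[OF that, of "nat (- z)"]] by (cases "z \<ge> 0") auto
  obtain x where "x \<in> G" "\<not> 2 dvd x" using np[of 2] by auto
  then have "x \<noteq> 0" by auto
  then have "\<bar>x\<bar> \<in> G" "\<bar>x\<bar> > 0" using neg \<open>x \<in> G\<close> by (auto simp: abs_if)
  then have ex: "\<exists>n::nat. n > 0 \<and> int n \<in> G" by (intro exI[of _ "nat \<bar>x\<bar>"]) auto
  define d where "d = (LEAST n::nat. n > 0 \<and> int n \<in> G)"
  have d: "d > 0" "int d \<in> G" using LeastI_ex[OF ex] by (auto simp: d_def)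
  have div: "int d dvd x" if "x \<in> G" for x
  proof -
    have "x mod int d = x - (x div int d) * int d" by (simp add: minus_div_mult_eq_mod)
    then have "x mod int d \<in> G" using that mul[OF d(2)] assms(2) by metis
    then have "int (nat (x mod int d)) \<in> G" using d by simp
    moreover have "nat (x mod int d) < d" using d by (simp add: nat_less_iff)
    ultimately have "\<not> nat (x mod int d) > 0" using not_less_Least[of "nat (x mod int d)" "\<lambda>n. n > 0 \<and> int n \<in> G", folded d_def] by metis
    moreover have "x mod int d \<ge> 0" using d by simp
    ultimately show ?thesis by (simp add: dvd_eq_mod_eq_0)
  qed
  have "d = 1"
  proof (rule ccontr)
    assume "d \<noteq> 1"
    then obtain p where p: "prime p" "p dvd d" using prime_factor_nat by blast
    then show False using np[of "int p"] div by (meson dvd_trans int_dvd_int_iff prime_nat_int_transfer)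
  qed
  then show ?thesis using mul[OF d(2)] by auto
qed

text \<open>Differences of two sums of equally many elements of \<open>B\<close> form a subgroup of
  the integers, which is everything because \<open>B\<close> lies in no residue class modulo a
  prime. Hence every \<open>e\<close> in \<open>E\<close> can be traded:
  \<open>e + v = b\<^sub>0 + u\<close> with \<open>u\<close> and \<open>v\<close> sums of the same
  length over \<open>B\<close>. Adding a fixed \<open>V\<close> to each summand rewrites sums over
  \<open>A\<close> as sums over \<open>B\<close>.\<close>

lemma erdos_graham_shift:
  assumes "finite E" and B: "A - E \<subseteq> B" "b\<^sub>0 \<in> B"
    and np: "\<And>p c. prime p \<Longrightarrow> \<exists>b\<in>B. b mod p \<noteq> c mod (p::nat)"
  shows "\<exists>V M. \<forall>h. \<forall>n\<in>sumset h A. n + h * V \<in> sumset (h + h * M) B"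
proof -
  define G where "G = {int u - int v | u v m. u \<in> sumset m B \<and> v \<in> sumset m B}"
  have "G = UNIV"
  proof (rule int_subgroup_eq_UNIV)
    show "0 \<in> G" unfolding G_def by (intro CollectI exI[of _ 0]) simp
  next
    fix x y assume "x \<in> G" "y \<in> G"
    then obtain u v m u' v' m' where *: "x = int u - int v" "u \<in> sumset m B" "v \<in> sumset m B"
      "y = int u' - int v'" "u' \<in> sumset m' B" "v' \<in> sumset m' B" unfolding G_def by blast
    then have "u + v' \<in> sumset (m + m') B" "v + u' \<in> sumset (m + m') B" by (auto intro: sumset_add)
    moreover have "x - y = int (u + v') - int (v + u')" using * by simp
    ultimately show "x - y \<in> G" unfolding G_def by blast
  next
    fix p :: int assume p: "prime p"
    then have pp: "prime (nat p)" "p > 0" by (auto simp: prime_gt_0_int)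
    obtain b where b: "b \<in> B" "b mod nat p \<noteq> b\<^sub>0 mod nat p" using np[OF pp(1), of b\<^sub>0] by blast
    then have "int b - int b\<^sub>0 \<in> G" using B(2) unfolding G_def
      by (intro CollectI exI[of _ b] exI[of _ b\<^sub>0] exI[of _ "Suc 0"]) simp
    moreover have "\<not> p dvd int b - int b\<^sub>0"
    proof
      assume "p dvd int b - int b\<^sub>0"
      then have "int b mod p = int b\<^sub>0 mod p" by (simp add: mod_eq_dvd_iff)
      then have "int (b mod nat p) = int (b\<^sub>0 mod nat p)" using pp by (simp add: zmod_int)
      then show False using b(2) by simp
    qed
    ultimately show "\<exists>x\<in>G. \<not> p dvd x" by blast
  qed
  have "\<exists>u v m. u \<in> sumset m B \<and> v \<in> sumset m B \<and> e + v = b\<^sub>0 + u" for e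
  proof -
    have "int e - int b\<^sub>0 \<in> G" using \<open>G = UNIV\<close> by simp
    then obtain u v m where "u \<in> sumset m B" "v \<in> sumset m B" "int e - int b\<^sub>0 = int u - int v"
      unfolding G_def by blast
    moreover from this have "e + v = b\<^sub>0 + u" by linarith
    ultimately show ?thesis by blast
  qed
  then obtain u v m where uvm: "\<And>e. u e \<in> sumset (m e) B" "\<And>e. v e \<in> sumset (m e) B" "\<And>e. e + v e = b\<^sub>0 + u e"
    by metis
  define V where "V = (\<Sum>e\<in>E. v e)"
  define M where "M = (\<Sum>e\<in>E. m e)"
  \<comment> \<open>For \<open>a\<close> in \<open>E\<close> the number \<open>v a\<close> trades
    \<open>a\<close> away and the other \<open>v e\<close> are padding; this keeps the shift
    \<open>V\<close> and the length \<open>Suc M\<close> independent of \<open>a\<close>.\<close>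
  have step: "a + V \<in> sumset (Suc M) B" if "a \<in> A" for a
  proof (cases "a \<in> E")
    case True
    have "a + v a \<in> sumset (Suc 0 + m a) B"
      unfolding uvm(3) by (rule sumset_add) (use B uvm in auto)
    then have "(a + v a) + (\<Sum>e\<in>E - {a}. v e) \<in> sumset ((Suc 0 + m a) + (\<Sum>e\<in>E - {a}. m e)) B"
      by (rule sumset_add) (use assms uvm in \<open>auto intro!: sumset_sum\<close>)
    then show ?thesis using assms(1) True by (simp add: V_def M_def sum.remove add.assoc)
  next
    case False
    then have "a \<in> sumset (Suc 0) B" using that B by auto
    from sumset_add[OF this, of V M] show ?thesis
      using assms uvm by (simp add: V_def M_def sumset_sum)
  qed
  have "n + h * V \<in> sumset (h + h * M) B" if "n \<in> sumset h A" for n h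
    using that
  proof (induction h arbitrary: n)
    case (Suc h)
    then obtain s a where sa: "s \<in> sumset h A" "a \<in> A" "n = s + a" by (auto simp: sumset_Suc)
    from sumset_add[OF Suc.IH[OF sa(1)] step[OF sa(2)]] show ?case using sa by (simp add: algebra_simps)
  qed simp
  then show ?thesis by blast
qed

text \<open>For fixed \<open>h\<close> the shift is the constant \<open>h * V\<close>, and a
  translate of a cofinite set is cofinite.\<close>

theorem erdos_graham_basis:
  assumes "is_basis A" "finite E"
    and np: "\<And>p c. prime p \<Longrightarrow> \<exists>b\<in>A - E. b mod p \<noteq> c mod (p::nat)"
  shows "is_basis (A - E)"
proof -
  obtain h where h: "cofinite_pos (sumset h A)" using assms(1) by (auto simp: is_basis_def basis_of_order_def)
  obtain b where "b \<in> A - E" using np[OF two_is_prime_nat] by blast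
  from erdos_graham_shift[OF assms(2) subset_refl this np] obtain V M where VM: "\<And>n. n \<in> sumset h A \<Longrightarrow> n + h * V \<in> sumset (h + h * M) (A - E)"
    by blast
  have "{n. 0 < n \<and> n \<notin> sumset (h + h * M) (A - E)} \<subseteq> {..h * V} \<union> (\<lambda>n. n + h * V) ` {n. 0 < n \<and> n \<notin> sumset h A}"
  proof
    fix n assume n: "n \<in> {n. 0 < n \<and> n \<notin> sumset (h + h * M) (A - E)}"
    show "n \<in> {..h * V} \<union> (\<lambda>n. n + h * V) ` {n. 0 < n \<and> n \<notin> sumset h A}"
    proof (cases "n \<le> h * V")
      case False
      then have nV: "n = (n - h * V) + h * V" "n - h * V > 0" by auto
      then have "n - h * V \<notin> sumset h A" using n VM[of "n - h * V"] by auto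
      then show ?thesis using nV by (intro UnI2 image_eqI[of _ _ "n - h * V"]) auto
    qed simp
  qed
  then have "cofinite_pos (sumset (h + h * M) (A - E))"
    using h unfolding cofinite_pos_def by (auto elim!: finite_subset)
  moreover have "0 \<notin> A - E" using assms(1) by (auto dest: is_basis_zero_notin)
  ultimately show ?thesis by (auto simp: is_basis_iff)
qed

text \<open>The criterion puts \<open>A - E\<close> into one class. The elements of \<open>A\<close>
  off that class form a subset of \<open>E\<close> whose removal already destroys the basis, so
  minimality makes it equal to \<open>E\<close>.\<close>

theorem essential_subset_residue:
  assumes "essential_subset A E"
  shows "\<exists>p c. prime p \<and> E = {a\<in>A. a mod p \<noteq> c mod (p::nat)}"
proof -
  have E: "is_basis A" "finite E" "E \<subseteq> A" "\<not> is_basis (A - E)" "\<And>E'. E' \<subset> E \<Longrightarrow> is_basis (A - E')"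
    using assms by (auto simp: essential_subset_def)
  then obtain p c where p: "prime p" "\<And>b. b \<in> A - E \<Longrightarrow> b mod p = c mod p"
    using erdos_graham_basis[OF E(1,2)] by blast
  define E' where "E' = {a\<in>A. a mod p \<noteq> c mod p}"
  have "E' \<subseteq> E" using p(2) by (auto simp: E'_def)
  moreover have "\<not> is_basis (A - E')"
    by (rule not_is_basis_residue_class[of _ p "c mod p"]) (use p prime_gt_1_nat in \<open>auto simp: E'_def\<close>)
  ultimately have "E' = E" using E(5) by blast
  then show ?thesis using p(1) unfolding E'_def by blast
qed

text \<open>The converse, used for the construction; the last assumption is the Erdos-Graham
  criterion for the removal of each proper subset of \<open>E\<close>.\<close>

lemma residue_essential_subset:
  assumes "is_basis A" "finite E" "prime p" "E = {a\<in>A. a mod p \<noteq> c mod (p::nat)}"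
    and "\<And>E' q d. E' \<subset> E \<Longrightarrow> prime q \<Longrightarrow> \<exists>b\<in>A - E'. b mod q \<noteq> d mod (q::nat)"
  shows "essential_subset A E"
  unfolding essential_subset_def
proof (intro conjI allI impI)
  show "\<not> is_basis (A - E)"
    by (rule not_is_basis_residue_class[of _ p "c mod p"]) (use assms prime_gt_1_nat in auto)
  fix E' assume "E' \<subset> E"
  then show "is_basis (A - E')"
    using assms by (intro erdos_graham_basis) (auto intro: finite_subset)
qed (use assms in auto)

section \<open>Multiplicities and the postage stamp problem in cyclic groups\<close>

text \<open>Records how often each element of \<open>X\<close> occurs among \<open>h\<close>
  summands; the other summands lie outside \<open>X\<close>, hence an inequality. Extensional
  functions keep the set finite.\<close>

definition multiplicities :: "'a set \<Rightarrow> nat \<Rightarrow> ('a \<Rightarrow> nat) set" where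
  "multiplicities X h = {m \<in> X \<rightarrow>\<^sub>E UNIV. (\<Sum>x\<in>X. m x) \<le> h}"

text \<open>Stars and bars: one value is split off, and the binomial coefficients are summed along a
  diagonal.\<close>

lemma card_multiplicities:
  assumes "finite X"
  shows "finite (multiplicities X h) \<and> card (multiplicities X h) \<le> (h + card X) choose card X"
  using assms
proof (induction X arbitrary: h rule: finite_induct)
  case empty
  have "multiplicities ({} :: 'a set) h = {\<lambda>_. undefined}" by (auto simp: multiplicities_def)
  then show ?case by simp
next
  case (insert x X)
  have sub: "multiplicities (insert x X) h \<subseteq> (\<Union>j\<in>{..h}. (\<lambda>m. m(x := j)) ` multiplicities X (h - j))"
  proof
    fix m assume m: "m \<in> multiplicities (insert x X) h"
    then have s: "m x + (\<Sum>y\<in>X. m y) \<le> h" using insert.hyps by (simp add: multiplicities_def)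
    have ext: "m y = undefined" if "y \<notin> insert x X" for y
      using m that by (auto simp: multiplicities_def)
    have r: "restrict m X \<in> multiplicities X (h - m x)"
      using s by (auto simp: multiplicities_def cong: sum.cong)
    have "m = (restrict m X)(x := m x)" using ext by (auto simp: fun_eq_iff restrict_def)
    then show "m \<in> (\<Union>j\<in>{..h}. (\<lambda>m. m(x := j)) ` multiplicities X (h - j))"
      using r s by (intro UN_I[of "m x"] image_eqI[of _ _ "restrict m X"]) auto
  qed
  have fin: "finite (\<Union>j\<in>{..h}. (\<lambda>m. m(x := j)) ` multiplicities X (h - j))"
    using insert.IH by auto
  have "card (multiplicities (insert x X) h) \<le> (\<Sum>j\<in>{..h}. card ((\<lambda>m. m(x := j)) ` multiplicities X (h - j)))"
    by (rule order_trans[OF card_mono[OF fin sub] card_UN_le]) simp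
  also have "\<dots> \<le> (\<Sum>j\<in>{..h}. ((h - j) + card X) choose card X)"
  proof (rule sum_mono)
    fix j
    show "card ((\<lambda>m. m(x := j)) ` multiplicities X (h - j)) \<le> ((h - j) + card X) choose card X"
      using card_image_le[of "multiplicities X (h - j)" "\<lambda>m. m(x := j)"] insert.IH[of "h - j"] by linarith
  qed
  also have "\<dots> = (\<Sum>j\<in>{..h}. (card X + j) choose card X)"
    by (rule sum.reindex_bij_witness[of _ "\<lambda>j. h - j" "\<lambda>j. h - j"]) (auto simp: add.commute)
  also have "\<dots> = (card X + h + 1) choose (card X + 1)" by (rule choose_rising_sum(1))
  finally show ?case using insert.hyps finite_subset[OF sub fin] by (simp add: add.commute)
qed

text \<open>Summands are grouped by value. The semiring is general because the lemma serves for
  counts and sums in \<open>nat\<close> and for the differences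
  \<open>int x - int c\<close>.\<close>

lemma sum_fibres:
  fixes g :: "'a \<Rightarrow> 'b::comm_semiring_1"
  assumes "finite X"
  shows "(\<Sum>i\<in>{i\<in>{..<h::nat}. f i \<in> X}. g (f i)) = (\<Sum>x\<in>X. of_nat (card {i\<in>{..<h}. f i = x}) * g x)"
proof -
  have "(\<Sum>i\<in>{i\<in>{..<h}. f i \<in> X}. g (f i)) = (\<Sum>x\<in>X. \<Sum>i\<in>{i\<in>{i\<in>{..<h}. f i \<in> X}. f i = x}. g (f i))"
    using assms by (intro sum.group[symmetric]) auto
  also have "\<dots> = (\<Sum>x\<in>X. of_nat (card {i\<in>{..<h}. f i = x}) * g x)"
  proof (rule sum.cong[OF refl])
    fix x assume "x \<in> X"
    then have "{i\<in>{i\<in>{..<h}. f i \<in> X}. f i = x} = {i\<in>{..<h}. f i = x}" by auto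
    then show "(\<Sum>i\<in>{i\<in>{i\<in>{..<h}. f i \<in> X}. f i = x}. g (f i)) = of_nat (card {i\<in>{..<h}. f i = x}) * g x" by simp
  qed
  finally show ?thesis .
qed

lemma sum_card_fibres_le:
  assumes "finite X"
  shows "(\<Sum>x\<in>X. card {i\<in>{..<h::nat}. f i = x}) \<le> h"
proof -
  have "(\<Sum>x\<in>X. card {i\<in>{..<h}. f i = x}) = card {i\<in>{..<h}. f i \<in> X}"
    using sum_fibres[OF assms, where g = "\<lambda>_. 1::nat" and h = h and f = f] by simp
  also have "\<dots> \<le> card {..<h}" by (rule card_mono) auto
  finally show ?thesis by simp
qed

section \<open>Bounds for the postage stamp number h(N,k) of a cyclic group\<close>

lemma zsumset_eq: "zsumset N h B = (\<lambda>n. n mod N) ` sumset h B"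
  by (auto simp: zsumset_def sumset_def)

lemma sumset_insert_0_mono:
  assumes "n \<in> sumset h A" "h \<le> w"
  shows "n \<in> sumset w (insert 0 A)"
proof -
  have "n \<in> sumset h (insert 0 A)" using assms sumset_mono[of A "insert 0 A"] by blast
  from sumset_add[OF this sumset_mult[of 0 "insert 0 A" "w - h"]] show ?thesis using assms by simp
qed

text \<open>The summand 0 contributes nothing, so a residue is determined by the multiplicities of
  the elements of \<open>A\<close>; there must be at least \<open>N\<close> of these.\<close>

lemma zsumset_full_card:
  assumes "zsumset N h (insert 0 A) = {0..<N}" "finite A" "0 \<notin> A"
  shows "N \<le> (h + card A) choose card A"
proof -
  have "{0..<N} \<subseteq> (\<lambda>m. (\<Sum>x\<in>A. m x * x) mod N) ` multiplicities A h"
  proof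
    fix n assume "n \<in> {0..<N}"
    then have "n \<in> zsumset N h (insert 0 A)" using assms(1) by simp
    then obtain f where f: "\<forall>i<h. f i \<in> insert 0 A" "n = (\<Sum>i<h. f i) mod N"
      unfolding zsumset_def by blast
    define m where "m = restrict (\<lambda>x. card {i\<in>{..<h}. f i = x}) A"
    have "(\<Sum>i<h. f i) = (\<Sum>i\<in>{i\<in>{..<h}. f i \<in> A}. f i)"
      using f by (intro sum.mono_neutral_right) auto
    also have "\<dots> = (\<Sum>x\<in>A. m x * x)"
      using sum_fibres[OF assms(2), where g = "\<lambda>x. x" and h = h and f = f] by (simp add: m_def)
    finally have "n = (\<Sum>x\<in>A. m x * x) mod N" using f by simp
    moreover have "m \<in> multiplicities A h"
      using sum_card_fibres_le[OF assms(2), of h f] by (auto simp: m_def multiplicities_def)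
    ultimately show "n \<in> (\<lambda>m. (\<Sum>x\<in>A. m x * x) mod N) ` multiplicities A h" by blast
  qed
  then have "card {0..<N} \<le> card (multiplicities A h)"
    using card_multiplicities[OF assms(2)] surj_card_le by blast
  then show ?thesis using card_multiplicities[OF assms(2), of h] by simp
qed

text \<open>Expansion in base \<open>m\<close>: each of the \<open>k\<close> digits is at most
  \<open>m - 1\<close> and is paid for by that many copies of a power of \<open>m\<close>.\<close>

lemma digits_sumset:
  assumes "m \<ge> 1" "n < m ^ k"
  shows "n \<in> sumset (k * (m - 1)) (insert 0 ((\<lambda>i. m ^ i) ` {..<k}))"
  using assms(2)
proof (induction k arbitrary: n)
  case (Suc k)
  let ?B = "\<lambda>k. insert 0 ((\<lambda>i. m ^ i) ` {..<k})"
  have "n mod m ^ k < m ^ k" using assms(1) by simp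
  from Suc.IH[OF this] have 1: "n mod m ^ k \<in> sumset (k * (m - 1)) (?B (Suc k))"
    using subsetD[OF sumset_mono[of "?B k" "?B (Suc k)"]] by (auto simp: lessThan_Suc)
  have "n div m ^ k < m" using Suc.prems assms(1) by (simp add: div_less_iff_less_mult mult.commute)
  then have 2: "n div m ^ k * m ^ k \<in> sumset (m - 1) (?B (Suc k))"
    using sumset_insert_0_mono[OF sumset_mult[of "m ^ k" "(\<lambda>i. m ^ i) ` {..<Suc k}" "n div m ^ k"], of "m - 1"] by auto
  have "n mod m ^ k + n div m ^ k * m ^ k = n" by (rule mod_div_mult_eq)
  with sumset_add[OF 1 2] show ?case by (simp add: add.commute)
qed simp

text \<open>The stamps are \<open>1, m, ..., m^(k-1)\<close> for the least \<open>m\<close> with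
  \<open>N \<le> m ^ k\<close>. Minimality gives \<open>(m - 1) ^ k < N\<close>, so the digit cost
  \<open>k * (m - 1)\<close> is at most \<open>k\<close> times the root. The size of
  \<open>N\<close> ensures that all these powers are below \<open>N\<close>.\<close>

lemma h_cyc_admissible:
  assumes k: "1 \<le> k" and N: "N \<ge> (2 ^ k + 1) ^ k"
  shows "\<exists>h A. real h \<le> real k * root k (real N) \<and> 0 < h \<and> A \<subseteq> {1..<N} \<and> card A = k \<and> zsumset N h (insert 0 A) = {0..<N}"
proof -
  have "N < (N + 1) ^ k" using k by (metis Suc_eq_plus1 lessI less_le_trans self_le_power zero_less_Suc Suc_leI One_nat_def)
  then have ex: "\<exists>m. N \<le> m ^ k" by (meson less_imp_le)
  define m where "m = (LEAST m. N \<le> m ^ k)"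
  have m1: "N \<le> m ^ k" unfolding m_def by (rule LeastI_ex[OF ex])
  have mN: "(2 ^ k + 1) ^ k \<le> m ^ k" using m1 N by linarith
  then have m2: "2 ^ k + 1 \<le> m" using k by (simp add: power_mono_iff)
  then have m3: "m \<ge> 2" using one_le_power[of "2::nat" k] by linarith
  have m4: "(m - 1) ^ k < N" using not_less_Least[of "m - 1" "\<lambda>m. N \<le> m ^ k"] m3 unfolding m_def[symmetric] by simp
  define t where "t = m - 1"
  have t: "t \<ge> 2 ^ k" "m = t + 1" "t \<ge> 1" using m2 m3 by (auto simp: t_def)
  \<comment> \<open>Only \<open>t ^ k < N\<close> is known for \<open>t = m - 1\<close>, whereas
    \<open>m ^ (k - 1) < N\<close> is wanted; replacing \<open>m\<close> by \<open>2 * t\<close>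
    costs a factor \<open>2 ^ (k - 1)\<close>, which \<open>t \<ge> 2 ^ k\<close> absorbs.\<close>
  have "m ^ (k - 1) \<le> (2 * t) ^ (k - 1)" using t by (intro power_mono) auto
  also have "\<dots> = 2 ^ (k - 1) * t ^ (k - 1)" by (simp add: power_mult_distrib)
  also have "\<dots> \<le> t * t ^ (k - 1)"
  proof -
    have "(2::nat) ^ (k - 1) \<le> 2 ^ k" by (intro power_increasing) auto
    then have "2 ^ (k - 1) \<le> t" using t(1) by linarith
    then show ?thesis by (rule mult_right_mono) simp
  qed
  also have "\<dots> = t ^ k" using k by (cases k) auto
  finally have mk: "m ^ (k - 1) < N" using m4 by (simp add: t_def)
  define A where "A = (\<lambda>i. m ^ i) ` {..<k}"
  have "A \<subseteq> {1..<N}"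
  proof safe
    fix x assume "x \<in> A"
    then obtain i where i: "i < k" "x = m ^ i" by (auto simp: A_def)
    then have "m ^ i \<le> m ^ (k - 1)" using m3 by (intro power_increasing) auto
    moreover have "m ^ i \<ge> 1" using m3 by (intro one_le_power) auto
    ultimately show "x \<in> {1..<N}" using mk i by simp
  qed
  moreover have "card A = k"
    unfolding A_def using m3 by (subst card_image) (auto simp: inj_on_def power_inject_exp)
  moreover have "zsumset N (k * (m - 1)) (insert 0 A) = {0..<N}"
  proof
    show "{0..<N} \<subseteq> zsumset N (k * (m - 1)) (insert 0 A)"
    proof
      fix n assume "n \<in> {0..<N}"
      then have "n < m ^ k" "n mod N = n" using m1 by auto
      then show "n \<in> zsumset N (k * (m - 1)) (insert 0 A)"
        using digits_sumset[of m n k] m3 unfolding zsumset_eq A_def by (auto intro: image_eqI[of _ _ n])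
    qed
    show "zsumset N (k * (m - 1)) (insert 0 A) \<subseteq> {0..<N}" using mk by (auto simp: zsumset_eq)
  qed
  moreover have "real (k * (m - 1)) \<le> real k * root k (real N)"
  proof -
    have "real (m - 1) = root k (real (m - 1) ^ k)" using k by (simp add: real_root_power_cancel)
    also have "\<dots> \<le> root k (real N)"
      using k m4 by (intro real_root_le_mono) (auto simp flip: of_nat_power)
    finally show ?thesis by (simp add: mult_left_mono)
  qed
  moreover have "0 < k * (m - 1)" using k m3 by simp
  ultimately show ?thesis by blast
qed

text \<open>The \<open>LEAST\<close> in \<open>h_cyc\<close> is attained once a witness exists, and
  the threshold on \<open>N\<close> supplies one.\<close>

lemma h_cyc_spec:
  assumes "1 \<le> k" "N \<ge> (2 ^ k + 1) ^ k"
  shows "0 < h_cyc N k" "real (h_cyc N k) \<le> real k * root k (real N)"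
    and "\<exists>A. A \<subseteq> {1..<N} \<and> card A = k \<and> zsumset N (h_cyc N k) (insert 0 A) = {0..<N}"
proof -
  let ?P = "\<lambda>h. 0 < h \<and> (\<exists>A. A \<subseteq> {1..<N} \<and> card A = k \<and> zsumset N h (insert 0 A) = {0..<N})"
  obtain h where h: "real h \<le> real k * root k (real N)" "?P h" using h_cyc_admissible[OF assms] by blast
  have "?P (h_cyc N k)" unfolding h_cyc_def by (rule LeastI[of ?P, OF h(2)])
  then show "0 < h_cyc N k" "\<exists>A. A \<subseteq> {1..<N} \<and> card A = k \<and> zsumset N (h_cyc N k) (insert 0 A) = {0..<N}" by auto
  have "h_cyc N k \<le> h" unfolding h_cyc_def by (rule Least_le[of ?P, OF h(2)])
  then show "real (h_cyc N k) \<le> real k * root k (real N)" using h(1) by linarith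
qed

text \<open>\<open>D\<close> may have fewer than \<open>k\<close> elements because reduction modulo
  a prime can identify elements of an essential subset; it is padded to size \<open>k\<close>, for
  which \<open>k < N\<close> leaves room.\<close>

lemma h_cyc_obstruction:
  assumes "D \<subseteq> {1..<N}" "card D \<le> k" "k < N" "0 < w" "w < h_cyc N k"
  shows "\<exists>s<N. s \<notin> zsumset N w (insert 0 D)"
proof -
  have "finite D" using assms(1) finite_subset by blast
  obtain D' where D': "D \<subseteq> D'" "D' \<subseteq> {1..<N}" "card D' = k"
  proof -
    have "k \<le> card {1..<N}" using assms(3) by simp
    from exists_subset_between[OF assms(2) this assms(1)] show ?thesis using that by auto
  qed
  have "\<not> (0 < w \<and> (\<exists>A. A \<subseteq> {1..<N} \<and> card A = k \<and> zsumset N w (insert 0 A) = {0..<N}))"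
    using assms(5) unfolding h_cyc_def by (rule not_less_Least)
  then have "zsumset N w (insert 0 D') \<noteq> {0..<N}" using D' assms(4) by blast
  moreover have "zsumset N w (insert 0 D') \<subseteq> {0..<N}" using assms(3) by (auto simp: zsumset_eq)
  ultimately obtain s where "s < N" "s \<notin> zsumset N w (insert 0 D')" by force
  moreover have "zsumset N w (insert 0 D) \<subseteq> zsumset N w (insert 0 D')"
    unfolding zsumset_eq using D' by (intro image_mono sumset_mono) auto
  ultimately show ?thesis by blast
qed

section \<open>Residue systems realised by a basis\<close>

text \<open>A solution of the congruences is moved by a multiple of the product of the moduli beyond
  all exceptions of the sumset.\<close>

lemma sumset_residue_system:
  assumes "cofinite_pos (sumset h A)" "finite S" "inj_on P S" "\<And>E. E \<in> S \<Longrightarrow> prime (P E :: nat)"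
  shows "\<exists>f. (\<forall>i<h. f i \<in> A) \<and> (\<forall>E\<in>S. [(\<Sum>i<h. f i) = r E] (mod P E))"
proof -
  have "\<forall>i\<in>S. \<forall>j\<in>S. i \<noteq> j \<longrightarrow> coprime (P i) (P j)"
    using assms(3,4) by (auto intro!: primes_coprime dest: inj_onD)
  then obtain x where x: "\<forall>i\<in>S. [x = r i] (mod P i)"
    using chinese_remainder_nat[OF assms(2), of P r] by blast
  define Q where "Q = (\<Prod>E\<in>S. P E)"
  have "Q > 0" unfolding Q_def using assms(4) prime_gt_0_nat by (intro prod_pos) auto
  obtain b where b: "\<And>n. 0 < n \<Longrightarrow> n \<notin> sumset h A \<Longrightarrow> n < b"
    using assms(1) unfolding cofinite_pos_def finite_nat_set_iff_bounded by blast
  define n where "n = x + Suc b * Q"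
  have "b < Suc b * 1" by simp
  also have "\<dots> \<le> Suc b * Q" using \<open>Q > 0\<close> by (intro mult_left_mono) auto
  finally have "n > b" by (simp add: n_def)
  then have "n \<in> sumset h A" using b[of n] by (cases "n = 0") auto
  then obtain f where f: "\<forall>i<h. f i \<in> A" "n = (\<Sum>i<h. f i)" by (auto simp: sumset_def)
  have "[n = r E] (mod P E)" if "E \<in> S" for E
  proof -
    have "P E dvd Q" unfolding Q_def using assms(2) that by (intro dvd_prodI) auto
    then have "[Suc b * Q = 0] (mod P E)" by (simp add: cong_0_iff)
    then have "[n = r E + 0] (mod P E)" unfolding n_def using x that by (intro cong_add) auto
    then show ?thesis by simp
  qed
  then show ?thesis using f by auto
qed

text \<open>Elements of \<open>A\<close> outside \<open>E\<close> are all congruent to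
  \<open>c\<close>, so modulo \<open>p\<close> the sum depends only on how often each
  \<open>x\<close> in \<open>E\<close> occurs. Integers are used because \<open>x - c\<close> may be
  negative.\<close>

lemma sum_residue_fibres:
  assumes "\<forall>i<h. f i \<in> A" "finite E" "E = {a\<in>A. a mod p \<noteq> c mod (p::nat)}"
  shows "[int (\<Sum>i<h. f i) = int h * int c + (\<Sum>x\<in>E. int (card {i\<in>{..<h}. f i = x}) * (int x - int c))] (mod int p)"
proof -
  have "(\<Sum>i<h. int (f i) - int c) = (\<Sum>i\<in>{i\<in>{..<h}. f i \<in> E}. int (f i) - int c) + (\<Sum>i\<in>{..<h} - {i\<in>{..<h}. f i \<in> E}. int (f i) - int c)"
    by (subst add.commute, rule sum.subset_diff) auto
  moreover have "[(\<Sum>i\<in>{..<h} - {i\<in>{..<h}. f i \<in> E}. int (f i) - int c) = (\<Sum>i\<in>{..<h} - {i\<in>{..<h}. f i \<in> E}. 0)] (mod int p)"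
  proof (rule cong_sum)
    fix i assume i: "i \<in> {..<h} - {i\<in>{..<h}. f i \<in> E}"
    then have "f i mod p = c mod p" using assms by auto
    then have "int (f i) mod int p = int c mod int p" by (metis zmod_int)
    then show "[int (f i) - int c = 0] (mod int p)" by (simp add: cong_0_iff mod_eq_dvd_iff)
  qed
  ultimately have "[(\<Sum>i<h. int (f i) - int c) = (\<Sum>i\<in>{i\<in>{..<h}. f i \<in> E}. int (f i) - int c) + 0] (mod int p)"
    by (simp only: sum.neutral_const cong_add[OF cong_refl])
  also have "(\<Sum>i\<in>{i\<in>{..<h}. f i \<in> E}. int (f i) - int c) = (\<Sum>x\<in>E. int (card {i\<in>{..<h}. f i = x}) * (int x - int c))"
    using sum_fibres[OF assms(2), where g = "\<lambda>x. int x - int c" and h = h and f = f] by simp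
  finally have "[(\<Sum>i<h. int (f i) - int c) + int h * int c = (\<Sum>x\<in>E. int (card {i\<in>{..<h}. f i = x}) * (int x - int c)) + 0 + int h * int c] (mod int p)"
    by (intro cong_add) auto
  then show ?thesis by (simp add: sum_subtractf add.commute)
qed

text \<open>The multiplicities on the union of the family determine all residues at once, and every
  system of residues occurs, so there are at least as many multiplicities as systems. An element
  shared by several members is counted once, which is why overlap forces the family to be
  small.\<close>

lemma prod_moduli_le_binomial:
  assumes "cofinite_pos (sumset h A)" "finite I" "inj_on P I" "\<And>E. E \<in> I \<Longrightarrow> prime (P E :: nat)"
    and E: "\<And>E. E \<in> I \<Longrightarrow> finite E \<and> E = {a\<in>A. a mod P E \<noteq> C E mod P E}"
  shows "(\<Prod>E\<in>I. P E) \<le> (h + card (\<Union>I)) choose card (\<Union>I)"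
proof -
  \<comment> \<open>\<open>\<phi>\<close> reads off from the multiplicities the residue of the sum
    modulo each \<open>P E\<close>; it is restricted to \<open>I\<close> to land in the extensional
    product.\<close>
  define \<phi> where "\<phi> = (\<lambda>m. restrict (\<lambda>E. nat ((int h * int (C E) + (\<Sum>x\<in>E. int (m x) * (int x - int (C E)))) mod int (P E))) I)"
  have fin: "finite (\<Union>I)" using assms(2) E by auto
  have "(\<Pi>\<^sub>E E\<in>I. {0..<P E}) \<subseteq> \<phi> ` multiplicities (\<Union>I) h"
  proof
    fix r assume r: "r \<in> (\<Pi>\<^sub>E E\<in>I. {0..<P E})"
    obtain f where f: "\<forall>i<h. f i \<in> A" "\<forall>E\<in>I. [(\<Sum>i<h. f i) = r E] (mod P E)"
      using sumset_residue_system[OF assms(1-4), of r] by blast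
    define m where "m = restrict (\<lambda>x. card {i\<in>{..<h}. f i = x}) (\<Union>I)"
    have "m \<in> multiplicities (\<Union>I) h"
      using sum_card_fibres_le[OF fin, of h f] by (auto simp: m_def multiplicities_def)
    moreover have "r = \<phi> m"
    proof
      fix E
      show "r E = \<phi> m E"
      proof (cases "E \<in> I")
        case True
        have "(\<Sum>x\<in>E. int (m x) * (int x - int (C E))) = (\<Sum>x\<in>E. int (card {i\<in>{..<h}. f i = x}) * (int x - int (C E)))"
          using True by (intro sum.cong) (auto simp: m_def)
        moreover have "[int (\<Sum>i<h. f i) = int h * int (C E) + (\<Sum>x\<in>E. int (card {i\<in>{..<h}. f i = x}) * (int x - int (C E)))] (mod int (P E))"
          by (rule sum_residue_fibres[OF f(1)]) (use E[OF True] in blast)+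
        moreover have "[int (\<Sum>i<h. f i) = int (r E)] (mod int (P E))"
          using f(2) True by (simp only: cong_int_iff)
        ultimately have "[int (r E) = int h * int (C E) + (\<Sum>x\<in>E. int (m x) * (int x - int (C E)))] (mod int (P E))"
          by (metis cong_sym cong_trans)
        moreover have "int (r E) mod int (P E) = int (r E)" using r True by (auto simp: PiE_iff)
        ultimately show ?thesis using True by (simp add: \<phi>_def cong_def)
      next
        case False
        then show ?thesis using r by (simp add: \<phi>_def PiE_iff extensional_def)
      qed
    qed
    ultimately show "r \<in> \<phi> ` multiplicities (\<Union>I) h" by blast
  qed
  then have "card (\<Pi>\<^sub>E E\<in>I. {0..<P E}) \<le> card (multiplicities (\<Union>I) h)"
    using card_multiplicities[OF fin] surj_card_le by blast
  then show ?thesis using card_multiplicities[OF fin, of h] assms(2) by (simp add: card_PiE)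
qed

text \<open>For each \<open>E\<close> the differences \<open>x - C E\<close> give at most
  \<open>k\<close> nonzero residues modulo \<open>P E\<close>, so some \<open>s\<close> is not a sum
  of \<open>h_cyc - 1\<close> of them and zeros. A sum over \<open>A\<close> hitting
  \<open>h * C E + s\<close> modulo every \<open>P E\<close> takes at least \<open>h_cyc - 1\<close>
  summands from each \<open>E\<close>, and disjointness lets these numbers be added. The condition
  \<open>k < P E\<close> provides room for \<open>k\<close> nonzero residues.\<close>

lemma sum_h_cyc_disjoint_le:
  assumes "cofinite_pos (sumset h A)" "finite J" "inj_on P J" "\<And>E. E \<in> J \<Longrightarrow> prime (P E :: nat)"
    and E: "\<And>E. E \<in> J \<Longrightarrow> finite E \<and> card E = k \<and> E = {a\<in>A. a mod P E \<noteq> C E mod P E}"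
    and disj: "\<And>E E'. E \<in> J \<Longrightarrow> E' \<in> J \<Longrightarrow> E \<noteq> E' \<Longrightarrow> E \<inter> E' = {}"
  shows "(\<Sum>E\<in>{E\<in>J. k < P E}. h_cyc (P E) k - 1) \<le> h"
proof -
  define D where "D = (\<lambda>E. (\<lambda>x. nat ((int x - int (C E)) mod int (P E))) ` E)"
  \<comment> \<open>If \<open>h_cyc (P E) k - 1\<close> is 0, possibly by truncated subtraction, the
    claimed cost is trivial and no obstruction is asked for.\<close>
  have "\<exists>s. 0 < h_cyc (P E) k - 1 \<longrightarrow> s < P E \<and> s \<notin> zsumset (P E) (h_cyc (P E) k - 1) (insert 0 (D E))"
    if "E \<in> J" "k < P E" for E
  proof -
    have "D E \<subseteq> {1..<P E}"
    proof
      fix d assume "d \<in> D E"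
      then obtain x where x: "x \<in> E" "d = nat ((int x - int (C E)) mod int (P E))" by (auto simp: D_def)
      have P0: "P E > 0" using assms(4)[OF that(1)] by (rule prime_gt_0_nat)
      have "x mod P E \<noteq> C E mod P E" using x(1) E[OF that(1)] by blast
      then have "\<not> int (P E) dvd int x - int (C E)" by (metis mod_eq_dvd_iff of_nat_eq_iff zmod_int)
      then have "(int x - int (C E)) mod int (P E) \<noteq> 0" by (simp add: dvd_eq_mod_eq_0)
      moreover have "(int x - int (C E)) mod int (P E) \<ge> 0" "(int x - int (C E)) mod int (P E) < int (P E)"
        using P0 by auto
      ultimately show "d \<in> {1..<P E}" using x(2) by auto
    qed
    moreover have "card (D E) \<le> k" unfolding D_def using E[OF that(1)] card_image_le by metis
    ultimately show ?thesis using h_cyc_obstruction[of "D E" "P E" k "h_cyc (P E) k - 1"] that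
      by (cases "0 < h_cyc (P E) k - 1") auto
  qed
  then have "\<exists>s. 0 < h_cyc (P E) k - 1 \<longrightarrow> E \<in> J \<and> k < P E \<longrightarrow> s < P E \<and> s \<notin> zsumset (P E) (h_cyc (P E) k - 1) (insert 0 (D E))" for E
    by blast
  then obtain s where s: "\<And>E. E \<in> J \<Longrightarrow> k < P E \<Longrightarrow> 0 < h_cyc (P E) k - 1 \<Longrightarrow>
      s E < P E \<and> s E \<notin> zsumset (P E) (h_cyc (P E) k - 1) (insert 0 (D E))" by metis
  obtain f where f: "\<forall>i<h. f i \<in> A" "\<forall>E\<in>J. [(\<Sum>i<h. f i) = h * C E + s E] (mod P E)"
    using sumset_residue_system[OF assms(1-4), of "\<lambda>E. h * C E + s E"] by blast
  define m where "m = (\<lambda>x. card {i\<in>{..<h}. f i = x})"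
  have cost: "h_cyc (P E) k - 1 \<le> (\<Sum>x\<in>E. m x)" if EJ: "E \<in> J" "k < P E" for E
  proof (rule ccontr)
    assume "\<not> h_cyc (P E) k - 1 \<le> (\<Sum>x\<in>E. m x)"
    \<comment> \<open>With fewer summands from \<open>E\<close>, padding by zeros would represent
      the forbidden residue \<open>s E\<close> by exactly \<open>h_cyc (P E) k - 1\<close>
      terms.\<close>
    then have w: "(\<Sum>x\<in>E. m x) \<le> h_cyc (P E) k - 1" "0 < h_cyc (P E) k - 1" by auto
    define d where "d = (\<lambda>x. nat ((int x - int (C E)) mod int (P E)))"
    have P0: "P E > 0" using assms(4)[OF EJ(1)] by (rule prime_gt_0_nat)
    have c1: "[int (\<Sum>i<h. f i) = int h * int (C E) + (\<Sum>x\<in>E. int (m x) * (int x - int (C E)))] (mod int (P E))"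
      unfolding m_def by (rule sum_residue_fibres[OF f(1)]) (use E[OF EJ(1)] in blast)+
    have c2: "[int (\<Sum>i<h. f i) = int (h * C E + s E)] (mod int (P E))"
      using f(2) EJ by (simp only: cong_int_iff)
    have "[int h * int (C E) + int (s E) = int h * int (C E) + (\<Sum>x\<in>E. int (m x) * (int x - int (C E)))] (mod int (P E))"
      using cong_trans[OF cong_sym[OF c2] c1] by (simp only: of_nat_add of_nat_mult)
    then have c3: "[int (s E) = (\<Sum>x\<in>E. int (m x) * (int x - int (C E)))] (mod int (P E))"
      by (simp only: cong_add_lcancel)
    have c4: "[(\<Sum>x\<in>E. int (m x) * (int x - int (C E))) = (\<Sum>x\<in>E. int (m x) * int (d x))] (mod int (P E))"
      by (intro cong_sum cong_mult cong_refl) (use P0 in \<open>simp add: d_def cong_def\<close>)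
    have "[int (s E) = int (\<Sum>x\<in>E. m x * d x)] (mod int (P E))"
      using cong_trans[OF c3 c4] by (simp only: of_nat_sum of_nat_mult)
    then have "[s E = (\<Sum>x\<in>E. m x * d x)] (mod P E)" by (simp only: cong_int_iff)
    then have "s E = (\<Sum>x\<in>E. m x * d x) mod P E" using s[OF EJ w(2)] by (simp add: cong_def)
    moreover have "(\<Sum>x\<in>E. m x * d x) \<in> sumset (\<Sum>x\<in>E. m x) (D E)"
      by (rule sumset_sum) (use E[OF EJ(1)] in \<open>auto simp: D_def d_def intro!: sumset_mult\<close>)
    ultimately have "s E \<in> zsumset (P E) (h_cyc (P E) k - 1) (insert 0 (D E))"
      unfolding zsumset_eq using sumset_insert_0_mono[OF _ w(1)] by blast
    then show False using s[OF EJ w(2)] by blast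
  qed
  have "(\<Sum>E\<in>{E\<in>J. k < P E}. h_cyc (P E) k - 1) \<le> (\<Sum>E\<in>{E\<in>J. k < P E}. \<Sum>x\<in>E. m x)"
    using cost by (intro sum_mono) auto
  also have "\<dots> = (\<Sum>x\<in>\<Union>{E\<in>J. k < P E}. m x)"
    using assms(2) E disj by (intro sum.Union_disjoint[symmetric, unfolded o_def]) auto
  also have "\<dots> \<le> h" unfolding m_def using assms(2) E by (intro sum_card_fibres_le) auto
  finally show ?thesis .
qed

text \<open>Each element of the union has total weight 1, shared equally among the members that
  contain it. A member meeting another one has an element of weight at most 1/2, so its own total is
  at most \<open>k - 1/2\<close>.\<close>

lemma card_Union_overlapping_le:
  assumes "finite I" "\<And>E. E \<in> I \<Longrightarrow> finite E \<and> card E = k"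
    and ov: "\<And>E. E \<in> I \<Longrightarrow> \<exists>E'\<in>I. E' \<noteq> E \<and> E \<inter> E' \<noteq> {}"
  shows "real (card (\<Union>I)) \<le> (real k - 1/2) * real (card I)"
proof -
  define deg where "deg = (\<lambda>x. real (card {E\<in>I. x \<in> E}))"
  have fin: "finite (\<Union>I)" using assms by auto
  have deg1: "deg x \<ge> 1" if "E \<in> I" "x \<in> E" for x E
  proof -
    have "{E} \<subseteq> {E\<in>I. x \<in> E}" using that by auto
    then have "card {E} \<le> card {E\<in>I. x \<in> E}" using assms(1) by (intro card_mono) auto
    then show ?thesis by (simp add: deg_def)
  qed
  have "real (card (\<Union>I)) = (\<Sum>x\<in>\<Union>I. \<Sum>E | E \<in> I \<and> x \<in> E. 1 / deg x)"
  proof -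
    have "(\<Sum>E | E \<in> I \<and> x \<in> E. 1 / deg x) = 1" if x: "x \<in> \<Union>I" for x
    proof -
      obtain E where "E \<in> I" "x \<in> E" using x by blast
      then have "deg x \<noteq> 0" using deg1[of E x] by simp
      moreover have "(\<Sum>E | E \<in> I \<and> x \<in> E. 1 / deg x) = deg x * (1 / deg x)" by (simp add: deg_def)
      ultimately show ?thesis by simp
    qed
    then have "(\<Sum>x\<in>\<Union>I. \<Sum>E | E \<in> I \<and> x \<in> E. 1 / deg x) = (\<Sum>x\<in>\<Union>I. 1)" by (rule sum.cong[OF refl])
    then show ?thesis by simp
  qed
  also have "\<dots> = (\<Sum>E\<in>I. \<Sum>x | x \<in> \<Union>I \<and> x \<in> E. 1 / deg x)"
    using fin assms(1) by (intro sum.swap_restrict) auto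
  also have "\<dots> \<le> (\<Sum>E\<in>I. real k - 1/2)"
  proof (rule sum_mono)
    fix E assume E: "E \<in> I"
    then obtain E' x where E': "E' \<in> I" "E' \<noteq> E" "x \<in> E" "x \<in> E'" using ov by blast
    have "{E, E'} \<subseteq> {E\<in>I. x \<in> E}" using E E' by auto
    then have "card {E, E'} \<le> card {E\<in>I. x \<in> E}" using assms(1) by (intro card_mono) auto
    then have d2: "deg x \<ge> 2" using E' by (simp add: deg_def)
    have "{x. x \<in> \<Union>I \<and> x \<in> E} = E" using E by auto
    then have "(\<Sum>x | x \<in> \<Union>I \<and> x \<in> E. 1 / deg x) = 1 / deg x + (\<Sum>y\<in>E - {x}. 1 / deg y)"
      using E' assms(2)[OF E] by (simp add: sum.remove)
    also have "\<dots> \<le> 1 / 2 + (\<Sum>y\<in>E - {x}. 1)"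
    proof (intro add_mono sum_mono)
      show "1 / deg x \<le> 1 / 2" using d2 by (intro divide_left_mono) auto
      fix y assume "y \<in> E - {x}"
      then show "1 / deg y \<le> 1" using deg1[OF E, of y] by simp
    qed
    also have "\<dots> = real k - 1 / 2"
    proof -
      have "card (E - {x}) = k - 1" "k \<ge> 1" using assms(2)[OF E] E'(3) by (auto simp: Suc_le_eq card_gt_0_iff)
      then show ?thesis by (simp add: of_nat_diff)
    qed
    finally show "(\<Sum>x | x \<in> \<Union>I \<and> x \<in> E. 1 / deg x) \<le> real k - 1 / 2" .
  qed
  finally show ?thesis by (simp add: mult.commute)
qed

text \<open>The largest of \<open>n\<close> distinct positive integers is at least
  \<open>n\<close>.\<close>

lemma fact_card_le_prod:
  assumes "finite B" "0 \<notin> (B :: nat set)"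
  shows "fact (card B) \<le> \<Prod>B"
  using assms
proof (induction B rule: finite_linorder_max_induct)
  case (insert b B)
  have "B \<subseteq> {1..<b}" using insert by (auto simp: Suc_le_eq intro!: Nat.gr0I)
  then have "card B \<le> b - 1" using card_mono[of "{1..<b}" B] by simp
  moreover have "b > 0" using insert.prems by (cases b) auto
  ultimately have "Suc (card B) \<le> b" by simp
  moreover have "b \<notin> B" using insert by auto
  moreover have "fact (card B) \<le> \<Prod>B" using insert by auto
  ultimately have "Suc (card B) * fact (card B) \<le> b * \<Prod>B" by (intro mult_mono) auto
  then show ?case using \<open>b \<notin> B\<close> insert.hyps by simp
qed simp

text \<open>A single term of the expansion of \<open>((1 - y) + y) ^ (h + M) = 1\<close> is at most
  1; \<open>y\<close> is left free for a later choice.\<close>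

lemma binomial_le_powr:
  assumes "0 < y" "y < (1::real)"
  shows "real ((h + M) choose M) \<le> (1 / y) ^ h * (1 / (1 - y)) ^ M"
proof -
  have "real ((h + M) choose M) * (1 - y) ^ M * y ^ ((h + M) - M) \<le> (\<Sum>j\<le>h + M. real ((h + M) choose j) * (1 - y) ^ j * y ^ ((h + M) - j))"
    using assms by (intro member_le_sum) auto
  also have "\<dots> = ((1 - y) + y) ^ (h + M)" by (rule binomial_ring[symmetric])
  finally have "real ((h + M) choose M) * ((1 - y) ^ M * y ^ h) \<le> 1" by (simp add: mult.assoc)
  then show ?thesis using assms by (simp add: power_divide field_simps)
qed

text \<open>Compares \<open>exp k\<close> with the term of index \<open>k\<close> of its own
  series.\<close>

lemma fact_gt_powr:
  assumes "k \<ge> 1"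
  shows "(real k / exp 1) ^ k < fact k"
proof -
  \<comment> \<open>Keeping the term of index 0 as well makes the inequality strict, which later
    yields the strict bound \<open>1 / exp 1 < R_low k\<close>.\<close>
  have "(\<Sum>n\<in>{0, k}. real k ^ n /\<^sub>R fact n) \<le> (\<Sum>n. real k ^ n /\<^sub>R fact n)"
    by (intro sum_le_suminf summable_exp_generic) auto
  then have "1 + real k ^ k / fact k \<le> exp (real k)"
    using assms by (simp add: exp_def divide_inverse mult.commute)
  then have "real k ^ k / fact k < exp (real k)" by simp
  then have "real k ^ k < exp (real k) * fact k" by (simp add: divide_less_eq)
  moreover have "exp (real k) = exp 1 ^ k" by (simp flip: exp_of_nat_mult)
  ultimately show ?thesis by (simp add: power_divide divide_less_eq mult.commute)
qed

text \<open>Taking \<open>q\<close>-th roots of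
  \<open>(q / e) ^ q \<le> e ^ q * B powr (a * q)\<close> with \<open>a = k - 1/2\<close> and
  \<open>B = 1 + h / q\<close> gives \<open>q \<le> e\<^sup>2 * B powr a\<close>. For
  \<open>q \<le> h\<close> this becomes \<open>q powr (1 + a) \<le> const * h powr a\<close>, whence
  the exponent \<open>a / (1 + a) = (2k - 1) / (2k + 1)\<close>.\<close>

lemma overlap_numeric_bound:
  assumes h: "h \<ge> 1" and q: "fact q \<le> (h + M) choose M" and M: "real M \<le> (real k - 1/2) * real q" and k: "k \<ge> 1"
  shows "real q \<le> exp 2 * 2 ^ k * real h powr ((2 * real k - 1) / (2 * real k + 1))"
proof (cases "q = 0")
  case False
  then have q0: "real q > 0" by simp
  define B where "B = (real h + real q) / real q"
  define a where "a = real k - 1/2"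
  have a: "a > 0" using k by (simp add: a_def)
  have B: "B \<ge> 1" using q0 by (simp add: B_def)
  \<comment> \<open>This \<open>y\<close> makes \<open>(1 / y) ^ h = (1 + q / h) ^ h\<close> at most
    \<open>exp q\<close>, while \<open>1 / (1 - y)\<close> becomes \<open>B\<close>.\<close>
  define y where "y = real h / (real h + real q)"
  have y: "0 < y" "y < 1" using h q0 by (auto simp: y_def)
  have y2: "1 / y = 1 + real q / real h" "1 / (1 - y) = B" using h q0 by (auto simp: y_def B_def field_simps)
  have "(1 / y) ^ h \<le> exp (real q / real h) ^ h"
    unfolding y2 using exp_ge_add_one_self[of "real q / real h"] by (intro power_mono) auto
  also have "\<dots> = exp (real q)" using h by (simp flip: exp_of_nat_mult)
  also have "\<dots> = exp 1 powr real q" by (simp add: powr_def)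
  finally have e1: "(1 / y) ^ h \<le> exp 1 powr real q" .
  have "(1 / (1 - y)) ^ M = B powr real M" unfolding y2 using B by (simp add: powr_realpow)
  also have "\<dots> \<le> B powr (a * real q)" using B M by (intro powr_mono) (auto simp: a_def)
  also have "\<dots> = (B powr a) powr real q" by (simp add: powr_powr)
  finally have e2: "(1 / (1 - y)) ^ M \<le> (B powr a) powr real q" .
  have "(real q / exp 1) powr real q = (real q / exp 1) ^ q" using q0 by (simp add: powr_realpow)
  also have "\<dots> \<le> fact q" using fact_gt_powr[of q] False by simp
  also have "\<dots> = real (fact q)" by simp
  also have "\<dots> \<le> real ((h + M) choose M)" using q by (rule of_nat_mono)
  also have "\<dots> \<le> (1 / y) ^ h * (1 / (1 - y)) ^ M" by (rule binomial_le_powr[OF y])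
  also have "\<dots> \<le> exp 1 powr real q * (B powr a) powr real q" using e1 e2 y by (intro mult_mono) auto
  also have "\<dots> = (exp 1 * B powr a) powr real q" by (simp add: powr_mult)
  finally have "real q / exp 1 \<le> exp 1 * B powr a"
    using powr_less_mono2[OF q0, of "exp 1 * B powr a" "real q / exp 1"] B by fastforce
  then have "real q \<le> exp 1 * (exp 1 * B powr a)" by (simp add: divide_le_eq mult.commute)
  also have "\<dots> = exp 2 * B powr a" by (simp flip: mult.assoc exp_add)
  finally have qB: "real q \<le> exp 2 * B powr a" .
  have h1: "real h powr ((2 * real k - 1) / (2 * real k + 1)) \<ge> 1" using h k by (intro ge_one_powr_ge_zero) auto
  have two: "2 powr a \<le> 2 ^ k"
  proof -
    have "2 powr a \<le> 2 powr real k" by (intro powr_mono) (auto simp: a_def)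
    then show ?thesis by (simp add: powr_realpow)
  qed
  show ?thesis
  proof (cases "q > h")
    case True
    \<comment> \<open>For \<open>q > h\<close> the base \<open>B\<close> is at most 2, so
      \<open>q\<close> is bounded by a constant.\<close>
    then have "B \<le> 2" using q0 by (simp add: B_def divide_le_eq)
    then have "B powr a \<le> 2 powr a" using B a by (intro powr_mono2) auto
    then have "exp 2 * B powr a \<le> exp 2 * 2 ^ k" using two by (intro mult_left_mono) auto
    then have "real q \<le> exp 2 * 2 ^ k * 1" using qB by linarith
    also have "\<dots> \<le> exp 2 * 2 ^ k * real h powr ((2 * real k - 1) / (2 * real k + 1))"
      by (intro mult_left_mono h1) auto
    finally show ?thesis .
  next
    case False
    then have "B \<le> 2 * real h / real q" using q0 by (simp add: B_def divide_right_mono)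
    then have "B powr a \<le> (2 * real h / real q) powr a" using B a by (intro powr_mono2) auto
    also have "\<dots> = 2 powr a * real h powr a / real q powr a" using q0 by (simp add: powr_mult powr_divide)
    also have "\<dots> \<le> 2 ^ k * real h powr a / real q powr a" using two by (intro divide_right_mono mult_right_mono) auto
    finally have "exp 2 * B powr a \<le> exp 2 * (2 ^ k * real h powr a / real q powr a)"
      by (rule mult_left_mono) simp
    with qB have "real q \<le> exp 2 * 2 ^ k * real h powr a / real q powr a" by simp
    then have "real q * real q powr a \<le> exp 2 * 2 ^ k * real h powr a" using q0 by (simp add: le_divide_eq)
    then have *: "real q powr (1 + a) \<le> exp 2 * 2 ^ k * real h powr a" using q0 by (simp add: powr_add)
    have "real q = (real q powr (1 + a)) powr (1 / (1 + a))" using q0 a by (simp add: powr_powr)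
    also have "\<dots> \<le> (exp 2 * 2 ^ k * real h powr a) powr (1 / (1 + a))" using * a by (intro powr_mono2) auto
    also have "\<dots> = (exp 2 * 2 ^ k) powr (1 / (1 + a)) * real h powr (a / (1 + a))" by (simp add: powr_mult powr_powr)
    also have "\<dots> \<le> (exp 2 * 2 ^ k) powr 1 * real h powr (a / (1 + a))"
    proof (intro mult_right_mono powr_mono)
      have "1 * 1 \<le> exp 2 * (2::real) ^ k" by (intro mult_mono) auto
      then show "1 \<le> exp 2 * (2::real) ^ k" by simp
    qed (use a in auto)
    also have "a / (1 + a) = (2 * real k - 1) / (2 * real k + 1)" by (simp add: a_def field_simps)
    finally show ?thesis by simp
  qed
qed simp

text \<open>One summand reaches at most \<open>k + 1\<close> residues. Hence each large prime has a
  positive price \<open>h_cyc p k - 1\<close>.\<close>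

lemma h_cyc_ge_2:
  assumes "1 \<le> k" "N \<ge> (2 ^ k + 1) ^ k"
  shows "h_cyc N k \<ge> 2"
proof (rule ccontr)
  assume "\<not> h_cyc N k \<ge> 2"
  with h_cyc_spec(1)[OF assms] have 1: "h_cyc N k = 1" by simp
  obtain A where A: "A \<subseteq> {1..<N}" "card A = k" "zsumset N 1 (insert 0 A) = {0..<N}"
    using h_cyc_spec(3)[OF assms] unfolding 1 by blast
  have "finite A" "0 \<notin> A" using A(1) finite_subset by auto
  then have "N \<le> (1 + k) choose k" using zsumset_full_card[OF A(3)] A(2) by simp
  also have "\<dots> = k + 1" by simp
  also have "\<dots> < 2 ^ k + 1" by simp
  also have "\<dots> \<le> (2 ^ k + 1) ^ k" using assms(1) by (intro self_le_power) auto
  finally show False using assms(2) by simp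
qed

text \<open>\<open>T\<close> consists of the primes above \<open>k\<close> that belong to the
  disjoint members. The term \<open>k\<close> pays for the primes up to \<open>k\<close>, the power
  of \<open>h\<close> for the overlapping members.\<close>

theorem essential_family_bound:
  assumes A: "basis_of_order A h" and k: "1 \<le> k" and S: "finite S" "\<And>E. E \<in> S \<Longrightarrow> essential_subset A E \<and> card E = k"
  shows "\<exists>T. finite T \<and> (\<forall>p\<in>T. prime p) \<and> (\<Sum>p\<in>T. h_cyc p k - 1) \<le> h \<and>
     real (card S) \<le> real (card T) + real k + exp 2 * 2 ^ k * real h powr ((2 * real k - 1) / (2 * real k + 1))"
proof -
  have cof: "cofinite_pos (sumset h A)" and h: "h \<ge> 1" using A by (auto simp: basis_of_order_def)
  have bas: "is_basis A" using A by (auto simp: is_basis_def)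
  have "\<exists>p c. E \<in> S \<longrightarrow> prime p \<and> E = {a\<in>A. a mod p \<noteq> c mod (p::nat)}" for E
    using essential_subset_residue S(2) by blast
  then obtain P C where PC: "\<And>E. E \<in> S \<Longrightarrow> prime (P E)" "\<And>E. E \<in> S \<Longrightarrow> E = {a\<in>A. a mod P E \<noteq> C E mod P E}"
    by metis
  have fin: "finite E" if "E \<in> S" for E using S(2)[OF that] by (simp add: essential_subset_def)
  have inj: "inj_on P S"
  proof (rule inj_onI)
    fix E E' assume E: "E \<in> S" "E' \<in> S" "P E = P E'"
    \<comment> \<open>The infinite set \<open>A\<close> has an element outside both finite sets. It
      lies in both main classes, so equal primes give equal classes and then equal sets.\<close>
    have "infinite (A - (E \<union> E'))" using is_basis_infinite[OF bas] fin E by (intro Diff_infinite_finite) auto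
    then obtain a where a: "a \<in> A" "a \<notin> E" "a \<notin> E'" using infinite_imp_nonempty by blast
    have "a mod P E = C E mod P E" using a PC(2)[OF E(1)] by blast
    moreover have "a mod P E' = C E' mod P E'" using a PC(2)[OF E(2)] by blast
    ultimately have "C E mod P E = C E' mod P E'" using E(3) by simp
    then show "E = E'" using PC(2)[OF E(1)] PC(2)[OF E(2)] E(3) by simp
  qed
  define I where "I = {E\<in>S. \<exists>E'\<in>S. E' \<noteq> E \<and> E \<inter> E' \<noteq> {}}"
  define J where "J = S - I"
  define T where "T = P ` {E\<in>J. k < P E}"
  have sub: "I \<subseteq> S" "J \<subseteq> S" by (auto simp: I_def J_def)
  have "fact (card I) \<le> \<Prod>(P ` I)"
  proof -
    have "card (P ` I) = card I" using inj sub by (intro card_image) (auto intro: inj_on_subset)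
    moreover have "0 \<notin> P ` I" using PC(1) sub by (metis imageE not_prime_0 subsetD)
    ultimately show ?thesis using fact_card_le_prod[of "P ` I"] S(1) sub finite_subset by (metis finite_imageI)
  qed
  also have "\<dots> = (\<Prod>E\<in>I. P E)" using inj sub by (intro prod.reindex_cong[OF _ refl]) (auto intro: inj_on_subset)
  also have "\<dots> \<le> (h + card (\<Union>I)) choose card (\<Union>I)"
    by (rule prod_moduli_le_binomial[OF cof, where C = C])
      (use inj sub S(1) PC fin in \<open>auto intro: inj_on_subset finite_subset simp: subset_iff\<close>)
  finally have q: "fact (card I) \<le> (h + card (\<Union>I)) choose card (\<Union>I)" .
  have "real (card (\<Union>I)) \<le> (real k - 1/2) * real (card I)"
  proof (rule card_Union_overlapping_le)
    show "finite I" using S(1) sub finite_subset by blast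
    show "finite E \<and> card E = k" if "E \<in> I" for E using that sub S(2) fin by blast
    fix E assume "E \<in> I"
    then obtain E' where E': "E \<in> S" "E' \<in> S" "E' \<noteq> E" "E \<inter> E' \<noteq> {}" by (auto simp: I_def)
    then have "E' \<in> I" unfolding I_def by blast
    then show "\<exists>E'\<in>I. E' \<noteq> E \<and> E \<inter> E' \<noteq> {}" using E' by blast
  qed
  from overlap_numeric_bound[OF h q this k]
  have cI: "real (card I) \<le> exp 2 * 2 ^ k * real h powr ((2 * real k - 1) / (2 * real k + 1))" .
  have finJ: "finite J" using S(1) sub finite_subset by blast
  have injJ: "inj_on P J" using inj sub by (auto intro: inj_on_subset)
  have "(\<Sum>E\<in>{E\<in>J. k < P E}. h_cyc (P E) k - 1) \<le> h"
  proof (rule sum_h_cyc_disjoint_le[OF cof finJ injJ, where C = C])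
    show "prime (P E)" if "E \<in> J" for E using PC(1) sub that by blast
    show "finite E \<and> card E = k \<and> E = {a\<in>A. a mod P E \<noteq> C E mod P E}" if "E \<in> J" for E
      using that sub fin S(2) PC(2)[of E] by blast
    show "E \<inter> E' = {}" if "E \<in> J" "E' \<in> J" "E \<noteq> E'" for E E' using that by (auto simp: J_def I_def)
  qed
  also have "(\<Sum>E\<in>{E\<in>J. k < P E}. h_cyc (P E) k - 1) = (\<Sum>p\<in>T. h_cyc p k - 1)"
    unfolding T_def by (rule sum.reindex_cong[OF _ refl, symmetric]) (use injJ in \<open>auto intro: inj_on_subset\<close>)
  finally have cost: "(\<Sum>p\<in>T. h_cyc p k - 1) \<le> h" .
  have "card S = card I + card J"
    unfolding J_def using S(1) sub(1) by (metis card_Diff_subset card_mono finite_subset le_add_diff_inverse)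
  moreover have "card J \<le> card T + k"
  proof -
    have "card J = card (P ` J)" using injJ by (simp add: card_image)
    also have "P ` J \<subseteq> T \<union> {1..k}"
    proof safe
      fix E assume E: "E \<in> J" "P E \<notin> {1..k}"
      then have "P E > 0" using PC(1) sub by (meson prime_gt_0_nat subsetD)
      then show "P E \<in> T" using E by (auto simp: T_def)
    qed
    then have "card (P ` J) \<le> card (T \<union> {1..k})" using finJ by (intro card_mono) (auto simp: T_def)
    also have "\<dots> \<le> card T + k" using card_Un_le[of T "{1..k}"] by simp
    finally show ?thesis .
  qed
  ultimately have "real (card S) \<le> real (card T) + real k + exp 2 * 2 ^ k * real h powr ((2 * real k - 1) / (2 * real k + 1))"
    using cI by linarith
  moreover have "finite T" using finJ by (simp add: T_def)
  moreover have "\<forall>p\<in>T. prime p" using PC(1) sub by (auto simp: T_def)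
  ultimately show ?thesis using cost by blast
qed

text \<open>Every prime above the threshold costs at least 1, which gives a bound depending on
  \<open>h\<close> and \<open>k\<close> only. This uniformity makes the supremum of naturals in
  \<open>E_max\<close> meaningful.\<close>

lemma essential_family_crude_bound:
  assumes A: "basis_of_order A h" and k: "1 \<le> k" and S: "finite S" "\<And>E. E \<in> S \<Longrightarrow> essential_subset A E \<and> card E = k"
  shows "real (card S) \<le> real (h + (2 ^ k + 1) ^ k) + real k + exp 2 * 2 ^ k * real h powr ((2 * real k - 1) / (2 * real k + 1))"
proof -
  let ?N = "(2 ^ k + 1) ^ k :: nat"
  obtain T where T: "finite T" "(\<Sum>p\<in>T. h_cyc p k - 1) \<le> h"
     "real (card S) \<le> real (card T) + real k + exp 2 * 2 ^ k * real h powr ((2 * real k - 1) / (2 * real k + 1))"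
    using essential_family_bound[OF assms] by auto
  have "card T \<le> card ({p\<in>T. p \<ge> ?N} \<union> {..<?N})" using T(1) by (intro card_mono) auto
  also have "\<dots> \<le> card {p\<in>T. p \<ge> ?N} + ?N" using card_Un_le[of "{p\<in>T. p \<ge> ?N}" "{..<?N}"] by simp
  also have "card {p\<in>T. p \<ge> ?N} \<le> (\<Sum>p\<in>{p\<in>T. p \<ge> ?N}. h_cyc p k - 1)"
    using sum_mono[of "{p\<in>T. p \<ge> ?N}" "\<lambda>_. 1" "\<lambda>p. h_cyc p k - 1"] h_cyc_ge_2[OF k] by fastforce
  also have "\<dots> \<le> (\<Sum>p\<in>T. h_cyc p k - 1)" using T(1) by (intro sum_mono2) auto
  finally have "card T \<le> h + ?N" using T(2) by linarith
  then have "real (card T) \<le> real (h + ?N)" by (rule of_nat_mono)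
  then show ?thesis using T(3) by linarith
qed

text \<open>\<open>card\<close> is 0 on infinite sets, so finiteness must be known before the family
  is counted. An infinite family would have finite subfamilies exceeding the uniform bound.\<close>

lemma finite_essential_subsets:
  assumes "basis_of_order A h" "1 \<le> k"
  shows "finite {E. essential_subset A E \<and> card E = k}"
proof (rule ccontr)
  let ?B = "real (h + (2 ^ k + 1) ^ k) + real k + exp 2 * 2 ^ k * real h powr ((2 * real k - 1) / (2 * real k + 1))"
  assume "infinite {E. essential_subset A E \<and> card E = k}"
  then obtain S where S: "finite S" "card S = nat \<lceil>?B\<rceil> + 1" "S \<subseteq> {E. essential_subset A E \<and> card E = k}"
    using infinite_arbitrarily_large by blast
  then have "real (card S) \<le> ?B" using essential_family_crude_bound[OF assms S(1)] by blast
  then show False unfolding S(2) by linarith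
qed

section \<open>The supremum E(h,k)\<close>

lemma E_max_le:
  assumes "\<And>A. basis_of_order A h \<Longrightarrow> real (card {E. essential_subset A E \<and> card E = k}) \<le> B" "0 \<le> B"
  shows "real (E_max h k) \<le> B"
proof (cases "{card {E. essential_subset A E \<and> card E = k} | A. basis_of_order A h} = {}")
  case True
  \<comment> \<open>If no basis of order \<open>h\<close> exists, the supremum of the empty set of
    naturals is 0; this is where \<open>0 \<le> B\<close> enters.\<close>
  then show ?thesis using assms(2) by (simp only: E_max_def Sup_nat_empty of_nat_0)
next
  case False
  have "E_max h k \<le> nat \<lfloor>B\<rfloor>"
    unfolding E_max_def using False assms(1) by (intro cSup_least) (auto intro!: le_nat_floor)
  then have "real (E_max h k) \<le> real (nat \<lfloor>B\<rfloor>)" by (rule of_nat_mono)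
  also have "\<dots> \<le> B" using assms(2) by simp
  finally show ?thesis .
qed

text \<open>The supremum is an upper bound because the crude bound is uniform in
  \<open>A\<close>.\<close>

lemma card_le_E_max:
  assumes "basis_of_order A h" "1 \<le> k" "\<And>E. E \<in> S \<Longrightarrow> essential_subset A E \<and> card E = k"
  shows "card S \<le> E_max h k"
proof -
  let ?B = "real (h + (2 ^ k + 1) ^ k) + real k + exp 2 * 2 ^ k * real h powr ((2 * real k - 1) / (2 * real k + 1))"
  have "bdd_above {card {E. essential_subset A E \<and> card E = k} | A. basis_of_order A h}"
  proof (rule bdd_aboveI)
    fix n assume "n \<in> {card {E. essential_subset A E \<and> card E = k} | A. basis_of_order A h}"
    then obtain A where A: "basis_of_order A h" "n = card {E. essential_subset A E \<and> card E = k}" by blast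
    then have "real n \<le> ?B" using essential_family_crude_bound[OF A(1) assms(2) finite_essential_subsets[OF A(1) assms(2)]] by blast
    then show "n \<le> nat \<lfloor>?B\<rfloor>" by (rule le_nat_floor)
  qed
  then have "card {E. essential_subset A E \<and> card E = k} \<le> E_max h k"
    unfolding E_max_def using assms(1) by (intro cSup_upper) auto
  moreover have "card S \<le> card {E. essential_subset A E \<and> card E = k}"
    using finite_essential_subsets[OF assms(1,2)] assms(3) by (intro card_mono) auto
  ultimately show ?thesis by linarith
qed

section \<open>Bases with prescribed essential subsets\<close>

lemma sumset_interval:
  assumes "{u..v} \<subseteq> B" "i * u \<le> n" "n \<le> i * v"
  shows "n \<in> sumset i B"
  using assms(2,3)
proof (induction i arbitrary: n)
  case (Suc i)
  have "Suc i * u \<le> Suc i * v" using Suc.prems by linarith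
  then have uv: "u \<le> v" by (simp only: Suc_mult_le_cancel1)
  \<comment> \<open>Greedy choice: the last summand is as large as possible while leaving at least
    \<open>i * u\<close> for the others.\<close>
  define c where "c = min v (n - i * u)"
  have c: "u \<le> c" "c \<le> v" "c \<le> n" using Suc.prems uv by (auto simp: c_def)
  have "i * u \<le> i * v" using uv by simp
  then have "i * u \<le> n - c" "n - c \<le> i * v" using Suc.prems by (auto simp: c_def min_def)
  then have "n - c \<in> sumset i B" by (rule Suc.IH)
  moreover have "c \<in> B" using assms(1) c by auto
  moreover have "n = (n - c) + c" using c by simp
  ultimately show ?case unfolding sumset_Suc by blast
qed simp

text \<open>A set of order exactly g whose shorter sumsets have unbounded gaps: the block lengths are
  tuned so that g elements of one block just reach the next block.\<close>

definition gap_ratio :: "nat \<Rightarrow> nat" where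
  "gap_ratio g = 2 * g * (g - 1) + g + 1"

definition block_set :: "nat \<Rightarrow> nat set" where
  "block_set g = {b. \<exists>j. gap_ratio g ^ j \<le> b \<and> b \<le> 2 * g * gap_ratio g ^ j}"

lemma one_in_block_set: "g \<ge> 1 \<Longrightarrow> 1 \<in> block_set g" and two_in_block_set: "g \<ge> 1 \<Longrightarrow> 2 \<in> block_set g"
  by (auto simp: block_set_def intro!: exI[of _ 0])

lemma block_set_pos: "b \<in> block_set g \<Longrightarrow> b > 0"
proof -
  assume "b \<in> block_set g"
  then obtain j where "gap_ratio g ^ j \<le> b" by (auto simp: block_set_def)
  moreover have "gap_ratio g ^ j > 0" by (simp add: gap_ratio_def)
  ultimately show "b > 0" by linarith
qed

text \<open>Let \<open>a = gap_ratio g\<close> and \<open>g * a ^ j \<le> n < g * a ^ Suc j\<close>.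
  Either \<open>g\<close> elements of block \<open>j\<close> suffice, or \<open>i\<close> elements
  of block \<open>j + 1\<close> are combined with \<open>g - i\<close> copies of
  \<open>a ^ j\<close>.\<close>

lemma block_set_cover:
  assumes g: "g \<ge> 1" and n: "n \<ge> g"
  shows "n \<in> sumset g (block_set g)"
proof -
  define a where "a = gap_ratio g"
  have a: "a \<ge> 2" using g by (simp add: a_def gap_ratio_def)
  have block: "{a ^ j..2 * g * a ^ j} \<subseteq> block_set g" for j
    by (auto simp: block_set_def a_def)
  have "n < a ^ n" using a by (metis less_exp less_le_trans power_mono zero_le_numeral)
  then have "n < g * a ^ n" using g by (metis less_le_trans mult_le_mono1 nat_mult_1)
  then have ex: "\<exists>j. n < g * a ^ j" by blast
  define J where "J = (LEAST j. n < g * a ^ j)"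
  have J1: "n < g * a ^ J" unfolding J_def by (rule LeastI_ex[OF ex])
  have "J \<noteq> 0" using J1 n by (cases J) auto
  then obtain j where j: "J = Suc j" using not0_implies_Suc by blast
  have J2: "g * a ^ j \<le> n" using not_less_Least[of j "\<lambda>j. n < g * a ^ j"] j unfolding J_def[symmetric] by simp
  define u where "u = a ^ j"
  have u: "u \<ge> 1" using a by (simp add: u_def)
  show ?thesis
  proof (cases "n \<le> g * (2 * g * u)")
    case True
    then show ?thesis using J2 by (intro sumset_interval[OF block[of j]]) (auto simp: u_def)
  next
    case False
    \<comment> \<open>\<open>\<delta>\<close> is the increase of the sum when one copy of
      \<open>a ^ j\<close> is replaced by \<open>a ^ Suc j\<close>.\<close>
    define \<delta> where "\<delta> = (a - 1) * u"
    have au: "a * u = u + \<delta>" using a by (simp add: \<delta>_def diff_mult_distrib)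
    have gu: "g * u \<le> n" using J2 by (simp add: u_def)
    have \<delta>0: "\<delta> > 0" using a u by (simp add: \<delta>_def)
    have "g * a ^ J = g * (a * u)" by (simp add: j u_def)
    also have "\<dots> = g * u + g * \<delta>" by (simp only: au distrib_left)
    finally have nlt: "n < g * u + g * \<delta>" using J1 by simp
    \<comment> \<open>The largest number of such replacements that keeps the sum at most
      \<open>n\<close>; the rest, less than \<open>\<delta>\<close>, is absorbed by the length of
      the higher block.\<close>
    define i where "i = (n - g * u) div \<delta>"
    have i1: "i * \<delta> + g * u \<le> n" using gu unfolding i_def by (metis div_times_less_eq_dividend le_diff_conv2)
    have i2: "n < (i + 1) * \<delta> + g * u"
    proof -
      have "n - g * u < (i + 1) * \<delta>" unfolding i_def using \<delta>0 dividend_less_div_times[of \<delta> "n - g * u"] by simp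
      then show ?thesis using gu by linarith
    qed
    have "i < g" unfolding i_def using nlt gu \<delta>0 by (subst div_less_iff_less_mult) linarith+
    \<comment> \<open>This identity is the tuning of \<open>gap_ratio\<close>: the largest sum of
      \<open>g\<close> elements of one block equals the smallest sum of \<open>g - 1\<close>
      elements of that block and one of the next.\<close>
    have eq: "\<delta> + g * u = g * (2 * g * u)"
    proof -
      obtain g' where g': "g = Suc g'" using g by (cases g) auto
      show ?thesis by (simp add: \<delta>_def a_def gap_ratio_def g' algebra_simps)
    qed
    have "\<delta> + g * u \<le> n" using False eq by simp
    then have "i \<ge> 1" unfolding i_def using \<delta>0 by (simp add: less_eq_div_iff_mult_less_eq le_diff_conv2 gu)
    define n1 where "n1 = n - (g - i) * u"
    have gi: "(g - i) * u + i * u = g * u" using \<open>i < g\<close> by (simp flip: add_mult_distrib)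
    have n1: "n = n1 + (g - i) * u" using gi gu by (simp add: n1_def)
    have "i * (a * u) \<le> n1" using i1 n1 gi by (simp add: au algebra_simps)
    moreover have "n1 \<le> i * (2 * g * (a * u))"
    proof -
      have "n1 \<le> i * (u + \<delta>) + \<delta>" using i2 n1 gi by (simp add: algebra_simps)
      also have "\<dots> \<le> i * (u + \<delta>) + i * (u + \<delta>)" using \<open>i \<ge> 1\<close> by (intro add_mono) (auto intro: order_trans[of _ "1 * (u + \<delta>)"] mult_le_mono1)
      also have "\<dots> = i * (2 * (a * u))" by (simp add: au algebra_simps)
      also have "\<dots> \<le> i * (2 * g * (a * u))" using g by (intro mult_le_mono2) (simp add: mult_le_mono1)
      finally show ?thesis .
    qed
    ultimately have "n1 \<in> sumset i (block_set g)"
      by (intro sumset_interval[OF block[of "Suc j"]]) (auto simp: u_def)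
    moreover have "u \<in> block_set g" using block[of j] u g by (auto simp: u_def)
    then have "(g - i) * u \<in> sumset (g - i) (block_set g)" by (rule sumset_mult)
    ultimately have "n1 + (g - i) * u \<in> sumset (i + (g - i)) (block_set g)" by (rule sumset_add)
    then show ?thesis using n1 \<open>i < g\<close> by simp
  qed
qed

text \<open>Since 1 belongs to the set, surplus summands can be spent one unit each.\<close>

lemma block_set_cover_ge:
  assumes "g \<ge> 1" "g \<le> t" "n \<ge> t"
  shows "n \<in> sumset t (block_set g)"
proof -
  have "n - (t - g) \<in> sumset g (block_set g)" using assms by (intro block_set_cover) auto
  moreover have "(t - g) * 1 \<in> sumset (t - g) (block_set g)" by (intro sumset_mult one_in_block_set assms)
  ultimately have "(n - (t - g)) + (t - g) * 1 \<in> sumset (g + (t - g)) (block_set g)" by (rule sumset_add)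
  then show ?thesis using assms by simp
qed

text \<open>Without an element of a later block the sum stays within the reach of
  \<open>g - 1\<close> elements of block \<open>j\<close>; with one it is at least
  \<open>gap_ratio g ^ Suc j\<close>.\<close>

lemma block_set_gap:
  assumes "t \<le> g - 1" "n \<in> sumset t (block_set g)"
  shows "n \<le> (g - 1) * (2 * g * gap_ratio g ^ j) \<or> gap_ratio g ^ Suc j \<le> n"
proof -
  have "n \<le> t * (2 * g * gap_ratio g ^ j) \<or> gap_ratio g ^ Suc j \<le> n"
    using assms(2)
  proof (induction t arbitrary: n)
    case (Suc t)
    then obtain s b where sb: "s \<in> sumset t (block_set g)" "b \<in> block_set g" "n = s + b" by (auto simp: sumset_Suc)
    obtain i where i: "gap_ratio g ^ i \<le> b" "b \<le> 2 * g * gap_ratio g ^ i" using sb(2) by (auto simp: block_set_def)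
    have a: "gap_ratio g \<ge> 1" by (simp add: gap_ratio_def)
    show ?case
    proof (cases "i \<le> j")
      case True
      then have "2 * g * gap_ratio g ^ i \<le> 2 * g * gap_ratio g ^ j" using a by (intro mult_le_mono2 power_increasing) auto
      then have "b \<le> 2 * g * gap_ratio g ^ j" using i by linarith
      then show ?thesis using Suc.IH[OF sb(1)] sb(3) by auto
    next
      case False
      then have "gap_ratio g ^ Suc j \<le> gap_ratio g ^ i" using a by (intro power_increasing) auto
      then show ?thesis using i sb(3) by linarith
    qed
  qed simp
  moreover have "t * (2 * g * gap_ratio g ^ j) \<le> (g - 1) * (2 * g * gap_ratio g ^ j)" using assms(1) by (rule mult_le_mono1)
  ultimately show ?thesis by linarith
qed

section \<open>Combining a finite part with multiples of P\<close>

lemma sumset_Un_split: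
  assumes "n \<in> sumset h (E \<union> (\<lambda>b. P * b) ` B)"
  shows "\<exists>t\<le>h. \<exists>e\<in>sumset t E. \<exists>b\<in>sumset (h - t) B. n = e + P * b"
  using assms
proof (induction h arbitrary: n)
  case (Suc h)
  then obtain s a where sa: "s \<in> sumset h (E \<union> (\<lambda>b. P * b) ` B)" "a \<in> E \<union> (\<lambda>b. P * b) ` B" "n = s + a"
    by (auto simp: sumset_Suc)
  obtain t e b where teb: "t \<le> h" "e \<in> sumset t E" "b \<in> sumset (h - t) B" "s = e + P * b"
    using Suc.IH[OF sa(1)] by blast
  show ?case
  proof (cases "a \<in> E")
    case True
    then have "e + a \<in> sumset (Suc t) E" using teb unfolding sumset_Suc by blast
    then show ?thesis using teb sa by (intro exI[of _ "Suc t"] conjI bexI[of _ "e + a"] bexI[of _ b]) auto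
  next
    case False
    then obtain b' where b': "b' \<in> B" "a = P * b'" using sa by auto
    then have "b + b' \<in> sumset (Suc h - t) B" using teb unfolding Suc_diff_le[OF teb(1)] sumset_Suc by blast
    then show ?thesis using teb sa b' by (intro exI[of _ t] conjI bexI[of _ e] bexI[of _ "b + b'"]) (auto simp: algebra_simps)
  qed
qed simp

lemma sumset_insert_0:
  assumes "n \<in> sumset h (insert 0 A)"
  shows "\<exists>t\<le>h. n \<in> sumset t A"
  using assms
proof (induction h arbitrary: n)
  case (Suc h)
  then obtain s a where sa: "s \<in> sumset h (insert 0 A)" "a \<in> insert 0 A" "n = s + a" by (auto simp: sumset_Suc)
  obtain t where t: "t \<le> h" "s \<in> sumset t A" using Suc.IH[OF sa(1)] by blast
  show ?case
  proof (cases "a \<in> A")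
    case True
    then have "n \<in> sumset (Suc t) A" using t sa unfolding sumset_Suc by blast
    then show ?thesis using t by (intro exI[of _ "Suc t"]) auto
  next
    case False
    then show ?thesis using t sa by (intro exI[of _ t]) auto
  qed
qed simp

text \<open>The finite part E fixes the residue modulo P at a cost of exactly T elements in the worst
  case, and the thin set B is chosen to spend the remaining elements exactly.\<close>

lemma basis_of_exact_order:
  assumes E: "finite E" "0 \<notin> E" and P: "P > 1"
    and full: "\<And>r. \<exists>s\<in>sumset w (insert 0 E). [s = r] (mod P)" and h: "w < h"
  shows "\<exists>B. 0 \<notin> B \<and> 1 \<in> B \<and> 2 \<in> B \<and> basis_of_order (E \<union> (\<lambda>b. P * b) ` B) h"
proof -
  define good where "good = (\<lambda>t. \<forall>r. \<exists>s\<in>sumset t (insert 0 E). [s = r] (mod P))"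
  define T where "T = (LEAST t. good t)"
  have gw: "good w" using full by (simp add: good_def)
  have gT: "good T" unfolding T_def by (rule LeastI[of good, OF gw])
  have Tw: "T \<le> w" unfolding T_def by (rule Least_le[of good, OF gw])
  have "\<not> good 0"
  proof
    assume "good 0"
    then have "[0 = 1] (mod P)" by (auto simp: good_def)
    then show False using P by (simp add: cong_def)
  qed
  then have T0: "T > 0" using gT by (cases T) auto
  then have "\<not> good (T - 1)" using not_less_Least[of "T - 1" good] unfolding T_def by simp
  \<comment> \<open>A residue out of reach of \<open>T - 1\<close> elements; it forces at least
    \<open>T\<close> elements of \<open>E\<close> to be used in the argument that
    \<open>h - 1\<close> summands are too few.\<close>
  then obtain r where r: "\<And>s. s \<in> sumset (T - 1) (insert 0 E) \<Longrightarrow> \<not> [s = r] (mod P)" by (auto simp: good_def)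
  define g where "g = h - T"
  have g: "g \<ge> 1" "h = T + g" using Tw h by (auto simp: g_def)
  define B where "B = block_set g"
  define A where "A = E \<union> (\<lambda>b. P * b) ` B"
  have B0: "0 \<notin> B" "1 \<in> B" "2 \<in> B"
    using g(1) one_in_block_set two_in_block_set block_set_pos[of 0 g] by (auto simp: B_def)
  have A0: "0 \<notin> A" using E B0 P by (auto simp: A_def)
  have "finite (sumset T (insert 0 E))" using E by (intro finite_sumset) auto
  then have smax: "s \<le> Max (sumset T (insert 0 E))" if "s \<in> sumset T (insert 0 E)" for s
    using that by (rule Max_ge)
  define smax where "smax = Max (sumset T (insert 0 E))"
  note smax = smax[folded smax_def]
  have cover: "n \<in> sumset h A" if n: "n \<ge> smax + P * h" for n
  proof -
    obtain s where s: "s \<in> sumset T (insert 0 E)" "[s = n] (mod P)" using gT by (auto simp: good_def)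
    obtain t where t: "t \<le> T" "s \<in> sumset t E" using sumset_insert_0[OF s(1)] by blast
    have "s \<le> n" using smax[OF s(1)] n by linarith
    then have "P dvd n - s" using s(2) by (metis cong_sym cong_altdef_nat)
    then obtain q where q: "n - s = P * q" by blast
    have "P * h \<le> P * q" using smax[OF s(1)] n q by linarith
    then have "h \<le> q" using P by simp
    \<comment> \<open>A representation may use only \<open>t \<le> T\<close> elements of
      \<open>E\<close>; the remaining \<open>h - t \<ge> g\<close> summands are all spent on
      \<open>B\<close>.\<close>
    then have "q \<in> sumset (h - t) B" unfolding B_def using t(1) g by (intro block_set_cover_ge) auto
    then have "P * q \<in> sumset (h - t) ((\<lambda>b. P * b) ` B)"
    proof (induction "h - t" arbitrary: q t)
      case 0
      then show ?case by simp
    next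
      case (Suc m)
      obtain s' b where sb: "s' \<in> sumset m B" "b \<in> B" "q = s' + b" using Suc.prems Suc.hyps(2)[symmetric] by (auto simp: sumset_Suc)
      have "P * s' \<in> sumset m ((\<lambda>b. P * b) ` B)" using Suc.hyps(1)[of "h - m" s'] Suc.hyps(2) sb by auto
      then show ?case unfolding Suc.hyps(2)[symmetric] sumset_Suc using sb by (auto simp: distrib_left)
    qed
    then have "s + P * q \<in> sumset (t + (h - t)) A"
      using t by (intro sumset_add) (auto simp: A_def intro: subsetD[OF sumset_mono])
    moreover have "t + (h - t) = h" "s + P * q = n" using t g q \<open>s \<le> n\<close> by linarith+
    ultimately show ?thesis by simp
  qed
  have "cofinite_pos (sumset h A)"
    unfolding cofinite_pos_def
  proof (rule finite_subset)
    show "{n. 0 < n \<and> n \<notin> sumset h A} \<subseteq> {..smax + P * h}"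
      using cover by (metis (mono_tags, lifting) atMost_iff linorder_le_cases mem_Collect_eq subsetI)
  qed simp
  moreover have "\<not> cofinite_pos (sumset (h - 1) A)"
  proof
    assume "cofinite_pos (sumset (h - 1) A)"
    then obtain bd where bd: "\<And>n. 0 < n \<Longrightarrow> n \<notin> sumset (h - 1) A \<Longrightarrow> n < bd"
      unfolding cofinite_pos_def finite_nat_set_iff_bounded by auto
    have "finite (\<Union>t\<le>h. sumset t E)" using E finite_sumset by blast
    then have emax: "e \<le> Max (\<Union>t\<le>h. sumset t E)" if "e \<in> (\<Union>t\<le>h. sumset t E)" for e
      using that by (rule Max_ge)
    define emax where "emax = Max (\<Union>t\<le>h. sumset t E)"
    note emax = emax[folded emax_def]
    define a where "a = gap_ratio g"
    \<comment> \<open>Large enough that \<open>a ^ j\<close> exceeds both the last exception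
      \<open>bd\<close> and every contribution \<open>emax\<close> of \<open>E\<close>, which
      therefore cannot bridge a gap.\<close>
    define j where "j = bd + emax + 1"
    have "a \<ge> 2" using g by (simp add: a_def gap_ratio_def)
    then have "(2::nat) ^ j \<le> a ^ j" by (intro power_mono) auto
    then have aj: "a ^ j > bd + emax + 1" using less_exp[of j] by (simp add: j_def)
    \<comment> \<open>The residue \<open>r\<close> leaves at most \<open>g - 1\<close> summands for
      \<open>B\<close>. The multiplier of \<open>P\<close> lies \<open>a ^ j\<close> above their
      reach from block \<open>j\<close> and \<open>g * a ^ j\<close> below block
      \<open>j + 1\<close>, hence inside the gap.\<close>
    define n where "n = P * ((g - 1) * (2 * g * a ^ j) + a ^ j) + r mod P"
    have "P * a ^ j \<ge> 1 * a ^ j" using P by (intro mult_le_mono1) auto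
    then have Pa: "P * a ^ j > bd + emax + 1" using aj by linarith
    have nexp: "n = P * ((g - 1) * (2 * g * a ^ j)) + P * a ^ j + r mod P" by (simp add: n_def distrib_left)
    have "n > bd" using nexp Pa by linarith
    then have "n \<in> sumset (h - 1) A" using bd[of n] by (cases "n = 0") auto
    then obtain t e b where teb: "t \<le> h - 1" "e \<in> sumset t E" "b \<in> sumset (h - 1 - t) B" "n = e + P * b"
      using sumset_Un_split unfolding A_def by blast
    have "[n = r] (mod P)" by (simp add: n_def cong_def)
    then have "[e = r] (mod P)" unfolding teb(4) by (simp add: cong_def)
    have "t \<ge> T"
    proof (rule ccontr)
      assume "\<not> t \<ge> T"
      then have "e \<in> sumset (T - 1) (insert 0 E)" by (intro sumset_insert_0_mono[OF teb(2)]) auto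
      then show False using r \<open>[e = r] (mod P)\<close> by blast
    qed
    then have "h - 1 - t \<le> g - 1" using g by linarith
    from block_set_gap[OF this teb(3)[unfolded B_def], of j]
    have "b \<le> (g - 1) * (2 * g * a ^ j) \<or> a ^ Suc j \<le> b" by (simp only: a_def)
    then show False
    proof
      assume "b \<le> (g - 1) * (2 * g * a ^ j)"
      then have "P * b \<le> P * ((g - 1) * (2 * g * a ^ j))" by (rule mult_le_mono2)
      moreover have "e \<le> emax" using teb by (intro emax UN_I[of t]) auto
      ultimately show False using teb(4) nexp Pa by linarith
    next
      assume "a ^ Suc j \<le> b"
      then have "P * a ^ Suc j \<le> P * b" by (rule mult_le_mono2)
      also have "\<dots> \<le> n" using teb(4) by simp
      also have "a ^ Suc j = (g - 1) * (2 * g * a ^ j) + a ^ j + g * a ^ j"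
      proof -
        have "gap_ratio g * X = (g - 1) * (2 * g * X) + X + g * X" for X
          using g(1) by (cases g) (simp_all add: gap_ratio_def algebra_simps)
        then show ?thesis unfolding a_def power_Suc .
      qed
      finally have "P * (g * a ^ j) \<le> r mod P" unfolding n_def by (simp add: distrib_left)
      moreover have "P * (g * a ^ j) \<ge> P * (1 * 1)" using g aj by (intro mult_le_mono2 mult_le_mono) auto
      moreover have "r mod P < P" using P by simp
      ultimately show False by linarith
    qed
  qed
  ultimately have "basis_of_order A h" using A0 g T0 by (simp add: basis_of_order_def)
  then show ?thesis using B0 unfolding A_def by blast
qed

text \<open>A lift of a residue modulo \<open>p\<close> that vanishes modulo the other primes, so
  that it disturbs neither their classes nor their sums.\<close>

lemma crt_element:
  assumes "finite S" "\<And>q. q \<in> S \<Longrightarrow> prime (q::nat)" "p \<in> S"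
  shows "\<exists>x. [x = a] (mod p) \<and> (\<forall>q\<in>S - {p}. [x = 0] (mod q))"
proof -
  have "\<forall>i\<in>S. \<forall>j\<in>S. i \<noteq> j \<longrightarrow> coprime i j" using assms(2) by (auto intro!: primes_coprime)
  then obtain x where x: "\<forall>i\<in>S. [x = (if i = p then a else 0)] (mod i)"
    using chinese_remainder_nat[OF assms(1), of "\<lambda>i. i" "\<lambda>i. if i = p then a else 0"] by blast
  have "[x = a] (mod p)" using bspec[OF x assms(3)] by simp
  moreover have "\<forall>q\<in>S - {p}. [x = 0] (mod q)" using x by (metis DiffE insertI1)
  ultimately show ?thesis by blast
qed

text \<open>An optimal set \<open>R p\<close> modulo each \<open>p\<close> is lifted to integers
  divisible by the other primes, giving \<open>Ep p\<close>; the multiples of \<open>P\<close> lie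
  in the class 0 of every \<open>p\<close>. Thus \<open>Ep p\<close> is what avoids the class 0
  modulo \<open>p\<close>. For minimality, \<open>P\<close> and \<open>2 * P\<close> always remain,
  which restricts a bad prime \<open>q\<close> to the divisors of \<open>P\<close> and its class to
  0, and \<open>Ep q\<close> always keeps an element outside a proper subset of
  \<open>Ep p\<close>.\<close>

theorem card_primes_le_E_max:
  assumes k: "1 \<le> k" and S: "finite S" "\<And>p. p \<in> S \<Longrightarrow> prime p \<and> (2 ^ k + 1) ^ k \<le> p"
    and cost: "(\<Sum>p\<in>S. h_cyc p k) < h"
  shows "card S \<le> E_max h k"
proof (cases "S = {}")
  case False
  have pr: "prime p" if "p \<in> S" for p using S(2) that by blast
  have "\<exists>A. p \<in> S \<longrightarrow> A \<subseteq> {1..<p} \<and> card A = k \<and> zsumset p (h_cyc p k) (insert 0 A) = {0..<p}" for p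
    using h_cyc_spec(3)[OF k] S(2) by blast
  then obtain R where R: "\<And>p. p \<in> S \<Longrightarrow> R p \<subseteq> {1..<p}" "\<And>p. p \<in> S \<Longrightarrow> card (R p) = k"
    "\<And>p. p \<in> S \<Longrightarrow> zsumset p (h_cyc p k) (insert 0 (R p)) = {0..<p}" by metis
  have "\<exists>x. p \<in> S \<longrightarrow> [x = a] (mod p) \<and> (\<forall>q\<in>S - {p}. [x = 0] (mod q))" for p a
    using crt_element[OF S(1) pr] by blast
  then obtain x where x: "\<And>p a. p \<in> S \<Longrightarrow> [x p a = a] (mod p)" "\<And>p a q. p \<in> S \<Longrightarrow> q \<in> S \<Longrightarrow> q \<noteq> p \<Longrightarrow> [x p a = 0] (mod q)"
    by (metis DiffI singletonD)
  have nz: "\<not> [x p a = 0] (mod p)" if "p \<in> S" "a \<in> R p" for p a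
  proof
    assume "[x p a = 0] (mod p)"
    then have "[a = 0] (mod p)" using x(1)[OF that(1), of a] cong_sym cong_trans by blast
    moreover have "a \<in> {1..<p}" using R(1)[OF that(1)] that(2) by blast
    ultimately show False unfolding cong_def by simp
  qed
  define Ep where "Ep = (\<lambda>p. x p ` R p)"
  define E where "E = (\<Union>p\<in>S. Ep p)"
  define P where "P = \<Prod>S"
  have finR: "finite (R p)" if "p \<in> S" for p using R(1)[OF that] finite_subset by blast
  have finE: "finite E" using S(1) finR by (auto simp: E_def Ep_def)
  have "0 \<notin> E"
  proof
    assume "0 \<in> E"
    then obtain p where p: "p \<in> S" "0 \<in> Ep p" unfolding E_def by blast
    then obtain a where a: "a \<in> R p" "0 = x p a" unfolding Ep_def by blast
    show False using nz[OF p(1) a(1)] unfolding a(2)[symmetric] by simp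
  qed
  have Pdvd: "p dvd P" if "p \<in> S" for p unfolding P_def using S(1) that by (intro dvd_prodI[where f = "\<lambda>x. x"]) auto
  have Pq: "\<exists>p\<in>S. q = p" if "prime q" "q dvd P" for q
    using that pr S(1) unfolding P_def by (metis prime_dvd_prod_iff primes_dvd_imp_eq)
  obtain p0 where p0: "p0 \<in> S" using False by blast
  have "P > 0" unfolding P_def using pr prime_gt_0_nat by (intro prod_pos) auto
  then have "p0 \<le> P" using Pdvd[OF p0] by (intro dvd_imp_le)
  then have P1: "P > 1" using prime_gt_1_nat[OF pr[OF p0]] by linarith
  have full: "\<exists>s\<in>sumset (\<Sum>p\<in>S. h_cyc p k) (insert 0 E). [s = r] (mod P)" for r
  proof -
    have "\<exists>s. p \<in> S \<longrightarrow> s \<in> sumset (h_cyc p k) (insert 0 E) \<and> [s = r] (mod p) \<and> (\<forall>q\<in>S - {p}. [s = 0] (mod q))" for p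
    proof (cases "p \<in> S")
      case True
      have "r mod p \<in> zsumset p (h_cyc p k) (insert 0 (R p))"
        unfolding R(3)[OF True] using prime_gt_0_nat[OF pr[OF True]] by simp
      then obtain f where f: "\<forall>i<h_cyc p k. f i \<in> insert 0 (R p)" "r mod p = (\<Sum>i<h_cyc p k. f i) mod p"
        unfolding zsumset_def by blast
      \<comment> \<open>Zeros stay zero: a lift \<open>x p 0\<close> could be a nonzero multiple of
        \<open>p\<close> outside \<open>E\<close>.\<close>
      define g where "g = (\<lambda>i. if f i = 0 then 0 else x p (f i))"
      have "(\<Sum>i<h_cyc p k. g i) \<in> sumset (h_cyc p k) (insert 0 E)"
      proof -
        have "g i \<in> insert 0 E" if "i < h_cyc p k" for i
        proof (cases "f i = 0")
          case False
          then have "f i \<in> R p" using f(1) that by auto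
          then show ?thesis using False True unfolding g_def E_def Ep_def by auto
        qed (simp add: g_def)
        then show ?thesis unfolding sumset_def by blast
      qed
      moreover have "[(\<Sum>i<h_cyc p k. g i) = (\<Sum>i<h_cyc p k. f i)] (mod p)"
        by (rule cong_sum) (use x(1)[OF True] in \<open>auto simp: g_def\<close>)
      then have "[(\<Sum>i<h_cyc p k. g i) = r] (mod p)" using f(2) by (simp add: cong_def)
      moreover have "[(\<Sum>i<h_cyc p k. g i) = 0] (mod q)" if "q \<in> S - {p}" for q
      proof -
        have "[(\<Sum>i<h_cyc p k. g i) = (\<Sum>i<h_cyc p k. 0)] (mod q)"
          by (rule cong_sum) (use x(2)[OF True] that in \<open>auto simp: g_def\<close>)
        then show ?thesis by simp
      qed
      ultimately show ?thesis by blast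
    qed simp
    then obtain s where s: "\<And>p. p \<in> S \<Longrightarrow> s p \<in> sumset (h_cyc p k) (insert 0 E)" "\<And>p. p \<in> S \<Longrightarrow> [s p = r] (mod p)"
      "\<And>p q. p \<in> S \<Longrightarrow> q \<in> S - {p} \<Longrightarrow> [s p = 0] (mod q)" by metis
    \<comment> \<open>Modulo \<open>q\<close> only the summand that belongs to \<open>q\<close>
      survives.\<close>
    have "[(\<Sum>p\<in>S. s p) = r] (mod q)" if q: "q \<in> S" for q
    proof -
      have "[(\<Sum>p\<in>S - {q}. s p) = (\<Sum>p\<in>S - {q}. 0)] (mod q)"
        by (rule cong_sum) (use s(3) q in auto)
      from cong_add[OF s(2)[OF q] this] show ?thesis using S(1) q by (simp add: sum.remove)
    qed
    then have "[(\<Sum>p\<in>S. s p) = r] (mod (\<Prod>p\<in>S. p))"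
      by (intro coprime_cong_prod_nat) (use pr in \<open>auto intro!: primes_coprime\<close>)
    moreover have "(\<Sum>p\<in>S. s p) \<in> sumset (\<Sum>p\<in>S. h_cyc p k) (insert 0 E)"
      using S(1) s(1) by (rule sumset_sum)
    ultimately show ?thesis by (auto simp: P_def)
  qed
  obtain B where B: "0 \<notin> B" "1 \<in> B" "2 \<in> B" "basis_of_order (E \<union> (\<lambda>b. P * b) ` B) h"
    using basis_of_exact_order[OF finE \<open>0 \<notin> E\<close> P1 full cost] by blast
  define A where "A = E \<union> (\<lambda>b. P * b) ` B"
  have bas: "is_basis A" using B(4) by (auto simp: is_basis_def A_def)
  have Ep_eq: "Ep p = {a\<in>A. a mod p \<noteq> 0 mod p}" if p: "p \<in> S" for p
  proof
    show "Ep p \<subseteq> {a\<in>A. a mod p \<noteq> 0 mod p}"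
      using p nz[OF p] by (auto simp: Ep_def A_def E_def cong_def)
    show "{a\<in>A. a mod p \<noteq> 0 mod p} \<subseteq> Ep p"
    proof safe
      fix a assume a: "a \<in> A" "a mod p \<noteq> 0 mod p"
      show "a \<in> Ep p"
      proof (cases "a \<in> E")
        case True
        then obtain q b where qb: "q \<in> S" "b \<in> R q" "a = x q b" by (auto simp: E_def Ep_def)
        then have "q = p" using x(2)[OF qb(1) p, of b] a(2) by (auto simp: cong_def)
        then show ?thesis using qb by (auto simp: Ep_def)
      next
        case False
        then obtain b where "a = P * b" using a(1) by (auto simp: A_def)
        then have "p dvd a" using Pdvd[OF p] by simp
        then show ?thesis using a(2) by (simp add: dvd_eq_mod_eq_0)
      qed
    qed
  qed
  have cardE: "card (Ep p) = k" if p: "p \<in> S" for p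
  proof -
    have "inj_on (x p) (R p)"
    proof (rule inj_onI)
      fix a b assume ab: "a \<in> R p" "b \<in> R p" "x p a = x p b"
      then have "[a = b] (mod p)" using x(1)[OF p, of a] x(1)[OF p, of b] by (metis cong_sym cong_trans)
      moreover have "a \<in> {1..<p}" "b \<in> {1..<p}" using R(1)[OF p] ab by blast+
      ultimately show "a = b" by (simp add: cong_def)
    qed
    then show ?thesis by (simp add: Ep_def card_image R(2)[OF p])
  qed
  have ess: "essential_subset A (Ep p)" if p: "p \<in> S" for p
  proof (rule residue_essential_subset[OF bas _ pr[OF p] Ep_eq[OF p]])
    show "finite (Ep p)" using finR[OF p] by (simp add: Ep_def)
    fix E' q d assume E': "E' \<subset> Ep p" and q: "prime (q::nat)"
    show "\<exists>b\<in>A - E'. b mod q \<noteq> d mod q"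
    proof (rule ccontr)
      assume "\<not> (\<exists>b\<in>A - E'. b mod q \<noteq> d mod q)"
      then have all: "b mod q = d mod q" if "b \<in> A" "b \<notin> E'" for b using that by blast
      have mem: "P * b \<in> A" "P * b \<notin> E'" if "b \<in> B" for b
      proof -
        show "P * b \<in> A" using that by (auto simp: A_def)
        have "(P * b) mod p = 0" using Pdvd[OF p] by (simp add: dvd_eq_mod_eq_0[symmetric])
        then show "P * b \<notin> E'" using E' Ep_eq[OF p] by auto
      qed
      \<comment> \<open>\<open>P * 1\<close> and \<open>P * 2\<close> lie in the same class modulo
        \<open>q\<close>, so \<open>q\<close> divides their difference \<open>P\<close>.\<close>
      have "[P * 1 + P = P * 1 + 0] (mod q)"
        using all[OF mem[OF B(2)]] all[OF mem[OF B(3)]] by (simp add: cong_def mult_2_right)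
      then have "[P = 0] (mod q)" by (simp only: cong_add_lcancel_nat)
      then have "q dvd P" by (simp add: cong_0_iff)
      then have qS: "q \<in> S" using Pq[OF q] by blast
      have d0: "d mod q = 0" using all[OF mem[OF B(2)]] \<open>q dvd P\<close> by (simp add: dvd_eq_mod_eq_0)
      have "\<exists>a\<in>Ep q. a \<notin> E'"
      proof (cases "q = p")
        case True
        then show ?thesis using E' by blast
      next
        case False
        have "card (Ep q) > 0" using cardE[OF qS] k by simp
        then obtain a where a: "a \<in> Ep q" by (metis card_gt_0_iff ex_in_conv)
        then obtain b where b: "b \<in> R q" "a = x q b" by (auto simp: Ep_def)
        have "[a = 0] (mod p)" using x(2)[OF qS p, of b] False b(2) by auto
        then have "a \<notin> Ep p" using Ep_eq[OF p] by (auto simp: cong_def)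
        then show ?thesis using a E' by blast
      qed
      then obtain a where a: "a \<in> Ep q" "a \<notin> E'" by blast
      then have "a \<in> A" "a mod q \<noteq> 0" using Ep_eq[OF qS] by auto
      then show False using all[OF _ a(2)] d0 by simp
    qed
  qed
  have inj: "inj_on Ep S"
  proof (rule inj_onI)
    fix p q assume pq: "p \<in> S" "q \<in> S" "Ep p = Ep q"
    have "card (Ep p) > 0" using cardE[OF pq(1)] k by simp
    then obtain a where a: "a \<in> Ep p" by (metis card_gt_0_iff ex_in_conv)
    then obtain b where b: "b \<in> R p" "a = x p b" by (auto simp: Ep_def)
    show "p = q"
    proof (rule ccontr)
      assume "p \<noteq> q"
      then have "[a = 0] (mod q)" using x(2)[OF pq(1,2), of b] b(2) by auto
      then have "a \<notin> Ep q" using Ep_eq[OF pq(2)] by (auto simp: cong_def)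
      then show False using a pq(3) by simp
    qed
  qed
  have "card (Ep ` S) \<le> E_max h k"
    using card_le_E_max[OF B(4)[folded A_def] k, of "Ep ` S"] ess cardE by blast
  then show ?thesis using inj by (simp add: card_image)
qed simp

section \<open>The zeta function on the line of real part one\<close>

text \<open>Since 0 powr s = 0, Dirichlet series may be indexed from n = 0 on.\<close>

definition powr_gap :: "nat \<Rightarrow> complex \<Rightarrow> complex" where
  "powr_gap n s = of_nat n powr (-s) - of_nat (Suc n) powr (-s) - s * of_nat n powr (-s - 1)"

lemma norm_of_nat_powr: "n > 0 \<Longrightarrow> norm (of_nat n powr s :: complex) = real n powr Re s"
  by (simp add: norm_powr_real_powr)

lemma powr_has_field_derivative_line:
  assumes "z \<in> closed_segment (of_nat n) (of_nat (Suc n))" "n > 0"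
  shows "((\<lambda>z::complex. z powr w) has_field_derivative w * z powr (w - 1)) (at z)"
    and "norm (z powr w) = norm z powr Re w" "norm z \<ge> n"
proof -
  have "closed_segment (complex_of_real (real n)) (of_real (real (Suc n))) = of_real ` closed_segment (real n) (real (Suc n))"
    by (rule closed_segment_of_real)
  then obtain x where x: "z = of_real x" "x \<ge> real n"
    using assms(1) by (auto simp: closed_segment_eq_real_ivl)
  have "x > 0" using x assms(2) by simp
  then show "((\<lambda>z::complex. z powr w) has_field_derivative w * z powr (w - 1)) (at z)"
    using x by (intro has_field_derivative_powr) (auto simp: complex_nonpos_Reals_iff)
  show "norm (z powr w) = norm z powr Re w" "norm z \<ge> n"
    using x \<open>x > 0\<close> by (simp_all add: norm_powr_real_powr)
qed

text \<open>Up to sign this is the remainder of the first-order Taylor expansion of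
  \<open>z powr (-s)\<close> from \<open>n\<close> to \<open>Suc n\<close>, governed by the second
  derivative \<open>s * (s + 1) * z powr (-s - 2)\<close>. The condition
  \<open>Re s \<ge> -2\<close> places the maximum of its modulus at \<open>n\<close>.\<close>

lemma norm_powr_gap_le:
  assumes "n > 0" "Re s \<ge> -2"
  shows "norm (powr_gap n s) \<le> norm s * norm (s + 1) * real n powr (- Re s - 2)"
proof -
  define f where "f = (\<lambda>i (z::complex). if i = (0::nat) then z powr (-s) else if i = 1 then (-s) * z powr (-s - 1)
     else (-s) * ((-s - 1) * z powr (-s - 1 - 1)))"
  let ?S = "closed_segment (of_nat n :: complex) (of_nat (Suc n))"
  have "cmod (f 0 (of_nat (Suc n)) - (\<Sum>i\<le>1. f i (of_nat n) * (of_nat (Suc n) - of_nat n) ^ i / (fact i)))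
     \<le> (norm s * norm (s + 1) * real n powr (- Re s - 2)) * cmod (of_nat (Suc n) - of_nat n)^(Suc 1) / fact 1"
  proof (rule complex_Taylor[where S = ?S])
    show "(f i has_field_derivative f (Suc i) x) (at x within ?S)" if "x \<in> ?S" "i \<le> 1" for i x
    proof -
      have "i = 0 \<or> i = 1" using that by auto
      then show ?thesis
        using powr_has_field_derivative_line(1)[OF that(1) assms(1), of "-s"]
          DERIV_cmult[OF powr_has_field_derivative_line(1)[OF that(1) assms(1), of "-s - 1"], of "-s"]
        by (auto simp: f_def simp del: of_nat_Suc mult_minus_left intro: has_field_derivative_at_within)
    qed
    show "cmod (f (Suc 1) x) \<le> norm s * norm (s + 1) * real n powr (- Re s - 2)" if "x \<in> ?S" for x
    proof -
      have "norm x powr (- Re s - 2) \<le> real n powr (- Re s - 2)"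
        using powr_has_field_derivative_line(3)[OF that assms(1)] assms by (intro powr_mono2') auto
      moreover have "norm (-s - 1) = norm (s + 1)" by (metis add.commute minus_add_distrib norm_minus_cancel uminus_add_conv_diff diff_minus_eq_add add_uminus_conv_diff)
      moreover have "norm (x powr (-s - 1 - 1)) = norm x powr (- Re s - 2)"
      proof -
        have "Re (-s - 1 - 1) = - Re s - 2" by simp
        then show ?thesis
          using powr_has_field_derivative_line(2)[OF that assms(1), of "-s - 1 - 1"] by (simp only:)
      qed
      ultimately show ?thesis
        by (simp add: f_def norm_mult mult.assoc mult_left_mono del: of_nat_Suc)
    qed
  qed auto
  also have "f 0 (of_nat (Suc n)) - (\<Sum>i\<le>1. f i (of_nat n) * (of_nat (Suc n) - of_nat n) ^ i / (fact i)) = - powr_gap n s"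
    by (simp add: f_def powr_gap_def)
  finally show ?thesis by simp
qed

section \<open>Holomorphic series and Dirichlet products\<close>

lemma has_field_derivative_nat_powr [derivative_intros]:
  "((\<lambda>s. of_nat n powr (c - s)) has_field_derivative (- of_real (ln (real n)) * of_nat n powr (c - s))) (at (s::complex) within A)"
proof (cases "n = 0")
  case False
  then have eq: "(\<lambda>s. of_nat n powr (c - s) :: complex) = (\<lambda>s. exp ((c - s) * of_real (ln (real n))))"
    by (auto simp: powr_def fun_eq_iff simp flip: Ln_of_real Ln_of_nat)
  have "((\<lambda>s. exp ((c - s) * of_real (ln (real n)))) has_field_derivative
      (- of_real (ln (real n)) * exp ((c - s) * of_real (ln (real n))))) (at s within A)"
    by (rule derivative_eq_intros refl | simp)+
  then show ?thesis
    unfolding eq by (simp only: fun_cong[OF eq])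
qed auto

lemma has_field_derivative_nat_powr' [derivative_intros]:
  "((\<lambda>s. of_nat n powr (- s)) has_field_derivative (- of_real (ln (real n)) * of_nat n powr (- s))) (at (s::complex) within A)"
  using has_field_derivative_nat_powr[of n 0 s A] by simp

text \<open>The gap gains two powers of \<open>n\<close> over \<open>n powr (-s)\<close>, so
  coefficients of size \<open>n powr a\<close> are admissible up to \<open>Re s > a - 1\<close>.
  This is used with \<open>a = 0\<close> for the zeta function and with \<open>a = 1\<close> for the
  error of \<open>psi\<close>.\<close>

lemma powr_gap_series:
  fixes c :: "nat \<Rightarrow> complex"
  assumes c: "\<And>n. norm (c n) \<le> C * real n powr a" and a: "a \<ge> -1"
  shows powr_gap_series_summable: "Re s > a - 1 \<Longrightarrow> summable (\<lambda>n. c n * powr_gap n s)"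
    and powr_gap_series_holomorphic: "(\<lambda>s. \<Sum>n. c n * powr_gap n s) holomorphic_on {s. Re s > a - 1}"
proof -
  let ?S = "{s. Re s > a - 1}"
  have "open ?S" by (simp add: open_halfspace_Re_gt)
  have C: "C \<ge> 0" using order_trans[OF norm_ge_zero c[of 1]] by simp
  have "\<exists>g g'. \<forall>s \<in> ?S. ((\<lambda>n. c n * powr_gap n s) sums g s) \<and> ((\<lambda>n. deriv (\<lambda>s. c n * powr_gap n s) s) sums g' s)
      \<and> (g has_field_derivative g' s) (at s)"
  proof (rule series_and_derivative_comparison_local[OF \<open>open ?S\<close>])
    fix n s
    show "((\<lambda>s. c n * powr_gap n s) has_field_derivative deriv (\<lambda>s. c n * powr_gap n s) s) (at s)"
    proof -
      have "(\<lambda>s. powr_gap n s) = (\<lambda>s. of_nat n powr (-s) - of_nat (Suc n) powr (-s) - s * of_nat n powr (-1 - s))"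
      proof
        fix s :: complex
        have "-s - 1 = -1 - s" by simp
        then show "powr_gap n s = of_nat n powr (-s) - of_nat (Suc n) powr (-s) - s * of_nat n powr (-1 - s)"
          unfolding powr_gap_def by (simp only:)
      qed
      moreover have "(\<lambda>s. of_nat m powr (-s)) field_differentiable (at s)" "(\<lambda>s. of_nat m powr (-1 - s)) field_differentiable (at s)" for m
        using has_field_derivative_nat_powr'[of m s UNIV] has_field_derivative_nat_powr[of m "-1" s UNIV]
        by (auto simp: field_differentiable_def)
      ultimately have "(\<lambda>s. c n * powr_gap n s) field_differentiable (at s)"
        by (auto simp del: of_nat_Suc intro!: field_differentiable_mult field_differentiable_diff)
      then show ?thesis
        by (simp add: DERIV_deriv_iff_field_differentiable)
    qed
  next
    fix x assume "x \<in> ?S"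
    \<comment> \<open>Half the distance to the boundary: on the ball of radius \<open>d\<close> the
      terms are still of size \<open>n powr (-1 - d)\<close>.\<close>
    define d where "d = (Re x - (a - 1)) / 2"
    have "d > 0" using \<open>x \<in> ?S\<close> by (simp add: d_def)
    define h where "h = (\<lambda>n. C * ((norm x + d) * (norm x + d + 1)) * real n powr (-1 - d))"
    have "summable h" unfolding h_def
      using \<open>d > 0\<close> by (intro summable_mult) (simp add: summable_real_powr_iff)
    moreover have "norm (c n * powr_gap n y) \<le> h n" if y: "y \<in> ball x d \<inter> ?S" and n: "n > 0" for n y
    proof -
      have "norm (y - x) < d" using y by (simp add: dist_norm norm_minus_commute)
      then have 1: "norm y \<le> norm x + d" and 2: "norm (y + 1) \<le> norm x + d + 1"
        using norm_triangle_ineq[of x "y - x"] norm_triangle_ineq[of y 1] by auto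
      have "Re x - Re y < d" using \<open>norm (y - x) < d\<close> abs_Re_le_cmod[of "y - x"] by simp
      then have 3: "a + (- Re y - 2) \<le> -1 - d" by (simp add: d_def field_simps)
      have "norm (c n * powr_gap n y) \<le> (C * real n powr a) * (norm y * norm (y + 1) * real n powr (- Re y - 2))"
        unfolding norm_mult using y a n C by (intro mult_mono c norm_powr_gap_le) auto
      also have "\<dots> = C * (norm y * norm (y + 1)) * real n powr (a + (- Re y - 2))"
        by (simp add: powr_add mult_ac)
      also have "\<dots> \<le> C * ((norm x + d) * (norm x + d + 1)) * real n powr (-1 - d)"
        using 1 2 3 C n \<open>d > 0\<close> by (intro mult_mono powr_mono mult_nonneg_nonneg add_nonneg_nonneg) auto
      finally show ?thesis by (simp add: h_def)
    qed
    ultimately show "\<exists>d h. 0 < d \<and> summable h \<and> (\<forall>\<^sub>F n in sequentially. \<forall>y\<in>ball x d \<inter> ?S. norm (c n * powr_gap n y) \<le> h n)"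
      using \<open>d > 0\<close> by (intro exI[of _ d] exI[of _ h]) (auto intro!: eventually_mono[OF eventually_gt_at_top[of 0]])
  qed
  then obtain g g' where g: "\<And>s. s \<in> ?S \<Longrightarrow> (\<lambda>n. c n * powr_gap n s) sums g s"
      "\<And>s. s \<in> ?S \<Longrightarrow> (g has_field_derivative g' s) (at s)" by blast
  show "Re s > a - 1 \<Longrightarrow> summable (\<lambda>n. c n * powr_gap n s)"
    using g(1)[of s] by (auto simp: sums_iff)
  have "g holomorphic_on ?S"
    using g(2) \<open>open ?S\<close> by (auto simp: holomorphic_on_open)
  then show "(\<lambda>s. \<Sum>n. c n * powr_gap n s) holomorphic_on ?S"
    using g(1) by (subst holomorphic_cong[where g = g]) (auto simp: sums_iff)
qed

text \<open>Coefficients below every positive power of \<open>n\<close> leave absolute convergence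
  for \<open>Re s > 1\<close>; both the constant 1 and \<open>mangoldt\<close> are of this
  kind.\<close>

lemma dirichlet_series_deriv:
  fixes c :: "nat \<Rightarrow> complex"
  assumes c: "\<And>d. d > 0 \<Longrightarrow> \<exists>C. \<forall>n>0. norm (c n) \<le> C * real n powr d" and s: "Re s > 1"
  shows dirichlet_summable_norm: "summable (\<lambda>n. norm (c n * of_nat n powr (-s)))"
    and dirichlet_has_derivative: "((\<lambda>s. \<Sum>n. c n * of_nat n powr (-s)) has_field_derivative
        (\<Sum>n. - c n * of_real (ln (real n)) * of_nat n powr (-s))) (at s)"
proof -
  let ?S = "{s. Re s > 1}"
  have "open ?S" by (simp add: open_halfspace_Re_gt)
  have bound: "\<exists>d h. 0 < d \<and> summable h \<and> (\<forall>n>0. \<forall>y\<in>ball x d \<inter> ?S. norm (c n * of_nat n powr (-y)) \<le> h n)"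
    if x: "x \<in> ?S" for x
  proof -
    \<comment> \<open>A third of the distance to the line \<open>Re s = 1\<close>: one share for the
      coefficients, one for the ball, one for convergence.\<close>
    define d where "d = (Re x - 1) / 3"
    have "d > 0" using x by (simp add: d_def)
    then obtain C where C: "\<And>n. n > 0 \<Longrightarrow> norm (c n) \<le> C * real n powr d" using c by blast
    have C0: "C \<ge> 0" using C[of 1] norm_ge_zero[of "c 1"] by (simp del: norm_ge_zero)
    have "norm (c n * of_nat n powr (-y)) \<le> C * real n powr (-1 - d)" if "y \<in> ball x d \<inter> ?S" "n > 0" for n y
    proof -
      have "norm (y - x) < d" using that by (simp add: dist_norm norm_minus_commute)
      then have "Re x - Re y < d" using abs_Re_le_cmod[of "y - x"] by simp
      then have 3: "d - Re y \<le> -1 - d" by (simp add: d_def field_simps)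
      have "norm (c n * of_nat n powr (-y)) \<le> (C * real n powr d) * real n powr (- Re y)"
        unfolding norm_mult using that C by (simp add: norm_of_nat_powr mult_right_mono)
      also have "\<dots> = C * real n powr (d - Re y)" by (simp add: powr_diff powr_minus field_simps)
      also have "\<dots> \<le> C * real n powr (-1 - d)"
        using 3 C0 that by (intro mult_mono powr_mono) auto
      finally show ?thesis .
    qed
    moreover have "summable (\<lambda>n. C * real n powr (-1 - d))"
      using \<open>d > 0\<close> by (intro summable_mult) (simp add: summable_real_powr_iff)
    ultimately show ?thesis using \<open>d > 0\<close> by blast
  qed
  from bound[of s] s obtain d h where "d > 0" "summable h" "\<forall>n>0. \<forall>y\<in>ball s d \<inter> ?S. norm (c n * of_nat n powr (-y)) \<le> h n"
    by auto
  then show "summable (\<lambda>n. norm (c n * of_nat n powr (-s)))"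
    using s by (intro summable_comparison_test_ev[OF _ \<open>summable h\<close>])
      (auto intro!: eventually_mono[OF eventually_gt_at_top[of 0]])
  have "\<exists>g g'. \<forall>s \<in> ?S. ((\<lambda>n. c n * of_nat n powr (-s)) sums g s) \<and> 
      ((\<lambda>n. - c n * of_real (ln (real n)) * of_nat n powr (-s)) sums g' s)
      \<and> (g has_field_derivative g' s) (at s)"
  proof (rule series_and_derivative_comparison_local[OF \<open>open ?S\<close>])
    fix n s
    show "((\<lambda>s. c n * of_nat n powr (-s)) has_field_derivative - c n * of_real (ln (real n)) * of_nat n powr (-s)) (at s)"
      by (rule derivative_eq_intros refl | simp)+
  next
    fix x assume "x \<in> ?S"
    from bound[OF this] obtain d h where "d > 0" "summable h" "\<forall>n>0. \<forall>y\<in>ball x d \<inter> ?S. norm (c n * of_nat n powr (-y)) \<le> h n"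
      by auto
    then show "\<exists>d h. 0 < d \<and> summable h \<and> (\<forall>\<^sub>F n in sequentially. \<forall>y\<in>ball x d \<inter> ?S. norm (c n * of_nat n powr (-y)) \<le> h n)"
      by (intro exI[of _ d] exI[of _ h]) (auto intro!: eventually_mono[OF eventually_gt_at_top[of 0]])
  qed
  then obtain g g' where g: "\<And>s. s \<in> ?S \<Longrightarrow> (\<lambda>n. c n * of_nat n powr (-s)) sums g s"
      "\<And>s. s \<in> ?S \<Longrightarrow> (\<lambda>n. - c n * of_real (ln (real n)) * of_nat n powr (-s)) sums g' s"
      "\<And>s. s \<in> ?S \<Longrightarrow> (g has_field_derivative g' s) (at s)" by blast
  have "((\<lambda>s. \<Sum>n. c n * of_nat n powr (-s)) has_field_derivative g' s) (at s)"
    by (rule DERIV_cong_ev[THEN iffD1, OF refl _ refl g(3)])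
      (use s g(1) \<open>open ?S\<close> in \<open>auto intro!: eventually_mono[OF eventually_nhds_in_open[of ?S]] simp: sums_iff\<close>)
  then show "((\<lambda>s. \<Sum>n. c n * of_nat n powr (-s)) has_field_derivative
        (\<Sum>n. - c n * of_real (ln (real n)) * of_nat n powr (-s))) (at s)"
    using g(2)[of s] s by (simp add: sums_iff)
qed

text \<open>Rearrangement of the absolutely convergent double series by \<open>n = d * m\<close>.
  The condition \<open>n > 0\<close> removes the index 0, which every number divides.\<close>

lemma has_sum_dirichlet_prod:
  fixes f g :: "nat \<Rightarrow> complex"
  assumes f: "summable (\<lambda>n. norm (f n))" and g: "summable (\<lambda>n. norm (g n))" and "f 0 = 0" "g 0 = 0"
  shows "(\<lambda>n. \<Sum>d | d dvd n \<and> n > 0. f d * g (n div d)) sums (suminf f * suminf g)"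
proof -
  let ?P = "{0<..} :: nat set"
  have f1: "(f has_sum suminf f) UNIV" "(g has_sum suminf g) UNIV"
    using f g by (auto intro!: norm_summable_imp_has_sum summable_sums summable_norm_cancel)
  then have f2: "(f has_sum suminf f) ?P" "(g has_sum suminf g) ?P"
    using assms(3,4) by (subst has_sum_cong_neutral[where T = UNIV and g = f] has_sum_cong_neutral[where T = UNIV and g = g], auto)+
  have fn: "(\<lambda>x. norm (f x)) summable_on ?P" "(\<lambda>x. norm (g x)) summable_on ?P"
    using f g by (auto intro!: summable_on_subset_banach[OF norm_summable_imp_summable_on])
  have "(\<lambda>x. norm (case x of (d,m) \<Rightarrow> f d * g m)) summable_on (Sigma ?P (\<lambda>_. ?P))"
  proof (subst Infinite_Sum.abs_summable_on_Sigma_iff[where f = "\<lambda>(d,m). f d * g m"], intro conjI ballI)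
    fix d :: nat
    show "(\<lambda>y. norm (case (d, y) of (d, m) \<Rightarrow> f d * g m)) summable_on ?P"
      using summable_on_cmult_right[OF fn(2), of "norm (f d)"] by (simp add: norm_mult)
  next
    have "(\<Sum>\<^sub>\<infinity>y\<in>?P. norm (case (x, y) of (d, m) \<Rightarrow> f d * g m)) = norm (f x) * (\<Sum>\<^sub>\<infinity>y\<in>?P. norm (g y))" for x
      by (simp add: norm_mult infsum_cmult_right')
    moreover have "(\<Sum>\<^sub>\<infinity>y\<in>?P. norm (g y)) \<ge> 0" by (simp add: infsum_nonneg)
    ultimately show "(\<lambda>x. norm (\<Sum>\<^sub>\<infinity>y\<in>?P. norm (case (x, y) of (d, m) \<Rightarrow> f d * g m))) summable_on ?P"
      using summable_on_cmult_left[OF fn(1)] by (simp add: abs_mult)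
  qed
  then have sm: "(\<lambda>(d,m). f d * g m) summable_on (?P \<times> ?P)"
    by (rule abs_summable_summable)
  have "((\<lambda>(d,m). f d * g m) has_sum (suminf f * suminf g)) (?P \<times> ?P)"
  proof (rule has_sum_SigmaI[OF _ _ sm])
    show "((\<lambda>y. case (d, y) of (d, m) \<Rightarrow> f d * g m) has_sum f d * suminf g) ?P" for d
      using has_sum_cmult_right[OF f2(2)] by simp
    show "((\<lambda>d. f d * suminf g) has_sum (suminf f * suminf g)) ?P"
      by (rule has_sum_cmult_left[OF f2(1)])
  qed
  also have "?this \<longleftrightarrow> ((\<lambda>(n,d). f d * g (n div d)) has_sum (suminf f * suminf g)) (Sigma ?P (\<lambda>n. {d. d dvd n}))"
    by (rule has_sum_reindex_bij_witness[of _ "\<lambda>(n,d). (d, n div d)" "\<lambda>(d,m). (d * m, d)"])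
      (auto elim!: dvdE intro!: Nat.gr0I)
  finally have "((\<lambda>n. \<Sum>d | d dvd n. f d * g (n div d)) has_sum (suminf f * suminf g)) ?P"
    by (rule has_sum_SigmaD) (auto intro!: has_sum_finiteI)
  also have "?this \<longleftrightarrow> ((\<lambda>n. \<Sum>d | d dvd n \<and> n > 0. f d * g (n div d)) has_sum (suminf f * suminf g)) UNIV"
    by (rule has_sum_cong_neutral) auto
  finally show ?thesis by (rule has_sum_imp_sums)
qed

section \<open>The zeta function and its logarithmic derivative\<close>

definition zeta_series :: "complex \<Rightarrow> complex" where
  "zeta_series s = (\<Sum>n. of_nat n powr (-s))"

definition mangoldt_series :: "complex \<Rightarrow> complex" where
  "mangoldt_series s = (\<Sum>n. mangoldt n * of_nat n powr (-s))"

text \<open>The continuation of (s - 1) zeta(s) to Re s > 0: the sum of n^-s is compared with the integrals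
  of x^-s over [n, n + 1].\<close>

definition zeta_reg :: "complex \<Rightarrow> complex" where
  "zeta_reg s = 1 - (\<Sum>n. of_bool (n > 0) * powr_gap n (s - 1))"

lemma zeta_reg_holomorphic: "zeta_reg holomorphic_on {s. Re s > 0}"
proof -
  have "(\<lambda>s. \<Sum>n. of_bool (n > 0) * powr_gap n s) holomorphic_on {s. Re s > 0 - 1}"
    by (rule powr_gap_series_holomorphic[where C = 1]) auto
  then have "((\<lambda>s. \<Sum>n. of_bool (n > 0) * powr_gap n s) \<circ> (\<lambda>s. s - 1)) holomorphic_on {s. Re s > 0}"
    by (rule holomorphic_on_compose_gen[rotated]) (auto intro!: holomorphic_intros)
  then have "(\<lambda>s. 1 - ((\<lambda>s. \<Sum>n. of_bool (n > 0) * powr_gap n s) \<circ> (\<lambda>s. s - 1)) s) holomorphic_on {s. Re s > 0}"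
    by (rule holomorphic_on_diff[OF holomorphic_on_const])
  then show ?thesis by (simp add: zeta_reg_def[abs_def] o_def)
qed

lemma zeta_reg_1 [simp]: "zeta_reg 1 = 1"
proof -
  have "(\<lambda>n. of_bool (n > 0) * powr_gap n (1 - 1)) = (\<lambda>n. 0)"
    by (auto simp: powr_gap_def fun_eq_iff simp del: of_nat_Suc)
  then show ?thesis by (simp add: zeta_reg_def)
qed

lemma nat_powr_tendsto_0:
  assumes "Re s < 0"
  shows "(\<lambda>n. of_nat (Suc n) powr s :: complex) \<longlonglongrightarrow> 0"
proof (rule tendsto_norm_zero_cancel)
  have "(\<lambda>n. real (Suc n) powr Re s) \<longlonglongrightarrow> 0"
    using assms by real_asymp
  then show "(\<lambda>n. norm (of_nat (Suc n) powr s :: complex)) \<longlonglongrightarrow> 0"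
    by (simp add: norm_of_nat_powr del: of_nat_Suc)
qed

lemma summable_norm_nat_powr:
  assumes "Re s > 1"
  shows "summable (\<lambda>n. norm (of_nat n powr (-s) :: complex))"
proof -
  have "summable (\<lambda>n. norm (1 * of_nat n powr (-s) :: complex))"
  proof (rule dirichlet_summable_norm[OF _ assms])
    fix d :: real assume "d > 0"
    then show "\<exists>C. \<forall>n>0. norm (1::complex) \<le> C * real n powr d"
      by (intro exI[of _ 1]) (auto intro!: ge_one_powr_ge_zero)
  qed
  then show ?thesis by simp
qed

text \<open>The differences of \<open>n powr (1 - s)\<close> telescope to 1, and
  \<open>powr_gap n (s - 1)\<close> is such a difference minus
  \<open>(s - 1) * n powr (-s)\<close>.\<close>

lemma zeta_reg_eq:
  assumes "Re s > 1"
  shows "zeta_reg s = (s - 1) * zeta_series s"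
proof -
  let ?c = "\<lambda>n. of_bool (n > (0::nat)) :: complex"
  have "(\<lambda>n. of_nat (Suc n) powr (1 - s) - of_nat (Suc (Suc n)) powr (1 - s)) sums (of_nat (Suc 0) powr (1 - s) - 0)"
    by (rule telescope_sums'[OF nat_powr_tendsto_0]) (use assms in auto)
  then have "(\<lambda>n. ?c (Suc n) * (of_nat (Suc n) powr (1 - s) - of_nat (Suc (Suc n)) powr (1 - s))) sums 1"
    by simp
  then have 1: "(\<lambda>n. ?c n * (of_nat n powr (1 - s) - of_nat (Suc n) powr (1 - s))) sums 1"
    by (subst (asm) sums_Suc_iff) simp
  have "summable (\<lambda>n. of_nat n powr (-s) :: complex)"
    using summable_norm_nat_powr[OF assms] by (rule summable_norm_cancel)
  then have 2: "(\<lambda>n. (s - 1) * of_nat n powr (-s)) sums ((s - 1) * zeta_series s)"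
    unfolding zeta_series_def by (intro sums_mult summable_sums)
  have "(\<lambda>n. ?c n * powr_gap n (s - 1)) sums (1 - (s - 1) * zeta_series s)"
  proof (rule sums_cong[THEN iffD1, OF _ sums_diff[OF 1 2]])
    fix n
    have "- (s - 1) - 1 = - s" "- (s - 1) = 1 - s" by simp_all
    then show "?c n * (of_nat n powr (1 - s) - of_nat (Suc n) powr (1 - s)) - (s - 1) * of_nat n powr (-s) = ?c n * powr_gap n (s - 1)"
      unfolding powr_gap_def by (cases "n = 0") (simp_all del: of_nat_Suc)
  qed
  then show ?thesis by (simp add: zeta_reg_def sums_iff)
qed

lemma mangoldt_le_ln: "n > 0 \<Longrightarrow> mangoldt n \<le> ln (real n)"
  using mangoldt_sum[of n, where ?'a = real] member_le_sum[of n "{d. d dvd n}" "mangoldt :: nat \<Rightarrow> real"]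
  by (simp add: mangoldt_nonneg)

lemma mangoldt_bound:
  assumes "d > 0"
  shows "\<exists>C. \<forall>n>0. norm (mangoldt n :: complex) \<le> C * real n powr d"
proof (intro exI[of _ "1/d"] allI impI)
  fix n :: nat assume "n > 0"
  then show "norm (mangoldt n :: complex) \<le> 1/d * real n powr d"
    using mangoldt_le_ln[of n] ln_powr_bound[of "real n" d] assms by simp
qed

lemma nat_powr_mult: "of_nat (a * b) powr (s::complex) = of_nat a powr s * of_nat b powr s"
  using powr_times_real[of "of_nat a" "of_nat b" s] by simp

text \<open>The product of the two series has the divisor sums of \<open>mangoldt\<close> as
  coefficients, and these are the logarithms produced by differentiation.\<close>

lemma zeta_series_deriv:
  assumes "Re s > 1"
  shows "(zeta_series has_field_derivative (- mangoldt_series s * zeta_series s)) (at s)"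
proof -
  have "\<exists>C. \<forall>n>0. norm (1::complex) \<le> C * real n powr d" if "d > 0" for d
    using that by (intro exI[of _ 1]) (auto intro!: ge_one_powr_ge_zero)
  from dirichlet_has_derivative[of "\<lambda>_. 1", OF this assms]
  have 1: "(zeta_series has_field_derivative (\<Sum>n. - of_real (ln (real n)) * of_nat n powr (-s))) (at s)"
    by (simp add: zeta_series_def[abs_def])
  have "(\<lambda>n. \<Sum>d | d dvd n \<and> n > 0. (mangoldt d * of_nat d powr (-s)) * of_nat (n div d) powr (-s)) sums
      (mangoldt_series s * zeta_series s)"
    unfolding mangoldt_series_def zeta_series_def
    using dirichlet_summable_norm[OF mangoldt_bound assms] summable_norm_nat_powr[OF assms]
    by (intro has_sum_dirichlet_prod) auto
  also have "(\<lambda>n. \<Sum>d | d dvd n \<and> n > 0. (mangoldt d * of_nat d powr (-s)) * of_nat (n div d) powr (-s)) =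
      (\<lambda>n. of_real (ln (real n)) * of_nat n powr (-s))"
  proof
    fix n :: nat
    show "(\<Sum>d | d dvd n \<and> n > 0. (mangoldt d * of_nat d powr (-s)) * of_nat (n div d) powr (-s)) =
      of_real (ln (real n)) * of_nat n powr (-s)"
    proof (cases "n = 0")
      case False
      have "(\<Sum>d | d dvd n \<and> n > 0. (mangoldt d * of_nat d powr (-s)) * of_nat (n div d) powr (-s)) =
        (\<Sum>d | d dvd n. mangoldt d * of_nat n powr (-s))"
        using False by (intro sum.cong) (auto simp: mult.assoc simp flip: nat_powr_mult)
      also have "\<dots> = (\<Sum>d | d dvd n. mangoldt d) * of_nat n powr (-s)"
        by (simp add: sum_distrib_right)
      finally show ?thesis using mangoldt_sum[OF False, where ?'a = complex] by simp
    qed simp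
  qed
  finally have "(\<lambda>n. - (of_real (ln (real n)) * of_nat n powr (-s))) sums - (mangoldt_series s * zeta_series s)"
    by (rule sums_minus)
  then show ?thesis using 1 by (simp add: sums_iff)
qed

text \<open>The product rule for \<open>(s - 1) * zeta_series s\<close>. The form without division
  by \<open>zeta_reg s\<close> matters, since its nonvanishing is deduced from this
  identity.\<close>

lemma deriv_zeta_reg:
  assumes "Re s > 1"
  shows "deriv zeta_reg s = zeta_reg s * (1 / (s - 1) - mangoldt_series s)"
proof -
  have "s \<noteq> 1" using assms by auto
  have op: "open {s. Re s > 1}" by (simp add: open_halfspace_Re_gt)
  have "((\<lambda>s. (s - 1) * zeta_series s) has_field_derivative
     (1 * zeta_series s + (- mangoldt_series s * zeta_series s) * (s - 1))) (at s)"
    using zeta_series_deriv[OF assms] by (auto intro!: derivative_eq_intros)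
  then have "(zeta_reg has_field_derivative
     (1 * zeta_series s + (- mangoldt_series s * zeta_series s) * (s - 1))) (at s)"
    by (rule has_field_derivative_transform_within_open[OF _ op]) (use assms zeta_reg_eq in auto)
  then have "deriv zeta_reg s = 1 * zeta_series s + (- mangoldt_series s * zeta_series s) * (s - 1)"
    by (rule DERIV_imp_deriv)
  moreover have "(s - 1) * zeta_series s * (1 / (s - 1)) = zeta_series s" using \<open>s \<noteq> 1\<close> by simp
  ultimately show ?thesis
    by (simp only: zeta_reg_eq[OF assms] right_diff_distrib) (simp add: algebra_simps)
qed

text \<open>Writing \<open>f w = (w - \<xi>) ^ n * g w\<close> with \<open>g\<close> free of zeros,
  the logarithmic derivative is \<open>n / (w - \<xi>)\<close> plus a function continuous at
  \<open>\<xi>\<close>; the limit is the order of the zero, with \<open>n = 0\<close> if there is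
  none.\<close>

lemma log_deriv_residue:
  assumes holf: "f holomorphic_on S" and S: "open S" "connected S"
    and "\<xi> \<in> S" and nonconst: "\<not> f constant_on S"
  shows "\<exists>m::nat. (m > 0 \<longleftrightarrow> f \<xi> = 0) \<and> ((\<lambda>w. (w - \<xi>) * (deriv f w / f w)) \<longlongrightarrow> of_nat m) (at \<xi>)"
proof -
  obtain g r n where gr: "0 < r" "ball \<xi> r \<subseteq> S" "g holomorphic_on ball \<xi> r"
      "\<And>w. w \<in> ball \<xi> r \<Longrightarrow> f w = (w - \<xi>)^n * g w" "\<And>w. w \<in> ball \<xi> r \<Longrightarrow> g w \<noteq> 0"
      and n: "n > 0 \<longleftrightarrow> f \<xi> = 0"
  proof (cases "f \<xi> = 0")
    case True
    show ?thesis
      by (rule holomorphic_factor_zero_nonconstant[OF holf S \<open>\<xi> \<in> S\<close> True nonconst]) (use that True in blast)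
  next
    case False
    have "continuous_on S f" using holf by (rule holomorphic_on_imp_continuous_on)
    then have "open (S \<inter> f -` (- {0}))" using S by (intro continuous_open_preimage) auto
    then obtain r where "r > 0" "ball \<xi> r \<subseteq> S \<inter> f -` (- {0})"
      by (rule openE[of _ \<xi>]) (use False \<open>\<xi> \<in> S\<close> in auto)
    then show ?thesis
      using holf False by (intro that[of r f 0]) (auto intro: holomorphic_on_subset)
  qed
  have "((\<lambda>w. of_nat n + (w - \<xi>) * (deriv g w / g w)) \<longlongrightarrow> of_nat n + (\<xi> - \<xi>) * (deriv g \<xi> / g \<xi>)) (at \<xi>)"
  proof -
    have "isCont (deriv g) \<xi>" "isCont g \<xi>"
      using gr holomorphic_deriv[OF gr(3)] by (auto intro!: continuous_on_interior[where S = "ball \<xi> r"] holomorphic_on_imp_continuous_on)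
    then show ?thesis using gr(5)[of \<xi>] gr(1) by (intro tendsto_intros) (auto simp: isCont_def)
  qed
  then have "((\<lambda>w. of_nat n + (w - \<xi>) * (deriv g w / g w)) \<longlongrightarrow> of_nat n) (at \<xi>)" by simp
  moreover have "\<forall>\<^sub>F w in at \<xi>. of_nat n + (w - \<xi>) * (deriv g w / g w) = (w - \<xi>) * (deriv f w / f w)"
  proof -
    have "\<forall>\<^sub>F w in at \<xi>. w \<in> ball \<xi> r \<and> w \<noteq> \<xi>"
      using eventually_at_in_open[of "ball \<xi> r" \<xi>] gr(1) by simp
    then show ?thesis
    proof eventually_elim
      case (elim w)
      have "(g has_field_derivative deriv g w) (at w)"
        using elim gr(3) by (intro holomorphic_derivI[where S = "ball \<xi> r"]) auto
      then have "((\<lambda>w. (w - \<xi>)^n * g w) has_field_derivative (of_nat n * (w - \<xi>)^(n - 1) * g w + (w - \<xi>)^n * deriv g w)) (at w)"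
        by (auto intro!: derivative_eq_intros)
      then have "(f has_field_derivative (of_nat n * (w - \<xi>)^(n - 1) * g w + (w - \<xi>)^n * deriv g w)) (at w)"
        by (rule has_field_derivative_transform_within_open[of _ _ _ "ball \<xi> r"]) (use elim gr(4) in auto)
      then have d: "deriv f w = of_nat n * (w - \<xi>)^(n - 1) * g w + (w - \<xi>)^n * deriv g w"
        by (rule DERIV_imp_deriv)
      have "(w - \<xi>) * (of_nat n * (w - \<xi>)^(n - 1)) = of_nat n * (w - \<xi>)^n"
        by (cases n) auto
      moreover have "(w - \<xi>) * deriv f w = (w - \<xi>) * (of_nat n * (w - \<xi>)^(n - 1)) * g w + (w - \<xi>) * ((w - \<xi>)^n * deriv g w)"
        unfolding d by (simp only: distrib_left mult.assoc)
      ultimately have "(w - \<xi>) * deriv f w = of_nat n * ((w - \<xi>)^n * g w) + (w - \<xi>) * ((w - \<xi>)^n * deriv g w)"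
        by (simp only: mult.assoc)
      moreover have fw: "f w = (w - \<xi>)^n * g w" "g w \<noteq> 0"
        using elim gr(4,5) by blast+
      moreover have "(w - \<xi>) * (deriv f w / f w) = (w - \<xi>) * deriv f w / f w"
        by (rule times_divide_eq_right)
      ultimately have "(w - \<xi>) * (deriv f w / f w) =
          (of_nat n * f w + (w - \<xi>) * ((w - \<xi>)^n * deriv g w)) / f w"
        by metis
      also have "\<dots> = of_nat n * f w / f w + (w - \<xi>) * (((w - \<xi>)^n * deriv g w) / ((w - \<xi>)^n * g w))"
        by (simp only: add_divide_distrib times_divide_eq_right fw(1))
      also have "\<dots> = of_nat n + (w - \<xi>) * (deriv g w / g w)"
      proof -
        have P: "(w - \<xi>)^n \<noteq> 0" using elim by simp
        then have "f w \<noteq> 0" using fw by (metis mult_eq_0_iff)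
        then have "of_nat n * f w / f w = of_nat n" by simp
        then show ?thesis by (simp only: mult_divide_mult_cancel_left[OF P])
      qed
      finally show ?case by (rule sym)
    qed
  qed
  ultimately have "((\<lambda>w. (w - \<xi>) * (deriv f w / f w)) \<longlongrightarrow> of_nat n) (at \<xi>)"
    by (rule Lim_transform_eventually)
  then show ?thesis using n by blast
qed

lemma zeta_reg_log_deriv_residue:
  assumes "Re \<xi> > 0"
  shows "\<exists>m::nat. (m > 0 \<longleftrightarrow> zeta_reg \<xi> = 0) \<and> ((\<lambda>w. (w - \<xi>) * (deriv zeta_reg w / zeta_reg w)) \<longlongrightarrow> of_nat m) (at \<xi>)"
proof (cases "zeta_reg constant_on {s. Re s > 0}")
  \<comment> \<open>A constant \<open>zeta_reg\<close> would be \<open>zeta_reg 1 = 1\<close>, and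
    then \<open>m = 0\<close> serves; this settles the case excluded by
    \<open>log_deriv_residue\<close>.\<close>
  case True
  then obtain c where "\<And>s. Re s > 0 \<Longrightarrow> zeta_reg s = c" by (auto simp: constant_on_def)
  with this[of 1] have c: "\<And>s. Re s > 0 \<Longrightarrow> zeta_reg s = 1" by auto
  have "deriv zeta_reg s = 0" if "Re s > 0" for s
  proof -
    have "((\<lambda>_. 1) has_field_derivative 0) (at s)" by simp
    then have "(zeta_reg has_field_derivative 0) (at s)"
      by (rule has_field_derivative_transform_within_open[of _ _ _ "{s. Re s > 0}"])
        (use that c in \<open>auto simp: open_halfspace_Re_gt\<close>)
    then show ?thesis by (rule DERIV_imp_deriv)
  qed
  moreover have "\<forall>\<^sub>F w in at \<xi>. Re w > 0"
    using assms eventually_at_in_open'[of "{s. Re s > 0}" \<xi>] by (simp add: open_halfspace_Re_gt)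
  ultimately have "((\<lambda>w. (w - \<xi>) * (deriv zeta_reg w / zeta_reg w)) \<longlongrightarrow> of_nat 0) (at \<xi>)"
    by (intro tendsto_eventually) (auto elim: eventually_mono)
  then show ?thesis using c[OF assms] by (intro exI[of _ 0]) auto
next
  case False
  show ?thesis
    by (rule log_deriv_residue[OF zeta_reg_holomorphic _ _ _ False])
      (use assms in \<open>auto simp: open_halfspace_Re_gt convex_halfspace_Re_gt intro!: convex_connected\<close>)
qed

lemma mangoldt_series_holomorphic: "mangoldt_series holomorphic_on {s. Re s > 1}"
  unfolding mangoldt_series_def[abs_def]
  using dirichlet_has_derivative[OF mangoldt_bound]
  by (auto simp: holomorphic_on_open open_halfspace_Re_gt)

text \<open>A zero would give the logarithmic derivative a pole, but nearby it is controlled by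
  \<open>1 / (w - 1) - mangoldt_series w\<close>, which is continuous at \<open>s\<close>.\<close>

lemma zeta_reg_nonzero_right:
  assumes "Re s > 1"
  shows "zeta_reg s \<noteq> 0"
proof
  assume "zeta_reg s = 0"
  then obtain m where m: "m > 0" "((\<lambda>w. (w - s) * (deriv zeta_reg w / zeta_reg w)) \<longlongrightarrow> of_nat m) (at s)"
    using zeta_reg_log_deriv_residue[of s] assms by auto
  have op: "open {s. Re s > 1}" by (simp add: open_halfspace_Re_gt)
  have "isCont mangoldt_series s"
    using holomorphic_on_imp_continuous_on[OF mangoldt_series_holomorphic] op assms
    by (auto intro: continuous_on_interior simp: interior_open)
  then have "((\<lambda>w. (w - s) * (1 / (w - 1) - mangoldt_series w)) \<longlongrightarrow> (s - s) * (1 / (s - 1) - mangoldt_series s)) (at s)"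
    using assms by (intro tendsto_intros) (auto simp: isCont_def)
  then have "((\<lambda>w. norm ((w - s) * (1 / (w - 1) - mangoldt_series w))) \<longlongrightarrow> 0) (at s)"
    by (simp add: tendsto_norm_zero)
  \<comment> \<open>Only an inequality: where \<open>zeta_reg w = 0\<close> the quotient on the left
    is 0 by convention.\<close>
  moreover have "\<forall>\<^sub>F w in at s. norm ((w - s) * (deriv zeta_reg w / zeta_reg w)) \<le> norm ((w - s) * (1 / (w - 1) - mangoldt_series w))"
    using eventually_at_in_open'[OF op, of s] assms
    by (auto elim!: eventually_mono simp: deriv_zeta_reg)
  ultimately have "((\<lambda>w. (w - s) * (deriv zeta_reg w / zeta_reg w)) \<longlongrightarrow> 0) (at s)"
    by (rule Lim_null_comparison[rotated])
  with m have "of_nat m = (0::complex)" by (intro tendsto_unique[OF _ m(2)]) auto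
  with m(1) show False by simp
qed

lemma mangoldt_series_eq:
  assumes "Re s > 1"
  shows "mangoldt_series s = 1 / (s - 1) - deriv zeta_reg s / zeta_reg s"
  using zeta_reg_nonzero_right[OF assms] by (simp add: deriv_zeta_reg[OF assms])

text \<open>Each term carries the factor
  \<open>3 + 4 cos u + cos (2 u) = 2 (1 + cos u)^2\<close>.\<close>

lemma mangoldt_series_341:
  assumes "x > 1"
  shows "Re (3 * mangoldt_series (Complex x 0) + 4 * mangoldt_series (Complex x t) + mangoldt_series (Complex x (2 * t))) \<ge> 0"
proof -
  have sm: "summable (\<lambda>n. mangoldt n * of_nat n powr (- Complex x u) :: complex)" for u
    using dirichlet_summable_norm[OF mangoldt_bound, of "Complex x u"] assms by (auto intro: summable_norm_cancel)
  have Re: "Re (mangoldt n * of_nat n powr (- Complex x u)) = mangoldt n * real n powr (-x) * cos (u * ln (real n))" for u n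
  proof (cases "n = 0")
    case False
    have "of_nat n powr (- Complex x u) = exp (- Complex x u * of_real (ln (real n)))"
      using False by (simp add: powr_def flip: Ln_of_real Ln_of_nat)
    then have "Re (of_nat n powr (- Complex x u)) = real n powr (-x) * cos (u * ln (real n))"
      using False by (simp add: Re_exp powr_def)
    moreover have "Re (mangoldt n * w) = mangoldt n * Re w" for w by simp
    ultimately show ?thesis by (simp only: mult.assoc)
  qed auto
  have "(\<lambda>n. 3 * (mangoldt n * of_nat n powr (- Complex x 0)) + 4 * (mangoldt n * of_nat n powr (- Complex x t)) +
      (mangoldt n * of_nat n powr (- Complex x (2 * t))))
    sums (3 * mangoldt_series (Complex x 0) + 4 * mangoldt_series (Complex x t) + mangoldt_series (Complex x (2 * t)))"
    unfolding mangoldt_series_def by (intro sums_add sums_mult summable_sums sm)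
  note S = sums_Re[OF this]
  show ?thesis
  proof (rule sums_le[OF _ sums_zero S])
    fix n :: nat
    let ?w = "mangoldt n * real n powr (-x)" and ?c = "cos (t * ln (real n))"
    have "Re (3 * (mangoldt n * of_nat n powr (- Complex x 0)) + 4 * (mangoldt n * of_nat n powr (- Complex x t)) +
      (mangoldt n * of_nat n powr (- Complex x (2 * t)))) = ?w * (3 + 4 * ?c + cos (2 * (t * ln (real n))))"
    proof -
      have "Re (3 * a + 4 * b + c) = 3 * Re a + 4 * Re b + Re c" for a b c by simp
      then show ?thesis by (simp only: Re) (simp add: algebra_simps)
    qed
    also have "\<dots> = ?w * (2 * (1 + ?c)^2)"
    proof -
      have "cos (2 * (t * ln (real n))) = 2 * ?c^2 - 1" by (rule cos_double_cos)
      then have "3 + 4 * ?c + cos (2 * (t * ln (real n))) = 2 * (1 + ?c)^2"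
        by (simp only:) (simp add: power2_eq_square algebra_simps)
      then show ?thesis by (simp only:)
    qed
    also have "0 \<le> \<dots>" by (simp add: mangoldt_nonneg)
    finally show "0 \<le> Re (3 * (mangoldt n * of_nat n powr (- Complex x 0)) + 4 * (mangoldt n * of_nat n powr (- Complex x t)) +
      (mangoldt n * of_nat n powr (- Complex x (2 * t))))" .
  qed
qed

text \<open>As \<open>e\<close> decreases to 0, the real part of
  \<open>e * mangoldt_series (Complex (1 + e) u)\<close> tends to \<open>of_bool (u = 0)\<close>
  minus the order of the zero at \<open>Complex 1 u\<close>. The inequality with weights 3, 4, 1
  becomes \<open>3 * (1 - m0) - 4 * m1 - m2 \<ge> 0\<close>, so the natural number \<open>m1\<close>
  is 0.\<close>

lemma zeta_reg_nonzero:
  assumes "Re s \<ge> 1"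
  shows "zeta_reg s \<noteq> 0"
proof (cases "Re s > 1 \<or> s = 1")
  case True
  then show ?thesis using zeta_reg_nonzero_right by auto
next
  case False
  define t where "t = Im s"
  have s: "s = Complex 1 t" using False assms by (auto simp: t_def complex_eq_iff)
  have "t \<noteq> 0" using False assms s by (auto simp: complex_eq_iff)
  have lim: "\<exists>m::nat. (m > 0 \<longleftrightarrow> zeta_reg (Complex 1 u) = 0) \<and>
      ((\<lambda>e. Re (of_real e * mangoldt_series (Complex (1 + e) u))) \<longlongrightarrow> of_bool (u = 0) - real m) (at_right 0)" for u
  proof -
    obtain m :: nat where m: "(m > 0 \<longleftrightarrow> zeta_reg (Complex 1 u) = 0)"
      "((\<lambda>w. (w - Complex 1 u) * (deriv zeta_reg w / zeta_reg w)) \<longlongrightarrow> of_nat m) (at (Complex 1 u))"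
      using zeta_reg_log_deriv_residue[of "Complex 1 u"] by auto
    have fl: "filterlim (\<lambda>e. Complex (1 + e) u) (at (Complex 1 u)) (at_right 0)"
    proof (rule filterlim_atI)
      have "((\<lambda>e. Complex (1 + e) u) \<longlongrightarrow> Complex (1 + 0) u) (at_right 0)"
        by (intro tendsto_intros)
      then show "((\<lambda>e. Complex (1 + e) u) \<longlongrightarrow> Complex 1 u) (at_right 0)" by simp
    qed (auto simp: eventually_at_filter)
    have 1: "((\<lambda>e. of_real e / (Complex (1 + e) u - 1)) \<longlongrightarrow> of_bool (u = 0)) (at_right 0)"
    proof (cases "u = 0")
      case True
      have "\<forall>\<^sub>F e in at_right 0. of_real e / (Complex (1 + e) u - 1) = 1"
        using True by (auto simp: eventually_at_filter complex_eq_iff Complex_eq)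
      then show ?thesis using True by (simp add: tendsto_eventually)
    next
      case False
      have "((\<lambda>e. of_real e / (Complex (1 + e) u - 1)) \<longlongrightarrow> of_real 0 / (Complex (1 + 0) u - 1)) (at_right 0)"
        using False by (intro tendsto_intros) (auto simp: complex_eq_iff)
      then show ?thesis using False by simp
    qed
    have 2: "((\<lambda>e. (Complex (1 + e) u - Complex 1 u) * (deriv zeta_reg (Complex (1 + e) u) / zeta_reg (Complex (1 + e) u))) \<longlongrightarrow> of_nat m) (at_right 0)"
      by (rule filterlim_compose[OF m(2) fl])
    have "((\<lambda>e. of_real e * mangoldt_series (Complex (1 + e) u)) \<longlongrightarrow> of_bool (u = 0) - of_nat m) (at_right 0)"
    proof (rule Lim_transform_eventually[OF tendsto_diff[OF 1 2]])
      show "\<forall>\<^sub>F e in at_right 0. of_real e / (Complex (1 + e) u - 1) - (Complex (1 + e) u - Complex 1 u) * (deriv zeta_reg (Complex (1 + e) u) / zeta_reg (Complex (1 + e) u))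
         = of_real e * mangoldt_series (Complex (1 + e) u)"
      proof (rule eventually_mono)
        show "\<forall>\<^sub>F e in at_right 0. e > (0::real)" by (simp add: eventually_at_filter)
        fix e :: real assume "e > 0"
        have "Complex (1 + e) u - Complex 1 u = of_real e" by (simp add: complex_eq_iff)
        then show "of_real e / (Complex (1 + e) u - 1) - (Complex (1 + e) u - Complex 1 u) * (deriv zeta_reg (Complex (1 + e) u) / zeta_reg (Complex (1 + e) u))
         = of_real e * mangoldt_series (Complex (1 + e) u)"
          using \<open>e > 0\<close> by (simp add: mangoldt_series_eq algebra_simps)
      qed
    qed
    from tendsto_Re[OF this] m(1) show ?thesis by (intro exI[of _ m]) (auto split: if_splits)
  qed
  obtain m0 :: nat where m0: "((\<lambda>e. Re (of_real e * mangoldt_series (Complex (1 + e) 0))) \<longlongrightarrow> of_bool True - real m0) (at_right 0)"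
    using lim[of 0] by auto
  obtain m1 :: nat where m1: "m1 > 0 \<longleftrightarrow> zeta_reg s = 0"
    "((\<lambda>e. Re (of_real e * mangoldt_series (Complex (1 + e) t))) \<longlongrightarrow> of_bool False - real m1) (at_right 0)"
    using lim[of t] s \<open>t \<noteq> 0\<close> by auto
  obtain m2 :: nat where m2: "((\<lambda>e. Re (of_real e * mangoldt_series (Complex (1 + e) (2 * t)))) \<longlongrightarrow> of_bool False - real m2) (at_right 0)"
    using lim[of "2 * t"] \<open>t \<noteq> 0\<close> by auto
  have "3 * (of_bool True - real m0) + 4 * (of_bool False - real m1) + (of_bool False - real m2) \<ge> 0"
  proof (rule tendsto_lowerbound)
    show "((\<lambda>e. 3 * Re (of_real e * mangoldt_series (Complex (1 + e) 0)) + 4 * Re (of_real e * mangoldt_series (Complex (1 + e) t))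
      + Re (of_real e * mangoldt_series (Complex (1 + e) (2 * t)))) \<longlongrightarrow>
       3 * (of_bool True - real m0) + 4 * (of_bool False - real m1) + (of_bool False - real m2)) (at_right 0)"
      by (intro tendsto_intros m0 m1 m2)
    show "\<forall>\<^sub>F e in at_right 0. 0 \<le> 3 * Re (of_real e * mangoldt_series (Complex (1 + e) 0)) + 4 * Re (of_real e * mangoldt_series (Complex (1 + e) t))
      + Re (of_real e * mangoldt_series (Complex (1 + e) (2 * t)))"
    proof (rule eventually_mono)
      show "\<forall>\<^sub>F e in at_right 0. e > (0::real)" by (simp add: eventually_at_filter)
      fix e :: real assume "e > 0"
      then have "0 \<le> e * Re (3 * mangoldt_series (Complex (1 + e) 0) + 4 * mangoldt_series (Complex (1 + e) t) + mangoldt_series (Complex (1 + e) (2 * t)))"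
        using mangoldt_series_341[of "1 + e" t] by simp
      then show "0 \<le> 3 * Re (of_real e * mangoldt_series (Complex (1 + e) 0)) + 4 * Re (of_real e * mangoldt_series (Complex (1 + e) t))
        + Re (of_real e * mangoldt_series (Complex (1 + e) (2 * t)))"
        by (simp add: algebra_simps)
    qed
  qed simp
  then have "m1 = 0" by simp
  then show ?thesis using m1 by auto
qed

section \<open>Newman's Tauberian theorem\<close>

lemma powr_mvt:
  assumes "0 < a" "a < (b::real)"
  obtains \<xi> where "a < \<xi>" "\<xi> < b" "b powr p - a powr p = (b - a) * (p * \<xi> powr (p - 1))"
proof -
  have "\<exists>\<xi>>a. \<xi> < b \<and> b powr p - a powr p = (b - a) * (p * \<xi> powr (p - 1))"
    using assms by (intro MVT2) (auto intro!: derivative_eq_intros)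
  then show ?thesis using that by blast
qed

text \<open>Comparison with an integral, made telescoping by the mean value theorem.\<close>

lemma sum_powr_tail_le:
  assumes "x > 0" "N > 0" "N \<le> M"
  shows "(\<Sum>n\<in>{N<..M}. real n powr (-1 - x)) \<le> real N powr (-x) / x"
proof -
  have "(\<Sum>n\<in>{N<..M}. real n powr (-1 - x)) \<le> (real N powr (-x) - real M powr (-x)) / x"
    using assms(3)
  proof (induction M rule: dec_induct)
    case (step M)
    then have "M > 0" using assms by simp
    then obtain \<xi> where xi: "real M < \<xi>" "\<xi> < real (Suc M)"
      "real (Suc M) powr (-x) - real M powr (-x) = (real (Suc M) - real M) * (-x * \<xi> powr (-x - 1))"
      using powr_mvt[of "real M" "real (Suc M)" "-x"] by (metis of_nat_0_less_iff of_nat_less_iff lessI)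
    have "real (Suc M) powr (-x - 1) \<le> \<xi> powr (-x - 1)"
      using xi \<open>M > 0\<close> assms(1) by (intro powr_mono2') auto
    then have "x * real (Suc M) powr (-x - 1) \<le> x * \<xi> powr (-x - 1)"
      using assms(1) by (intro mult_left_mono) auto
    also have "\<dots> = real M powr (-x) - real (Suc M) powr (-x)" using xi(3) by simp
    finally have "x * real (Suc M) powr (-x - 1) \<le> real M powr (-x) - real (Suc M) powr (-x)" .
    moreover have "-1 - x = -x - 1" by simp
    ultimately have "x * real (Suc M) powr (-1 - x) \<le> real M powr (-x) - real (Suc M) powr (-x)"
      by (simp only:)
    then have "real (Suc M) powr (-1 - x) \<le> (real M powr (-x) - real (Suc M) powr (-x)) / x"
      using assms(1) by (simp add: le_divide_eq mult.commute)
    moreover have "{N<..Suc M} = insert (Suc M) {N<..M}" using step by auto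
    ultimately show ?case using step.IH by (simp add: diff_divide_distrib)
  qed simp
  also have "\<dots> \<le> real N powr (-x) / x"
    using assms(1) by (intro divide_right_mono) auto
  finally show ?thesis .
qed

text \<open>For \<open>u \<ge> 1\<close> the terms do not decrease and the last one is paid
  separately; for \<open>u < 1\<close> they decrease and the integral alone suffices.\<close>

lemma sum_powr_le:
  assumes "u > 0" "N > 0"
  shows "(\<Sum>n\<in>{0<..N}. real n powr (u - 1)) \<le> real N powr (u - 1) + real N powr u / u"
proof (cases "u \<ge> 1")
  case True
  have "(\<Sum>n\<in>{0<..N}. real n powr (u - 1)) \<le> real N powr (u - 1) + (real N powr u - 1) / u"
    using assms(2)
  proof (induction N rule: nat_induct_non_zero)
    case 1
    have "{0<..Suc 0} = {1}" by auto
    then show ?case by simp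
  next
    case (Suc N)
    obtain \<xi> where xi: "real N < \<xi>" "\<xi> < real (Suc N)"
      "real (Suc N) powr u - real N powr u = (real (Suc N) - real N) * (u * \<xi> powr (u - 1))"
      using powr_mvt[of "real N" "real (Suc N)" u] Suc.hyps by (metis of_nat_0_less_iff of_nat_less_iff lessI)
    have "u * real N powr (u - 1) \<le> u * \<xi> powr (u - 1)"
      using xi True by (intro mult_left_mono powr_mono2) auto
    also have "\<dots> = real (Suc N) powr u - real N powr u" using xi(3) by simp
    finally have "(u * real N powr (u - 1) + real N powr u - 1) / u \<le> (real (Suc N) powr u - 1) / u"
      using assms(1) by (intro divide_right_mono) auto
    then have "real N powr (u - 1) + (real N powr u - 1) / u \<le> (real (Suc N) powr u - 1) / u"
      using assms(1) by (simp add: add_divide_distrib diff_divide_distrib)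
    moreover have "{0<..Suc N} = insert (Suc N) {0<..N}" by auto
    ultimately show ?case using Suc.IH by simp
  qed
  also have "\<dots> \<le> real N powr (u - 1) + real N powr u / u"
    using assms(1) by (simp add: divide_right_mono)
  finally show ?thesis .
next
  case False
  have "(\<Sum>n\<in>{0<..N}. real n powr (u - 1)) \<le> real N powr u / u"
    using assms(2)
  proof (induction N rule: nat_induct_non_zero)
    case 1
    have "{0<..Suc 0} = {1}" by auto
    then show ?case using False assms(1) by simp
  next
    case (Suc N)
    obtain \<xi> where xi: "real N < \<xi>" "\<xi> < real (Suc N)"
      "real (Suc N) powr u - real N powr u = (real (Suc N) - real N) * (u * \<xi> powr (u - 1))"
      using powr_mvt[of "real N" "real (Suc N)" u] Suc.hyps by (metis of_nat_0_less_iff of_nat_less_iff lessI)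
    have "u * real (Suc N) powr (u - 1) \<le> u * \<xi> powr (u - 1)"
      using xi False assms(1) by (intro mult_left_mono powr_mono2') auto
    also have "\<dots> = real (Suc N) powr u - real N powr u" using xi(3) by simp
    finally have "(real N powr u + u * real (Suc N) powr (u - 1)) / u \<le> real (Suc N) powr u / u"
      using assms(1) by (intro divide_right_mono) auto
    then have "real N powr u / u + real (Suc N) powr (u - 1) \<le> real (Suc N) powr u / u"
      using assms(1) by (simp add: add_divide_distrib)
    moreover have "{0<..Suc N} = insert (Suc N) {0<..N}" by auto
    ultimately show ?case using Suc.IH by simp
  qed
  moreover have "real N powr (u - 1) \<ge> 0" by simp
  ultimately show ?thesis by linarith
qed

section \<open>Contours for Newman's argument\<close>

lemma path_image_right_semicircle:
  assumes "R > 0" "z \<in> path_image (part_circlepath 0 R (-(pi/2)) (pi/2))"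
  shows "norm z = R" "Re z \<ge> 0" "z \<notin> \<real>\<^sub>\<le>\<^sub>0"
proof -
  obtain x where x: "-(pi/2) \<le> x" "x \<le> pi/2" "z = of_real R * exp (\<i> * of_real x)"
    using assms(2) by (auto simp: path_image_part_circlepath)
  then have "z = of_real R * cis x" by (simp add: cis_conv_exp)
  then have z: "Re z = R * cos x" "Im z = R * sin x" by simp_all
  show "norm z = R" using x assms by (simp add: norm_mult)
  have "cos x \<ge> 0" using x by (intro cos_ge_zero) auto
  then show "Re z \<ge> 0" using z assms by simp
  show "z \<notin> \<real>\<^sub>\<le>\<^sub>0"
  proof
    assume "z \<in> \<real>\<^sub>\<le>\<^sub>0"
    then have "R * cos x \<le> 0" "R * sin x = 0" using z by (auto simp: complex_nonpos_Reals_iff)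
    then have "cos x = 0" "sin x = 0" using \<open>cos x \<ge> 0\<close> assms(1) by (auto simp: mult_le_0_iff)
    then show False using sin_cos_squared_add[of x] by simp
  qed
qed

lemma path_image_left_semicircle:
  assumes "R > 0" "z \<in> path_image (part_circlepath 0 R (pi/2) (3*pi/2))"
  shows "norm z = R" "Re z \<le> 0" "- z \<notin> \<real>\<^sub>\<le>\<^sub>0"
proof -
  obtain x where x: "pi/2 \<le> x" "x \<le> 3*pi/2" "z = of_real R * exp (\<i> * of_real x)"
    using assms(2) by (auto simp: path_image_part_circlepath)
  have "-z \<in> path_image (part_circlepath 0 R (-(pi/2)) (pi/2))"
    using x exp_pi_i by (auto simp: path_image_part_circlepath exp_diff algebra_simps intro!: image_eqI[of _ _ "x - pi"] exI[of _ "x - pi"])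
  from path_image_right_semicircle[OF assms(1) this]
  show "norm z = R" "Re z \<le> 0" "- z \<notin> \<real>\<^sub>\<le>\<^sub>0" by auto
qed

lemma Ln_imag_axis:
  assumes "R > 0"
  shows "Ln (\<i> * of_real R) - Ln (- (\<i> * of_real R)) = \<i> * pi"
proof -
  show ?thesis
    using Ln_times_of_real[of R "\<i>"] Ln_times_of_real[of R "-\<i>"] assms by (simp add: mult.commute)
qed

text \<open>The winding number is 1 because each half contributes \<open>\<i> * pi\<close>: the
  principal logarithm is a primitive of \<open>1 / z\<close> along the right arc,
  \<open>Ln (-z)\<close> along the left path. The left path \<open>q\<close> is arbitrary since two
  are used: three sides of a rectangle inside the domain of continuation, and the left
  semicircle.\<close>

lemma cauchy_formula_semicircle:
  assumes V: "convex V" "open V" "0 \<in> V" and g: "g holomorphic_on V" and R: "R > 0"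
    and P: "path_image (part_circlepath 0 R (-(pi/2)) (pi/2)) \<subseteq> V"
    and q: "valid_path q" "path_image q \<subseteq> V" "pathstart q = \<i> * of_real R" "pathfinish q = - (\<i> * of_real R)"
    and qn: "\<And>z. z \<in> path_image q \<Longrightarrow> - z \<notin> \<real>\<^sub>\<le>\<^sub>0"
  shows "contour_integral (part_circlepath 0 R (-(pi/2)) (pi/2)) (\<lambda>z. g z / z) + contour_integral q (\<lambda>z. g z / z) = 2 * pi * \<i> * g 0"
    and "(\<lambda>z. g z / z) contour_integrable_on (part_circlepath 0 R (-(pi/2)) (pi/2))"
    and "(\<lambda>z. g z / z) contour_integrable_on q"
proof -
  let ?p = "part_circlepath 0 R (-(pi/2)) (pi/2)"
  have st: "pathstart ?p = - (\<i> * of_real R)" "pathfinish ?p = \<i> * of_real R"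
    using cis_conv_exp[of "pi/2"] by (simp_all add: exp_minus)
  have P0: "0 \<notin> path_image ?p" using path_image_right_semicircle[OF R] R by force
  have Q0: "0 \<notin> path_image q" using qn by force
  have 1: "((\<lambda>z. 1 / z) has_contour_integral (Ln (pathfinish ?p) - Ln (pathstart ?p))) ?p"
    by (rule contour_integral_primitive[where S = "- \<real>\<^sub>\<le>\<^sub>0"])
      (use path_image_right_semicircle[OF R] in \<open>auto intro!: derivative_eq_intros simp: field_simps\<close>)
  have 2: "((\<lambda>z. 1 / z) has_contour_integral ((\<lambda>z. Ln (-z)) (pathfinish q) - (\<lambda>z. Ln (-z)) (pathstart q))) q"
    by (rule contour_integral_primitive[where S = "{z. -z \<notin> \<real>\<^sub>\<le>\<^sub>0}"])
      (use qn q(1) in \<open>auto intro!: derivative_eq_intros simp: field_simps\<close>)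
  have 1: "((\<lambda>z. 1 / z) has_contour_integral \<i> * pi) ?p"
    using 1 unfolding st Ln_imag_axis[OF R] .
  have 2: "((\<lambda>z. 1 / z) has_contour_integral \<i> * pi) q"
    using 2 unfolding q(3,4) minus_minus Ln_imag_axis[OF R] .
  have v: "valid_path (?p +++ q)" using q st by (intro valid_path_join) auto
  have im: "path_image (?p +++ q) \<subseteq> V - {0}"
    using P P0 q(2) Q0 path_image_join_subset[of ?p q] by blast
  have "winding_number (?p +++ q) 0 = 1 / (2 * pi * \<i>) * contour_integral (?p +++ q) (\<lambda>w. 1 / (w - 0))"
    using im v by (intro winding_number_valid_path) auto
  also have "contour_integral (?p +++ q) (\<lambda>w. 1 / (w - 0)) = \<i> * pi + \<i> * pi"
    using has_contour_integral_join[OF 1 2] q by (intro contour_integral_unique) simp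
  finally have w: "winding_number (?p +++ q) 0 = 1" by simp
  have "((\<lambda>z. g z / (z - 0)) has_contour_integral (2 * pi * \<i> * winding_number (?p +++ q) 0 * g 0)) (?p +++ q)"
    using V g v im q st by (intro Cauchy_integral_formula_convex_simple[where S = V]) (auto simp: interior_open)
  then have *: "((\<lambda>z. g z / z) has_contour_integral (2 * pi * \<i> * g 0)) (?p +++ q)"
    using w by simp
  then have "(\<lambda>z. g z / z) contour_integrable_on (?p +++ q)"
    by (rule has_contour_integral_integrable)
  then show i: "(\<lambda>z. g z / z) contour_integrable_on ?p" "(\<lambda>z. g z / z) contour_integrable_on q"
    using q(1) by (auto intro: contour_integrable_joinD1 contour_integrable_joinD2)
  show "contour_integral ?p (\<lambda>z. g z / z) + contour_integral q (\<lambda>z. g z / z) = 2 * pi * \<i> * g 0"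
    using contour_integral_unique[OF *] contour_integral_join[OF i _ q(1)] by simp
qed

text \<open>On the circle \<open>1 / z = cnj z / R\<^sup>2\<close>, which turns the kernel into
  \<open>2 * Re z / R\<^sup>2\<close>. Its vanishing at \<open>Re z = 0\<close> cancels the growth
  \<open>1 / Re z\<close> of the estimates for the sums.\<close>

lemma newman_kernel_norm:
  assumes "norm z = R" "R > 0"
  shows "norm ((1 + z\<^sup>2 / of_real (R\<^sup>2)) / z) = 2 * \<bar>Re z\<bar> / R\<^sup>2"
proof -
  have "z \<noteq> 0" using assms by auto
  have zz: "z * cnj z = of_real (R\<^sup>2)" using assms complex_norm_square[of z] by simp
  then have "(1 + z\<^sup>2 / of_real (R\<^sup>2)) / z = (z * cnj z + z\<^sup>2) / (of_real (R\<^sup>2) * z)"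
    using assms(2) \<open>z \<noteq> 0\<close> by (simp add: field_simps)
  also have "\<dots> = (cnj z + z) / of_real (R\<^sup>2)"
    using \<open>z \<noteq> 0\<close> assms(2) by (simp add: field_simps power2_eq_square)
  also have "cnj z + z = of_real (2 * Re z)" by (simp add: complex_eq_iff)
  finally show ?thesis by (simp add: norm_divide norm_power abs_mult)
qed

lemma tendsto_const_over_powr:
  assumes "\<eta> > 0"
  shows "(\<lambda>N. A * real N powr (-\<eta>)) \<longlonglongrightarrow> 0"
  using assms by real_asymp

lemma norm_nat_powr_le_1:
  assumes "N > 0" "Re z \<le> 0"
  shows "norm (of_nat N powr z :: complex) \<le> 1"
proof -
  have "real N powr Re z \<le> real N powr 0" using assms by (intro powr_mono) auto
  then show ?thesis using assms by (simp add: norm_of_nat_powr)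
qed

section \<open>Estimates for partial sums and tails on the arcs\<close>

lemma newman_partial_sum_holomorphic:
  "(\<lambda>z. \<Sum>n\<in>A. e n * of_nat n powr (-1 - z :: complex)) holomorphic_on S"
proof (intro holomorphic_on_sum holomorphic_on_mult holomorphic_on_const)
  fix n :: nat
  show "(\<lambda>z. of_nat n powr (-1 - z :: complex)) holomorphic_on S"
    using has_field_derivative_nat_powr[of n "-1"] unfolding holomorphic_on_def field_differentiable_def by blast
qed

text \<open>The finite sum is entire, so on the left it is bounded directly, by comparison with an
  integral up to \<open>N\<close>.\<close>

lemma newman_partial_sum_left:
  fixes e :: "nat \<Rightarrow> complex"
  assumes C: "\<And>n. norm (e n) \<le> C" and "Re z < 0" "N > 0"
  shows "norm (\<Sum>n\<in>{0<..N}. e n * of_nat n powr (-1 - z)) \<le> C * (real N powr (- Re z - 1) + real N powr (- Re z) / (- Re z))"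
proof -
  have C0: "C \<ge> 0" using order_trans[OF norm_ge_zero C[of 0]] .
  have "norm (\<Sum>n\<in>{0<..N}. e n * of_nat n powr (-1 - z)) \<le> (\<Sum>n\<in>{0<..N}. C * real n powr (- Re z - 1))"
  proof (rule sum_norm_le)
    fix n assume "n \<in> {0<..N}"
    then have "norm (of_nat n powr (-1 - z) :: complex) = real n powr (- Re z - 1)"
      by (simp add: norm_of_nat_powr minus_diff_commute)
    then show "norm (e n * of_nat n powr (-1 - z)) \<le> C * real n powr (- Re z - 1)"
      using C by (simp add: norm_mult mult_right_mono)
  qed
  also have "\<dots> = C * (\<Sum>n\<in>{0<..N}. real n powr (- Re z - 1))" by (simp add: sum_distrib_left)
  also have "\<dots> \<le> C * (real N powr (- Re z - 1) + real N powr (- Re z) / (- Re z))"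
    using assms C0 by (intro mult_left_mono sum_powr_le) auto
  finally show ?thesis .
qed

lemma newman_partial_sum_tail:
  fixes e :: "nat \<Rightarrow> complex"
  assumes C: "\<And>n. norm (e n) \<le> C" and "Re z > 0" "N > 0"
    and S: "(\<lambda>n. e n * of_nat n powr (-1 - z)) sums f"
  shows "norm (f - (\<Sum>n\<in>{0<..N}. e n * of_nat n powr (-1 - z))) \<le> C * (real N powr (- Re z) / Re z)"
proof -
  have C0: "C \<ge> 0" using order_trans[OF norm_ge_zero C[of 0]] .
  let ?S = "\<lambda>M. \<Sum>n\<in>{0<..M}. e n * of_nat n powr (-1 - z)"
  have "?S M = (\<Sum>n\<le>M. e n * of_nat n powr (-1 - z))" for M
    by (rule sum.mono_neutral_left) (auto simp: not_less_eq_eq)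
  then have lim: "?S \<longlonglongrightarrow> f" using S by (simp add: sums_def_le)
  show ?thesis
  proof (rule tendsto_upperbound)
    show "(\<lambda>M. norm (?S M - ?S N)) \<longlonglongrightarrow> norm (f - ?S N)" by (intro tendsto_intros lim)
    show "\<forall>\<^sub>F M in sequentially. norm (?S M - ?S N) \<le> C * (real N powr (- Re z) / Re z)"
      using eventually_ge_at_top[of N]
    proof eventually_elim
      case (elim M)
      have "?S M - ?S N = (\<Sum>n\<in>{0<..M} - {0<..N}. e n * of_nat n powr (-1 - z))"
        using elim by (subst sum_diff) auto
      also have "{0<..M} - {0<..N} = {N<..M}" by auto
      finally have "norm (?S M - ?S N) = norm (\<Sum>n\<in>{N<..M}. e n * of_nat n powr (-1 - z))" by simp
      also have "\<dots> \<le> (\<Sum>n\<in>{N<..M}. C * real n powr (-1 - Re z))"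
      proof (rule sum_norm_le)
        fix n assume "n \<in> {N<..M}"
        then have "norm (of_nat n powr (-1 - z) :: complex) = real n powr (-1 - Re z)"
          by (simp add: norm_of_nat_powr)
        then show "norm (e n * of_nat n powr (-1 - z)) \<le> C * real n powr (-1 - Re z)"
          using C by (simp add: norm_mult mult_right_mono)
      qed
      also have "\<dots> = C * (\<Sum>n\<in>{N<..M}. real n powr (-1 - Re z))" by (simp add: sum_distrib_left)
      also have "\<dots> \<le> C * (real N powr (- Re z) / Re z)"
        using assms C0 elim by (intro mult_left_mono sum_powr_tail_le) auto
      finally show ?case .
    qed
  qed simp
qed

lemma nat_powr_holomorphic: "(\<lambda>z. of_nat N powr z :: complex) holomorphic_on S"
proof -
  have "(\<lambda>z. of_nat N powr z :: complex) field_differentiable (at z within S)" for z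
  proof (cases "N = 0")
    case False
    then have "(\<lambda>z. of_nat N powr z :: complex) = (\<lambda>z. exp (z * Ln (of_nat N)))" by (simp add: powr_def)
    then show ?thesis
      by (simp only:) (auto simp: field_differentiable_def intro!: exI derivative_eq_intros)
  qed simp
  then show ?thesis by (auto simp: holomorphic_on_def)
qed

text \<open>The factors \<open>N powr (- Re z)\<close> and \<open>1 / Re z\<close> of the tail
  cancel against the kernel, leaving \<open>2 * C / R\<^sup>2\<close>. On the left the extra last
  term of the partial sum adds \<open>\<bar>Re z\<bar> / N\<close>, at most 1 by
  \<open>N \<ge> R\<close>, which doubles the constant.\<close>

lemma newman_arc_bounds:
  fixes e :: "nat \<Rightarrow> complex"
  assumes C: "\<And>n. norm (e n) \<le> C" and "norm z = R" "R > 0" "N > 0" "real N \<ge> R"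
  shows "Re z > 0 \<Longrightarrow> (\<lambda>n. e n * of_nat n powr (-1 - z)) sums f \<Longrightarrow>
      norm (f * (of_nat N powr z * (1 + z\<^sup>2 / of_real (R\<^sup>2))) / z -
        (\<Sum>n\<in>{0<..N}. e n * of_nat n powr (-1 - z)) * (of_nat N powr z * (1 + z\<^sup>2 / of_real (R\<^sup>2))) / z) \<le> 2 * C / R\<^sup>2"
    and "Re z < 0 \<Longrightarrow>
      norm ((\<Sum>n\<in>{0<..N}. e n * of_nat n powr (-1 - z)) * (of_nat N powr z * (1 + z\<^sup>2 / of_real (R\<^sup>2))) / z) \<le> 4 * C / R\<^sup>2"
proof -
  have C0: "C \<ge> 0" using order_trans[OF norm_ge_zero C[of 0]] .
  let ?S = "\<Sum>n\<in>{0<..N}. e n * of_nat n powr (-1 - z)"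
  have k: "norm (of_nat N powr z * (1 + z\<^sup>2 / of_real (R\<^sup>2)) / z) = real N powr Re z * (2 * \<bar>Re z\<bar> / R\<^sup>2)"
    using newman_kernel_norm[OF assms(2,3)] assms(4)
    by (simp add: norm_of_nat_powr norm_mult norm_divide flip: times_divide_eq_right)
  {
    assume z: "Re z > 0" and f: "(\<lambda>n. e n * of_nat n powr (-1 - z)) sums f"
    have "norm (f * (of_nat N powr z * (1 + z\<^sup>2 / of_real (R\<^sup>2))) / z - ?S * (of_nat N powr z * (1 + z\<^sup>2 / of_real (R\<^sup>2))) / z)
        = norm (f - ?S) * norm (of_nat N powr z * (1 + z\<^sup>2 / of_real (R\<^sup>2)) / z)"
      by (simp only: norm_mult[symmetric] left_diff_distrib diff_divide_distrib times_divide_eq_right)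
    also have "\<dots> \<le> C * (real N powr (- Re z) / Re z) * (real N powr Re z * (2 * \<bar>Re z\<bar> / R\<^sup>2))"
      unfolding k using C0 z assms(4) newman_partial_sum_tail[OF C z assms(4) f] by (intro mult_right_mono) auto
    also have "\<dots> = 2 * C / R\<^sup>2 * (real N powr (- Re z) * real N powr Re z)"
      using z by (simp add: field_simps)
    also have "real N powr (- Re z) * real N powr Re z = 1"
      using assms(4) by (simp add: powr_add[symmetric])
    finally show "norm (f * (of_nat N powr z * (1 + z\<^sup>2 / of_real (R\<^sup>2))) / z -
        ?S * (of_nat N powr z * (1 + z\<^sup>2 / of_real (R\<^sup>2))) / z) \<le> 2 * C / R\<^sup>2" by simp
  }
  {
    assume z: "Re z < 0"
    have "norm (?S * (of_nat N powr z * (1 + z\<^sup>2 / of_real (R\<^sup>2))) / z) = norm ?S * norm (of_nat N powr z * (1 + z\<^sup>2 / of_real (R\<^sup>2)) / z)"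
      by (simp only: norm_mult[symmetric] times_divide_eq_right)
    also have "\<dots> \<le> C * (real N powr (- Re z - 1) + real N powr (- Re z) / (- Re z)) * (real N powr Re z * (2 * \<bar>Re z\<bar> / R\<^sup>2))"
      unfolding k by (rule mult_right_mono[OF newman_partial_sum_left[OF C z assms(4)]]) auto
    also have "\<dots> = 2 * C / R\<^sup>2 * (real N powr (- Re z) * real N powr Re z) * (\<bar>Re z\<bar> / real N + 1)"
    proof -
      have alg: "C * (a / n + a / u) * (b * (2 * u / R\<^sup>2)) = 2 * C / R\<^sup>2 * (a * b) * (u / n + 1)"
        if "u > 0" "n > 0" for a b u n :: real
        using that assms(3) by (simp add: field_simps)
      have "real N powr (- Re z - 1) = real N powr (- Re z) / real N" using assms(4) by (simp add: powr_diff)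
      then show ?thesis using alg[of "- Re z" "real N"] z assms(4) by (simp only: abs_of_neg)
    qed
    also have "real N powr (- Re z) * real N powr Re z = 1"
      using assms(4) by (simp add: powr_add[symmetric])
    also have "2 * C / R\<^sup>2 * 1 * (\<bar>Re z\<bar> / real N + 1) \<le> 2 * C / R\<^sup>2 * 1 * (1 + 1)"
    proof -
      have "\<bar>Re z\<bar> \<le> real N" using abs_Re_le_cmod[of z] assms by linarith
      then have "\<bar>Re z\<bar> / real N \<le> 1" using assms(4) by simp
      then show ?thesis using C0 by (intro mult_left_mono add_mono) auto
    qed
    finally show "norm (?S * (of_nat N powr z * (1 + z\<^sup>2 / of_real (R\<^sup>2))) / z) \<le> 4 * C / R\<^sup>2" by simp
  }
qed

text \<open>The two arcs, each of length \<open>pi * R\<close>, contribute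
  \<open>2 * C / R\<^sup>2\<close> and \<open>4 * C / R\<^sup>2\<close> per unit length; after
  division by \<open>2 * pi\<close> this is \<open>3 * C / R\<close>. The integral of
  \<open>F\<close> over a shallow rectangle left of the imaginary axis becomes small as
  \<open>N\<close> grows. The radius is fixed first, then the depth, then \<open>N\<close>.\<close>

lemma newman_estimate:
  fixes e :: "nat \<Rightarrow> complex"
  assumes C: "\<And>n. norm (e n) \<le> C" and U: "open U" "{z. Re z \<ge> 0} \<subseteq> U" and F: "F holomorphic_on U"
    and S: "\<And>z. Re z > 0 \<Longrightarrow> (\<lambda>n. e n * of_nat n powr (-1 - z)) sums F z"
    and R: "R \<ge> 1" and eps: "\<epsilon> > 0"
  shows "\<forall>\<^sub>F N in sequentially. norm (F 0 - (\<Sum>n\<in>{0<..N}. e n * of_nat n powr (-1))) \<le> 3 * C / R + \<epsilon>"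
proof -
  have C0: "C \<ge> 0" using order_trans[OF norm_ge_zero C[of 0]] .
  \<comment> \<open>The part of \<open>U\<close> left of the imaginary axis may become arbitrarily
    thin far out; compactness of a segment gives a width \<open>\<delta>\<close> for the given
    \<open>R\<close>.\<close>
  have "compact (Complex 0 ` {-(2*R)..2*R})"
    by (intro compact_continuous_image continuous_intros) auto
  moreover have "Complex 0 ` {-(2*R)..2*R} \<subseteq> U" using U by auto
  ultimately obtain \<delta> where \<delta>: "\<delta> > 0" "(\<Union>x\<in>Complex 0 ` {-(2*R)..2*R}. ball x \<delta>) \<subseteq> U"
    using U by (metis compact_subset_open_imp_ball_epsilon_subset)
  define V where "V = {z. Re z > -\<delta>} \<inter> {z. Im z < 2 * R} \<inter> {z. Im z > - (2 * R)}"
  have V: "convex V" "open V"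
    unfolding V_def by (intro convex_Int convex_halfspace_Re_gt convex_halfspace_Im_lt convex_halfspace_Im_gt)
      (intro open_Int open_halfspace_Re_gt open_halfspace_Im_lt open_halfspace_Im_gt)
  have "V \<subseteq> U"
  proof
    fix z assume z: "z \<in> V"
    show "z \<in> U"
    proof (cases "Re z \<ge> 0")
      case False
      have "dist (Complex 0 (Im z)) z = \<bar>Re z\<bar>" by (simp add: dist_norm cmod_def)
      then have "z \<in> ball (Complex 0 (Im z)) \<delta>" using z False by (auto simp: V_def)
      moreover have "Complex 0 (Im z) \<in> Complex 0 ` {-(2*R)..2*R}" using z by (auto simp: V_def)
      ultimately show ?thesis using \<delta>(2) by blast
    qed (use U in auto)
  qed
  have FV: "F holomorphic_on V" using F \<open>V \<subseteq> U\<close> by (rule holomorphic_on_subset)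
  define K where "K = cbox (Complex (-\<delta>/2) (-R)) (Complex 0 R)"
  have K: "z \<in> K \<longleftrightarrow> -\<delta>/2 \<le> Re z \<and> Re z \<le> 0 \<and> -R \<le> Im z \<and> Im z \<le> R" for z
    by (auto simp: K_def in_cbox_complex_iff)
  have "K \<subseteq> V" using \<delta>(1) R by (auto simp: K V_def)
  have "continuous_on K (\<lambda>z. F z * (1 + z\<^sup>2 / of_real (R\<^sup>2)))"
    using FV \<open>K \<subseteq> V\<close> R
    by (intro continuous_intros holomorphic_on_imp_continuous_on[OF holomorphic_on_subset[OF FV]]) auto
  then have "bounded ((\<lambda>z. F z * (1 + z\<^sup>2 / of_real (R\<^sup>2))) ` K)"
    unfolding K_def by (intro compact_imp_bounded compact_continuous_image compact_cbox)
  then obtain B where B: "B > 0" "\<And>z. z \<in> K \<Longrightarrow> norm (F z * (1 + z\<^sup>2 / of_real (R\<^sup>2))) \<le> B"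
    unfolding bounded_pos by blast
  \<comment> \<open>The two short sides have length \<open>\<eta>\<close> and contribute at most
    \<open>2 * B * \<eta>\<close>; on the long side \<open>N powr z\<close> has modulus
    \<open>N powr (-\<eta>)\<close>.\<close>
  define \<eta> where "\<eta> = min (\<delta>/2) (\<epsilon> / (2 * B))"
  have \<eta>: "\<eta> > 0" "\<eta> \<le> \<delta>/2" "2 * B * \<eta> \<le> \<epsilon>"
    using \<delta>(1) B(1) eps by (auto simp: \<eta>_def min_def field_simps)
  have "(\<lambda>N. (2 * R * B / \<eta>) * real N powr (-\<eta>)) \<longlonglongrightarrow> 0" by (rule tendsto_const_over_powr[OF \<eta>(1)])
  then have ev1: "\<forall>\<^sub>F N in sequentially. (2 * R * B / \<eta>) * real N powr (-\<eta>) < \<epsilon>"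
    using eps by (rule order_tendstoD)
  have ev2: "\<forall>\<^sub>F N in sequentially. real N \<ge> R" by real_asymp
  show ?thesis using ev1 ev2
  proof eventually_elim
    case (elim N)
    then have N: "N > 0" using R by (cases N) auto
    define S where "S = (\<lambda>z. \<Sum>n\<in>{0<..N}. e n * of_nat n powr (-1 - z))"
    \<comment> \<open>Newman's kernel: entire with value 1 at 0, so Cauchy's formula still returns
      \<open>F 0\<close> and \<open>S 0\<close>.\<close>
    define k where "k = (\<lambda>z. of_nat N powr z * (1 + z\<^sup>2 / of_real (R\<^sup>2)) :: complex)"
    have k: "k holomorphic_on A" for A
      unfolding k_def using R by (intro holomorphic_intros nat_powr_holomorphic) auto
    have k0: "k 0 = 1" using N by (simp add: k_def)
    let ?p = "part_circlepath 0 R (-(pi/2)) (pi/2)" and ?q = "part_circlepath 0 R (pi/2) (3*pi/2)"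
    let ?a = "\<i> * of_real R" and ?b = "Complex (-\<eta>) R" and ?c = "Complex (-\<eta>) (-R)"
    define l where "l = linepath ?a ?b +++ (linepath ?b ?c +++ linepath ?c (-?a))"
    have s1: "z \<in> closed_segment ?a ?b \<Longrightarrow> Im z = R \<and> -\<eta> \<le> Re z \<and> Re z \<le> 0" for z
      using \<eta> by (subst (asm) closed_segment_same_Im) (auto simp: closed_segment_eq_real_ivl split: if_splits)
    have s2: "z \<in> closed_segment ?b ?c \<Longrightarrow> Re z = -\<eta> \<and> -R \<le> Im z \<and> Im z \<le> R" for z
      using R by (subst (asm) closed_segment_same_Re) (auto simp: closed_segment_eq_real_ivl split: if_splits)
    have s3: "z \<in> closed_segment ?c (-?a) \<Longrightarrow> Im z = -R \<and> -\<eta> \<le> Re z \<and> Re z \<le> 0" for z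
      using \<eta> by (subst (asm) closed_segment_same_Im) (auto simp: closed_segment_eq_real_ivl split: if_splits)
    have l: "valid_path l" "pathstart l = ?a" "pathfinish l = -?a"
      by (auto simp: l_def intro!: valid_path_join)
    have pl: "path_image l = closed_segment ?a ?b \<union> (closed_segment ?b ?c \<union> closed_segment ?c (-?a))"
      by (simp add: l_def path_image_join)
    have lK: "z \<in> K \<and> -z \<notin> \<real>\<^sub>\<le>\<^sub>0" if "z \<in> path_image l" for z
      using that s1[of z] s2[of z] s3[of z] \<eta> R by (auto simp: pl K complex_nonpos_Reals_iff)
    have pV: "path_image ?p \<subseteq> V"
    proof
      fix z assume "z \<in> path_image ?p"
      with path_image_right_semicircle[of R z] R have "norm z = R" "Re z \<ge> 0" by auto
      then show "z \<in> V" using abs_Im_le_cmod[of z] R \<delta>(1) by (auto simp: V_def)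
    qed
    have "0 \<in> V" using R \<delta>(1) by (auto simp: V_def)
    have R0: "R > 0" using R by simp
    have "(\<lambda>z. F z * k z) holomorphic_on V" by (intro holomorphic_intros FV k)
    note c1 = cauchy_formula_semicircle[OF V \<open>0 \<in> V\<close> this R0 pV l(1) _ l(2,3)]
    have c1: "contour_integral ?p (\<lambda>z. F z * k z / z) + contour_integral l (\<lambda>z. F z * k z / z) = 2 * pi * \<i> * F 0"
      "(\<lambda>z. F z * k z / z) contour_integrable_on ?p" "(\<lambda>z. F z * k z / z) contour_integrable_on l"
      using c1 lK \<open>K \<subseteq> V\<close> k0 by auto
    have "(\<lambda>z. S z * k z) holomorphic_on UNIV"
      unfolding S_def by (intro holomorphic_intros newman_partial_sum_holomorphic k)
    note c2 = cauchy_formula_semicircle[OF convex_UNIV open_UNIV UNIV_I this R0 subset_UNIV _ subset_UNIV, of ?q]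
    have "pathstart ?q = \<i> * of_real R" "pathfinish ?q = - (\<i> * of_real R)"
    proof -
      have "cis (3 * pi / 2) = - \<i>"
        using sin_3over2_pi cos_3over2_pi by (simp add: complex_eq_iff)
      then show "pathstart ?q = \<i> * of_real R" "pathfinish ?q = - (\<i> * of_real R)"
        using cis_conv_exp[of "pi/2"] cis_conv_exp[of "3*pi/2"] by simp_all
    qed
    then have c2: "contour_integral ?p (\<lambda>z. S z * k z / z) + contour_integral ?q (\<lambda>z. S z * k z / z) = 2 * pi * \<i> * S 0"
      "(\<lambda>z. S z * k z / z) contour_integrable_on ?p" "(\<lambda>z. S z * k z / z) contour_integrable_on ?q"
      using c2 path_image_left_semicircle[OF R0] k0 by auto
    have b1: "norm (contour_integral ?p (\<lambda>z. F z * k z / z - S z * k z / z)) \<le> 2 * C / R\<^sup>2 * R * (pi/2 - (-(pi/2)))"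
    proof (rule contour_integral_bound_part_circlepath_strong[where k = "{?a, -?a}"])
      show "(\<lambda>z. F z * k z / z - S z * k z / z) contour_integrable_on ?p"
        by (intro contour_integrable_diff c1 c2)
      show "norm (F z * k z / z - S z * k z / z) \<le> 2 * C / R\<^sup>2" if "z \<in> path_image ?p - {?a, -?a}" for z
      proof -
        have z: "norm z = R" "Re z \<ge> 0" using that path_image_right_semicircle[OF R0, of z] by auto
        have "Re z \<noteq> 0"
        proof
          assume "Re z = 0"
          with z have "\<bar>Im z\<bar> = R" by (simp add: cmod_def)
          with \<open>Re z = 0\<close> that show False by (auto simp: complex_eq_iff abs_if split: if_splits)
        qed
        with z have "Re z > 0" by simp
        show ?thesis
          unfolding S_def k_def
          by (rule newman_arc_bounds(1)[OF C z(1) R0 N]) (use elim \<open>Re z > 0\<close> assms(5) in auto)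
      qed
    qed (use R C0 in auto)
    have b2: "norm (contour_integral ?q (\<lambda>z. S z * k z / z)) \<le> 4 * C / R\<^sup>2 * R * (3*pi/2 - pi/2)"
    proof (rule contour_integral_bound_part_circlepath_strong[where k = "{?a, -?a}"])
      show "norm (S z * k z / z) \<le> 4 * C / R\<^sup>2" if "z \<in> path_image ?q - {?a, -?a}" for z
      proof -
        have z: "norm z = R" "Re z \<le> 0" using that path_image_left_semicircle[OF R0, of z] by auto
        have "Re z \<noteq> 0"
        proof
          assume "Re z = 0"
          with z have "\<bar>Im z\<bar> = R" by (simp add: cmod_def)
          with \<open>Re z = 0\<close> that show False by (auto simp: complex_eq_iff abs_if split: if_splits)
        qed
        with z have "Re z < 0" by simp
        show ?thesis
          unfolding S_def k_def
          by (rule newman_arc_bounds(2)[OF C z(1) R0 N]) (use elim \<open>Re z < 0\<close> in auto)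
      qed
    qed (use R C0 c2 in auto)
    have kb: "norm (F z * k z / z) \<le> B * norm (of_nat N powr z :: complex) / norm z" if "z \<in> K" for z
    proof -
      have "norm (F z * k z / z) = norm (F z * (1 + z\<^sup>2 / of_real (R\<^sup>2))) * norm (of_nat N powr z :: complex) / norm z"
        by (simp add: k_def norm_mult norm_divide mult_ac)
      also have "\<dots> \<le> B * norm (of_nat N powr z :: complex) / norm z"
        using B(2)[OF that] by (intro divide_right_mono mult_right_mono) auto
      finally show ?thesis .
    qed
    have hb: "norm (F z * k z / z) \<le> B" if "z \<in> K" "\<bar>Im z\<bar> = R" for z
    proof -
      have "norm z \<ge> 1" using abs_Im_le_cmod[of z] that R by simp
      have "norm (F z * k z / z) \<le> B * norm (of_nat N powr z :: complex) / norm z" by (rule kb) fact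
      also have "\<dots> \<le> B * 1 / 1"
        using that B(1) \<open>norm z \<ge> 1\<close> K norm_nat_powr_le_1[OF N] by (intro frac_le mult_left_mono) auto
      finally show ?thesis by simp
    qed
    have "(\<lambda>z. F z * k z / z) contour_integrable_on linepath ?a ?b" "(\<lambda>z. F z * k z / z) contour_integrable_on linepath ?b ?c"
       "(\<lambda>z. F z * k z / z) contour_integrable_on linepath ?c (-?a)"
      using c1(3) by (auto simp: l_def)
    note li = this
    have l_eq: "contour_integral l (\<lambda>z. F z * k z / z) = contour_integral (linepath ?a ?b) (\<lambda>z. F z * k z / z)
       + (contour_integral (linepath ?b ?c) (\<lambda>z. F z * k z / z) + contour_integral (linepath ?c (-?a)) (\<lambda>z. F z * k z / z))"
      using li by (simp add: l_def)
    have i1: "norm (contour_integral (linepath ?a ?b) (\<lambda>z. F z * k z / z)) \<le> B * norm (?b - ?a)"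
    proof (rule contour_integral_bound_linepath[OF li(1)])
      fix z assume "z \<in> closed_segment ?a ?b"
      from s1[OF this] \<eta> R show "norm (F z * k z / z) \<le> B" by (intro hb) (auto simp: K)
    qed (use B in auto)
    have i3: "norm (contour_integral (linepath ?c (-?a)) (\<lambda>z. F z * k z / z)) \<le> B * norm (-?a - ?c)"
    proof (rule contour_integral_bound_linepath[OF li(3)])
      fix z assume "z \<in> closed_segment ?c (-?a)"
      from s3[OF this] \<eta> R show "norm (F z * k z / z) \<le> B" by (intro hb) (auto simp: K)
    qed (use B in auto)
    have i2: "norm (contour_integral (linepath ?b ?c) (\<lambda>z. F z * k z / z)) \<le> (B * real N powr (-\<eta>) / \<eta>) * norm (?c - ?b)"
    proof (rule contour_integral_bound_linepath[OF li(2)])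
      fix z assume z: "z \<in> closed_segment ?b ?c"
      have zK: "z \<in> K" using s2[OF z] \<eta> R by (auto simp: K)
      have "norm z \<ge> \<eta>" using abs_Re_le_cmod[of z] s2[OF z] \<eta> by simp
      have "norm (F z * k z / z) \<le> B * norm (of_nat N powr z :: complex) / norm z" by (rule kb[OF zK])
      also have "\<dots> \<le> B * real N powr (-\<eta>) / \<eta>"
        using \<open>norm z \<ge> \<eta>\<close> \<eta> B(1) s2[OF z] N by (intro frac_le) (auto simp: norm_of_nat_powr)
      finally show "norm (F z * k z / z) \<le> B * real N powr (-\<eta>) / \<eta>" .
    qed (use B \<eta> in auto)
    have n1: "norm (?b - ?a) = \<eta>" "norm (-?a - ?c) = \<eta>" "norm (?c - ?b) = 2 * R"
      using \<eta> R by (simp_all add: cmod_def real_sqrt_mult)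
    have "norm (contour_integral l (\<lambda>z. F z * k z / z)) \<le> B * \<eta> + ((B * real N powr (-\<eta>) / \<eta>) * (2 * R) + B * \<eta>)"
      unfolding l_eq using i1 i2 i3 unfolding n1 by (intro norm_triangle_le add_mono) auto
    also have "\<dots> \<le> 2 * \<epsilon>" using elim(1) \<eta>(3) by (simp add: mult_ac)
    finally have b3: "norm (contour_integral l (\<lambda>z. F z * k z / z)) \<le> 2 * \<epsilon>" .
    \<comment> \<open>The two Cauchy formulas are subtracted: \<open>F\<close> and \<open>S\<close>
      are compared on the right arc and estimated separately on the left.\<close>
    have "2 * pi * \<i> * (F 0 - S 0) = contour_integral ?p (\<lambda>z. F z * k z / z - S z * k z / z)
        + contour_integral l (\<lambda>z. F z * k z / z) - contour_integral ?q (\<lambda>z. S z * k z / z)"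
      unfolding right_diff_distrib c1(1)[symmetric] c2(1)[symmetric] contour_integral_diff[OF c1(2) c2(2)] by simp
    then have "norm (2 * pi * \<i> * (F 0 - S 0)) \<le> 2 * C / R\<^sup>2 * R * (pi/2 - (-(pi/2))) + 2 * \<epsilon> + 4 * C / R\<^sup>2 * R * (3*pi/2 - pi/2)"
      using norm_triangle_le[OF add_mono[OF b1 b3]] b2 norm_triangle_le_diff by (smt (verit) norm_triangle_ineq4)
    also have "\<dots> = 2 * pi * (3 * C / R) + 2 * \<epsilon>"
      using R by (simp add: field_simps power2_eq_square)
    also have "\<dots> \<le> 2 * pi * (3 * C / R + \<epsilon>)"
    proof -
      have "\<epsilon> \<le> pi * \<epsilon>" using eps pi_gt3 by simp
      then show ?thesis by (simp add: distrib_left)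
    qed
    finally have "2 * pi * norm (F 0 - S 0) \<le> 2 * pi * (3 * C / R + \<epsilon>)" by (simp add: norm_mult)
    then have "norm (F 0 - S 0) \<le> 3 * C / R + \<epsilon>" by (subst (asm) mult_le_cancel_left_pos) auto
    then show ?case by (simp add: S_def)
  qed
qed

theorem newman_tauberian:
  fixes e :: "nat \<Rightarrow> complex"
  assumes C: "\<And>n. norm (e n) \<le> C" and U: "open U" "{z. Re z \<ge> 0} \<subseteq> U" and F: "F holomorphic_on U"
    and S: "\<And>z. Re z > 0 \<Longrightarrow> (\<lambda>n. e n * of_nat n powr (-1 - z)) sums F z"
  shows "(\<lambda>n. e n / of_nat n) sums F 0"
proof -
  have C0: "C \<ge> 0" using order_trans[OF norm_ge_zero C[of 0]] .
  have "(\<lambda>N. \<Sum>n\<in>{0<..N}. e n * of_nat n powr (-1)) \<longlonglongrightarrow> F 0"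
  proof (rule tendstoI)
    fix r :: real assume r: "r > 0"
    \<comment> \<open>Makes \<open>3 * C / R\<close> at most half of \<open>r\<close>; the value at
      least 1 is required by the estimate.\<close>
    define R where "R = max 1 (6 * C / r)"
    have R: "R \<ge> 1" "6 * C / r \<le> R" by (auto simp: R_def)
    then have "3 * C / R \<le> r / 2" using r by (simp add: field_simps)
    have "r / 4 > 0" using r by simp
    have "\<forall>\<^sub>F N in sequentially. norm (F 0 - (\<Sum>n\<in>{0<..N}. e n * of_nat n powr (-1))) \<le> 3 * C / R + r / 4"
      by (rule newman_estimate[OF C U F S R(1) \<open>r / 4 > 0\<close>])
    then show "\<forall>\<^sub>F N in sequentially. dist (\<Sum>n\<in>{0<..N}. e n * of_nat n powr (-1)) (F 0) < r"
    proof eventually_elim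
      case (elim N)
      then show ?case using \<open>3 * C / R \<le> r / 2\<close> r by (simp add: dist_norm norm_minus_commute)
    qed
  qed
  moreover have "(\<Sum>n\<in>{0<..N}. e n * of_nat n powr (-1)) = (\<Sum>n\<le>N. e n / of_nat n)" for N
    by (rule sum.mono_neutral_cong_left) (auto simp: powr_minus divide_inverse not_less_eq_eq)
  ultimately show ?thesis by (simp add: sums_def_le)
qed

section \<open>The prime number theorem\<close>

definition psi :: "nat \<Rightarrow> real" where
  "psi n = (\<Sum>m\<le>n. mangoldt m)"

lemma psi_0 [simp]: "psi 0 = 0" and psi_Suc: "psi (Suc n) = psi n + mangoldt (Suc n)"
  by (simp_all add: psi_def)

lemma psi_mono: "m \<le> n \<Longrightarrow> psi m \<le> psi n"
  unfolding psi_def by (rule sum_mono2) (auto simp: mangoldt_nonneg)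

lemma psi_nonneg: "psi n \<ge> 0"
  unfolding psi_def by (simp add: sum_nonneg mangoldt_nonneg)

section \<open>Chebyshev's estimate\<close>

lemma card_multiples_le:
  assumes "d > 0"
  shows "card {m\<in>{1..n}. d dvd m} = n div (d::nat)"
proof -
  have "{m\<in>{1..n}. d dvd m} = (\<lambda>k. d * k) ` {1..n div d}"
    using assms by (auto elim!: dvdE simp: less_eq_div_iff_mult_less_eq mult.commute intro!: image_eqI)
  also have "card \<dots> = n div d"
    using assms by (subst card_image) (auto simp: inj_on_def)
  finally show ?thesis .
qed

text \<open>\<open>mangoldt_sum\<close> is summed over \<open>m \<le> n\<close> and grouped by
  divisors. The upper limit \<open>N\<close> is free so that the formulas for \<open>n\<close> and
  \<open>2 * n\<close> can be subtracted over one range.\<close>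

lemma ln_fact_eq_sum_mangoldt:
  assumes "n \<le> N"
  shows "ln (fact n :: real) = (\<Sum>d\<in>{1..N}. mangoldt d * real (n div d))"
proof -
  have "ln (fact n :: real) = (\<Sum>m\<in>{1..n}. ln (real m))"
    by (subst ln_prod[symmetric]) (auto simp: fact_prod)
  also have "\<dots> = (\<Sum>m\<in>{1..n}. \<Sum>d | d \<in> {1..N} \<and> d dvd m. mangoldt d)"
  proof (rule sum.cong)
    fix m assume m: "m \<in> {1..n}"
    then have "{d. d dvd m} = {d \<in> {1..N}. d dvd m}"
      using assms by (auto dest: dvd_imp_le intro!: Nat.gr0I simp: Suc_le_eq)
    then show "ln (real m) = (\<Sum>d | d \<in> {1..N} \<and> d dvd m. mangoldt d)"
      using mangoldt_sum[of m, where ?'a = real] m by simp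
  qed simp
  also have "\<dots> = (\<Sum>d\<in>{1..N}. \<Sum>m | m \<in> {1..n} \<and> d dvd m. mangoldt d)"
    by (rule sum.swap_restrict) auto
  also have "\<dots> = (\<Sum>d\<in>{1..N}. mangoldt d * real (n div d))"
    by (intro sum.cong refl) (use card_multiples_le[of _ n] in \<open>simp add: mult.commute\<close>)
  finally show ?thesis .
qed

text \<open>Each \<open>d\<close> above \<open>n\<close> and up to \<open>2 * n\<close> has weight
  \<open>2 * n div d - 2 * (n div d)\<close> at least 1, and no weight is negative; so the
  difference is at most the logarithm of the central binomial coefficient.\<close>

lemma psi_double_le: "psi (2 * n) - psi n \<le> real n * ln 4"
proof -
  have "psi (2 * n) - psi n = (\<Sum>d\<in>{..2 * n} - {..n}. mangoldt d)"
    unfolding psi_def by (subst sum_diff) auto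
  also have "{..2 * n} - {..n} = {n<..2 * n}" by auto
  also have "(\<Sum>d\<in>{n<..2 * n}. mangoldt d) \<le> (\<Sum>d\<in>{1..2 * n}. mangoldt d * (real (2 * n div d) - 2 * real (n div d)))"
  proof (rule sum_le_included[where i = id])
    show "\<forall>y\<in>{1..2 * n}. 0 \<le> mangoldt y * (real (2 * n div y) - 2 * real (n div y))"
    proof
      fix y :: nat
      have "2 * (n div y) \<le> 2 * n div y"
        using div_times_less_eq_dividend[of n y]
        by (cases "y = 0") (simp_all add: less_eq_div_iff_mult_less_eq)
      then have "2 * real (n div y) \<le> real (2 * n div y)" by linarith
      then show "0 \<le> mangoldt y * (real (2 * n div y) - 2 * real (n div y))"
        by (simp add: mangoldt_nonneg)
    qed
    show "\<forall>x\<in>{n<..2 * n}. \<exists>y\<in>{1..2 * n}. id y = x \<and> mangoldt x \<le> mangoldt y * (real (2 * n div y) - 2 * real (n div y))"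
    proof
      fix x assume x: "x \<in> {n<..2 * n}"
      then have "n div x = 0" "2 * n div x \<ge> 1" by (auto simp: div_greater_zero_iff Suc_le_eq)
      then have "mangoldt x * 1 \<le> mangoldt x * (real (2 * n div x) - 2 * real (n div x))"
        by (intro mult_left_mono) (auto simp: mangoldt_nonneg)
      then show "\<exists>y\<in>{1..2 * n}. id y = x \<and> mangoldt x \<le> mangoldt y * (real (2 * n div y) - 2 * real (n div y))"
        using x by (intro bexI[of _ x]) auto
    qed
  qed auto
  also have "\<dots> = ln (fact (2 * n)) - 2 * ln (fact n)"
    using ln_fact_eq_sum_mangoldt[of "2 * n" "2 * n"] ln_fact_eq_sum_mangoldt[of n "2 * n"]
    by (simp add: sum_subtractf sum_distrib_left algebra_simps)
  also have "\<dots> = ln (real (2 * n choose n))"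
  proof -
    have "real (2 * n choose n) = fact (2 * n) / (fact n * fact n)"
      using binomial_fact[of n "2 * n", where ?'a = real] by (simp add: mult_2)
    then have "ln (real (2 * n choose n)) = ln (fact (2 * n)) - (ln (fact n) + ln (fact n))"
      by (simp add: ln_div ln_mult)
    then show ?thesis by simp
  qed
  also have "\<dots> \<le> ln (2 ^ (2 * n))"
  proof -
    have "(2 * n choose n) \<le> (\<Sum>k\<le>2 * n. 2 * n choose k)" by (rule member_le_sum) auto
    then have "real (2 * n choose n) \<le> 2 ^ (2 * n)"
      unfolding choose_row_sum by (metis of_nat_le_iff of_nat_numeral of_nat_power)
    then show ?thesis by (subst ln_le_cancel_iff) auto
  qed
  also have "\<dots> = real n * ln 4" by (simp add: power_mult ln_realpow)
  finally show ?thesis .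
qed

text \<open>Doubling gives \<open>psi (2 ^ j) \<le> 2 ^ j * ln 4\<close>; the next power of two is
  at most \<open>2 * n\<close>, and \<open>ln 4 \<le> 2\<close>.\<close>

lemma psi_le: "psi n \<le> 4 * real n"
proof (cases "n = 0")
  case False
  have pow: "psi (2 ^ j) \<le> 2 ^ j * ln 4" for j
  proof (induction j)
    case 0
    then show ?case by (simp add: psi_Suc)
  next
    case (Suc j)
    then show ?case using psi_double_le[of "2 ^ j"] by simp
  qed
  define j where "j = (LEAST j. n < 2 ^ j)"
  have j: "n < 2 ^ j" "\<And>i. i < j \<Longrightarrow> \<not> n < 2 ^ i"
    unfolding j_def by (rule LeastI[of _ n], rule less_exp) (rule not_less_Least)
  then obtain i where i: "j = Suc i" using False by (cases j) auto
  then have "2 ^ i \<le> n" using j(2)[of i] by simp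
  then have "2 ^ j \<le> 2 * n" using i by simp
  have "psi n \<le> psi (2 ^ j)" using j by (intro psi_mono) simp
  also have "\<dots> \<le> 2 ^ j * ln 4" by (rule pow)
  also have "\<dots> \<le> (2 * real n) * 2"
  proof (rule mult_mono)
    show "2 ^ j \<le> 2 * real n" using \<open>2 ^ j \<le> 2 * n\<close> by (metis of_nat_le_iff of_nat_mult of_nat_numeral of_nat_power)
    have "ln 4 = 2 * ln (2::real)" using ln_realpow[of 2 2] by simp
    then show "ln 4 \<le> (2::real)" using ln_le_minus_one[of "2::real"] by simp
  qed auto
  finally show ?thesis by simp
qed simp

section \<open>The Dirichlet series of the error psi(n) - n\<close>

lemma dirichlet_abel_summation:
  fixes a u :: "nat \<Rightarrow> complex"
  shows "(\<Sum>n\<le>N. a n * u n) = (\<Sum>n\<le>N. a n) * u (Suc N) + (\<Sum>n\<le>N. (\<Sum>m\<le>n. a m) * (u n - u (Suc n)))"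
  by (induction N) (simp_all add: algebra_simps)

lemma sum_mangoldt_minus_one: "(\<Sum>m\<le>n. mangoldt m - of_bool (m > 0)) = psi n - real n"
  by (induction n) (simp_all add: psi_Suc)

lemma psi_error_bound: "\<bar>psi n - real n\<bar> \<le> 4 * real n"
  using psi_le[of n] psi_nonneg[of n] by linarith

definition psi_gap_series :: "complex \<Rightarrow> complex" where
  "psi_gap_series s = (\<Sum>n. of_real (psi n - real n) * powr_gap n s)"

lemma psi_gap_norm_bound: "norm (of_real (psi n - real n) :: complex) \<le> 4 * real n powr 1"
  using psi_error_bound[of n] by (simp only: norm_of_real powr_one' of_nat_0_le_iff abs_of_nonneg)

lemma psi_gap_series_holomorphic: "psi_gap_series holomorphic_on {s. Re s > 0}"
  using powr_gap_series_holomorphic[OF psi_gap_norm_bound] by (simp add: psi_gap_series_def[abs_def])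

text \<open>Abel summation expresses the difference of the two series through
  \<open>psi n - n\<close> and the differences of \<open>n powr (-s)\<close>. Each difference is
  \<open>s * n powr (-s - 1)\<close> plus \<open>powr_gap n s\<close>; the first part is the series
  sought, and the second converges even for \<open>Re s > 0\<close>.\<close>

lemma psi_error_dirichlet_series:
  assumes s: "Re s > 1"
  shows "(\<lambda>n. of_real ((psi n - real n) / real n) * of_nat n powr (-s)) sums
    ((mangoldt_series s - zeta_series s - psi_gap_series s) / s)"
proof -
  have "s \<noteq> 0" using s by auto
  define a where "a = (\<lambda>n::nat. of_real (mangoldt n - of_bool (n > 0)) :: complex)"
  define u where "u = (\<lambda>n::nat. of_nat n powr (-s) :: complex)"
  have A: "(\<Sum>m\<le>n. a m) = of_real (psi n - real n)" for n
    unfolding a_def of_real_sum[symmetric] sum_mangoldt_minus_one ..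
  have "(\<lambda>n. mangoldt n * u n) sums mangoldt_series s"
    unfolding mangoldt_series_def u_def
    by (intro summable_sums summable_norm_cancel[OF dirichlet_summable_norm[OF mangoldt_bound s]])
  moreover have "u sums zeta_series s"
    unfolding zeta_series_def u_def
    by (intro summable_sums summable_norm_cancel[OF summable_norm_nat_powr[OF s]])
  ultimately have "(\<lambda>n. mangoldt n * u n - u n) sums (mangoldt_series s - zeta_series s)"
    by (rule sums_diff)
  also have "(\<lambda>n. mangoldt n * u n - u n) = (\<lambda>n. a n * u n)"
    by (auto simp: a_def u_def fun_eq_iff algebra_simps)
  finally have 1: "(\<lambda>N. \<Sum>n\<le>N. a n * u n) \<longlonglongrightarrow> mangoldt_series s - zeta_series s"
    by (simp add: sums_def_le)
  have 2: "(\<lambda>N. (\<Sum>n\<le>N. a n) * u (Suc N)) \<longlonglongrightarrow> 0"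
  proof (rule Lim_null_comparison)
    show "\<forall>\<^sub>F N in sequentially. norm ((\<Sum>n\<le>N. a n) * u (Suc N)) \<le> 4 * real N * real (Suc N) powr (- Re s)"
      using psi_error_bound unfolding A u_def
      by (intro always_eventually allI) (simp add: norm_mult norm_of_nat_powr mult_right_mono del: of_nat_Suc of_real_diff)
    show "(\<lambda>N. 4 * real N * real (Suc N) powr (- Re s)) \<longlonglongrightarrow> 0"
      using s by real_asymp
  qed
  have "(\<lambda>N. \<Sum>n\<le>N. (\<Sum>m\<le>n. a m) * (u n - u (Suc n))) \<longlonglongrightarrow> (mangoldt_series s - zeta_series s) - 0"
  proof (rule Lim_transform_eventually[OF tendsto_diff[OF 1 2]])
    show "\<forall>\<^sub>F N in sequentially. (\<Sum>n\<le>N. a n * u n) - (\<Sum>n\<le>N. a n) * u (Suc N) = (\<Sum>n\<le>N. (\<Sum>m\<le>n. a m) * (u n - u (Suc n)))"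
      using dirichlet_abel_summation[of a u] by (intro always_eventually allI) (simp only: add_diff_cancel_left')
  qed
  then have 3: "(\<lambda>n. of_real (psi n - real n) * (u n - u (Suc n))) sums (mangoldt_series s - zeta_series s)"
    by (simp only: sums_def_le A diff_zero)
  have 4: "(\<lambda>n. of_real (psi n - real n) * powr_gap n s) sums psi_gap_series s"
    unfolding psi_gap_series_def
    using s by (intro summable_sums powr_gap_series_summable[OF psi_gap_norm_bound]) auto
  have "(\<lambda>n. of_real (psi n - real n) * (u n - u (Suc n)) - of_real (psi n - real n) * powr_gap n s) sums
      (mangoldt_series s - zeta_series s - psi_gap_series s)"
    by (rule sums_diff[OF 3 4])
  then have "(\<lambda>n. (of_real (psi n - real n) * (u n - u (Suc n)) - of_real (psi n - real n) * powr_gap n s) / s) sums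
      ((mangoldt_series s - zeta_series s - psi_gap_series s) / s)"
    by (rule sums_divide)
  moreover have "(of_real (psi n - real n) * (u n - u (Suc n)) - of_real (psi n - real n) * powr_gap n s) / s =
      of_real ((psi n - real n) / real n) * of_nat n powr (-s)" for n
  proof -
    have "(of_real (psi n - real n) * (u n - u (Suc n)) - of_real (psi n - real n) * powr_gap n s) / s =
       of_real (psi n - real n) * of_nat n powr (-s - 1)"
      using \<open>s \<noteq> 0\<close> unfolding right_diff_distrib[symmetric] powr_gap_def u_def by simp
    also have "\<dots> = of_real ((psi n - real n) / real n) * of_nat n powr (-s)"
      by (simp add: powr_diff)
    finally show ?thesis .
  qed
  ultimately show ?thesis by simp
qed

text \<open>In the variable \<open>s = 1 + z\<close> the simple poles of the two series at
  \<open>s = 1\<close> cancel. Nonvanishing of \<open>zeta_reg\<close> makes the remaining function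
  holomorphic near \<open>Re z \<ge> 0\<close>, and Newman's theorem is read at
  \<open>z = 0\<close>.\<close>

lemma summable_psi_error: "summable (\<lambda>n. (psi n - real n) / real n ^ 2)"
proof -
  \<comment> \<open>The difference quotient of \<open>zeta_reg\<close> at 1 with its singularity
    removed, so that \<open>zeta_series s = 1 / (s - 1) + Q s\<close> for
    \<open>Re s > 1\<close>.\<close>
  define Q where "Q = (\<lambda>s. if s = 1 then deriv zeta_reg 1 else (zeta_reg s - zeta_reg 1) / (s - 1))"
  define W where "W = {s. Re s > 0 \<and> zeta_reg s \<noteq> 0}"
  have op: "open {s. Re s > 0}" by (simp add: open_halfspace_Re_gt)
  have Q: "Q holomorphic_on {s. Re s > 0}"
    unfolding Q_def by (rule pole_lemma_open[OF zeta_reg_holomorphic op])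
  have "open ({s. Re s > 0} \<inter> zeta_reg -` (- {0}))"
    using holomorphic_on_imp_continuous_on[OF zeta_reg_holomorphic] op by (intro continuous_open_preimage) auto
  also have "{s. Re s > 0} \<inter> zeta_reg -` (- {0}) = W" by (auto simp: W_def)
  finally have W: "open W" "W \<subseteq> {s. Re s > 0}" by (auto simp: W_def)
  define H where "H = (\<lambda>s. (- Q s - deriv zeta_reg s / zeta_reg s - psi_gap_series s) / s)"
  have H: "H holomorphic_on W"
    unfolding H_def
  proof (intro holomorphic_on_divide holomorphic_on_diff holomorphic_on_minus holomorphic_on_ident)
    show "Q holomorphic_on W" "psi_gap_series holomorphic_on W" "zeta_reg holomorphic_on W"
      by (rule holomorphic_on_subset[OF _ W(2)], rule Q psi_gap_series_holomorphic zeta_reg_holomorphic)+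
    then show "deriv zeta_reg holomorphic_on W" using W(1) by (intro holomorphic_deriv)
  qed (auto simp: W_def)
  define U where "U = (\<lambda>z. 1 + z) -` W"
  have "open U" unfolding U_def using W(1) by (rule open_vimage) (intro continuous_intros)
  have "{z. Re z \<ge> 0} \<subseteq> U" using zeta_reg_nonzero by (auto simp: U_def W_def)
  have "(H \<circ> (\<lambda>z. 1 + z)) holomorphic_on U"
    by (rule holomorphic_on_compose_gen[OF _ H]) (auto simp: U_def intro: holomorphic_on_add)
  define e where "e = (\<lambda>n. of_real ((psi n - real n) / real n) :: complex)"
  have "(\<lambda>n. e n / of_nat n) sums (H \<circ> (\<lambda>z. 1 + z)) 0"
  proof (rule newman_tauberian[OF _ \<open>open U\<close> \<open>_ \<subseteq> U\<close> \<open>_ holomorphic_on U\<close>])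
    show "norm (e n) \<le> 4" for n
      using psi_error_bound[of n] unfolding e_def norm_of_real by (cases "n = 0") (simp_all add: abs_divide divide_le_eq)
    fix z :: complex assume "Re z > 0"
    then have s: "Re (1 + z) > 1" by simp
    have z: "z \<noteq> 0" "1 + z \<noteq> 1" "1 + z - 1 = z" using \<open>Re z > 0\<close> by auto
    have zs: "zeta_series (1 + z) = zeta_reg (1 + z) / z"
      using zeta_reg_eq[OF s] z(1) unfolding z(3) by (simp add: field_simps)
    have "mangoldt_series (1 + z) = 1 / z - deriv zeta_reg (1 + z) / zeta_reg (1 + z)"
      using mangoldt_series_eq[OF s] unfolding z(3) .
    moreover have "Q (1 + z) = (zeta_reg (1 + z) - 1) / z"
      unfolding Q_def z(3) using z(2) by (simp only: if_False zeta_reg_1)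
    ultimately have "mangoldt_series (1 + z) - zeta_series (1 + z) = - Q (1 + z) - deriv zeta_reg (1 + z) / zeta_reg (1 + z)"
      unfolding zs by (simp only: diff_divide_distrib) simp
    then have eq: "(mangoldt_series (1 + z) - zeta_series (1 + z) - psi_gap_series (1 + z)) / (1 + z) = (H \<circ> (\<lambda>z. 1 + z)) z"
      unfolding H_def o_def by (simp only:)
    have "- (1 + z) = -1 - z" by simp
    with psi_error_dirichlet_series[OF s] show "(\<lambda>n. e n * of_nat n powr (-1 - z)) sums (H \<circ> (\<lambda>z. 1 + z)) z"
      unfolding eq e_def by (simp only:)
  qed
  from sums_Re[OF this] have "summable (\<lambda>n. Re (e n / of_nat n))" by (rule sums_summable)
  also have "(\<lambda>n. Re (e n / of_nat n)) = (\<lambda>n. (psi n - real n) / real n ^ 2)"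
  proof
    fix n
    have "e n / of_nat n = of_real ((psi n - real n) / real n / real n)" by (simp add: e_def)
    then show "Re (e n / of_nat n) = (psi n - real n) / real n ^ 2"
      by (simp only: Re_complex_of_real) (simp add: power2_eq_square)
  qed
  finally show ?thesis .
qed

text \<open>If \<open>psi N\<close> exceeds \<open>(1 + 2 * \<delta>) * N\<close>, monotonicity
  keeps \<open>psi n - n\<close> at least \<open>\<delta> * N\<close> for \<open>n\<close> from
  \<open>N\<close> up to about \<open>(1 + \<delta>) * N\<close>. This block of the series has sum
  at least \<open>\<delta>\<^sup>2 / (1 + \<delta>)\<^sup>2\<close>, against Cauchy's
  criterion.\<close>

lemma psi_upper:
  assumes "\<delta> > 0"
  shows "\<forall>\<^sub>F N in sequentially. psi N \<le> (1 + 2 * \<delta>) * real N"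
proof -
  define f where "f = (\<lambda>n. (psi n - real n) / real n ^ 2)"
  have "summable f" unfolding f_def by (rule summable_psi_error)
  moreover have "\<delta>\<^sup>2 / (1 + \<delta>)\<^sup>2 > 0" using assms by simp
  ultimately obtain M where M: "\<And>m n. m \<ge> M \<Longrightarrow> norm (sum f {m..<n}) < \<delta>\<^sup>2 / (1 + \<delta>)\<^sup>2"
    unfolding summable_Cauchy by blast
  show ?thesis using eventually_ge_at_top[of "max M 1"]
  proof eventually_elim
    case (elim N)
    then have N: "N \<ge> M" "N \<ge> 1" by auto
    show ?case
    proof (rule ccontr)
      assume "\<not> psi N \<le> (1 + 2 * \<delta>) * real N"
      then have psiN: "psi N > (1 + 2 * \<delta>) * real N" by simp
      define K where "K = nat \<lfloor>\<delta> * real N\<rfloor> + 1"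
      have K: "real K \<ge> \<delta> * real N" "real K - 1 \<le> \<delta> * real N"
        using assms by (auto simp: K_def) linarith+
      have "real K * (\<delta> / ((1 + \<delta>)\<^sup>2 * real N)) = (\<Sum>n\<in>{N..<N+K}. \<delta> / ((1 + \<delta>)\<^sup>2 * real N))"
        by simp
      also have "\<dots> \<le> sum f {N..<N+K}"
      proof (rule sum_mono)
        fix n assume n: "n \<in> {N..<N+K}"
        then have "real n \<le> real N + (real K - 1)" by auto
        then have n2: "real n \<le> (1 + \<delta>) * real N" using K by (simp add: algebra_simps)
        have "\<delta> / ((1 + \<delta>)\<^sup>2 * real N) = (\<delta> * real N) / ((1 + \<delta>) * real N)\<^sup>2"
          using N assms by (simp add: power2_eq_square)
        also have "\<dots> \<le> (psi n - real n) / real n ^ 2"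
        proof (rule frac_le)
          have "psi n \<ge> psi N" using n by (intro psi_mono) auto
          then show "\<delta> * real N \<le> psi n - real n" using psiN n2 by (simp add: algebra_simps)
          show "(real n)\<^sup>2 \<le> ((1 + \<delta>) * real N)\<^sup>2" using n2 by (intro power_mono) auto
          have "\<delta> * real N \<ge> 0" using assms by simp
          then show "0 \<le> psi n - real n"
            using \<open>\<delta> * real N \<le> psi n - real n\<close> by linarith
        qed (use n N in auto)
        finally show "\<delta> / ((1 + \<delta>)\<^sup>2 * real N) \<le> f n" by (simp add: f_def)
      qed
      also have "\<dots> < \<delta>\<^sup>2 / (1 + \<delta>)\<^sup>2" using M[OF N(1), of "N + K"] by simp
      finally have "real K * (\<delta> / ((1 + \<delta>)\<^sup>2 * real N)) < \<delta>\<^sup>2 / (1 + \<delta>)\<^sup>2" .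
      moreover have "(\<delta> * real N) * (\<delta> / ((1 + \<delta>)\<^sup>2 * real N)) \<le> real K * (\<delta> / ((1 + \<delta>)\<^sup>2 * real N))"
        using K assms by (intro mult_right_mono) auto
      moreover have "(\<delta> * real N) * (\<delta> / ((1 + \<delta>)\<^sup>2 * real N)) = \<delta>\<^sup>2 / (1 + \<delta>)\<^sup>2"
        using N assms by (simp add: power2_eq_square)
      ultimately show False by linarith
    qed
  qed
qed

text \<open>The mirror image of the upper bound, with the block to the left of
  \<open>N\<close>.\<close>

lemma psi_lower:
  assumes "\<delta> > 0" "\<delta> < 1"
  shows "\<forall>\<^sub>F N in sequentially. psi N \<ge> (1 - 2 * \<delta>) * real N"
proof -
  define f where "f = (\<lambda>n. (psi n - real n) / real n ^ 2)"
  have "summable f" unfolding f_def by (rule summable_psi_error)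
  \<comment> \<open>The number of terms is rounded down; \<open>\<delta> * N \<ge> 2\<close> keeps
    at least half of \<open>\<delta> * N\<close>, hence the denominator 2.\<close>
  moreover have "\<delta>\<^sup>2 / 2 > 0" using assms by simp
  ultimately obtain M where M: "\<And>m n. m \<ge> M \<Longrightarrow> norm (sum f {m..<n}) < \<delta>\<^sup>2 / 2"
    unfolding summable_Cauchy by blast
  have "\<forall>\<^sub>F N in sequentially. real M + 1 \<le> (1 - \<delta>) * real N" "\<forall>\<^sub>F N in sequentially. 2 / \<delta> \<le> real N"
    using assms by real_asymp+
  then show ?thesis
  proof eventually_elim
    case (elim N)
    show ?case
    proof (rule ccontr)
      assume "\<not> (1 - 2 * \<delta>) * real N \<le> psi N"
      then have psiN: "psi N < (1 - 2 * \<delta>) * real N" by simp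
      have "2 / \<delta> > 0" using assms by simp
      then have N: "real N > 0" using elim by linarith
      have dN: "\<delta> * real N \<ge> 2" using elim assms by (simp add: field_simps)
      define K where "K = nat \<lfloor>\<delta> * real N\<rfloor>"
      have K1: "real K \<le> \<delta> * real N" "real K \<ge> \<delta> * real N - 1"
        using dN by (auto simp: K_def)
      have "\<delta> * real N \<le> 1 * real N" using assms N by (intro mult_right_mono) auto
      then have "real K \<le> real N" using K1 by linarith
      then have KN: "K \<le> N" by simp
      have "real (N - K) \<ge> (1 - \<delta>) * real N" using KN K1 by (simp add: of_nat_diff algebra_simps)
      then have "N - K \<ge> M" using elim by linarith
      have "sum f {N-K..<N} \<le> (\<Sum>n\<in>{N-K..<N}. - (\<delta> / real N))"
      proof (rule sum_mono)
        fix n assume n: "n \<in> {N-K..<N}"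
        then have "real n \<ge> real (N - K)" by simp
        then have n2: "real n \<ge> (1 - \<delta>) * real N" using \<open>real (N - K) \<ge> (1 - \<delta>) * real N\<close> by linarith
        moreover have "(1 - \<delta>) * real N > 0" using N assms by (intro mult_pos_pos) auto
        ultimately have "real n > 0" by linarith
        have "\<delta> / real N = (\<delta> * real N) / (real N)\<^sup>2" using N by (simp add: power2_eq_square)
        also have "\<dots> \<le> (real n - psi n) / real n ^ 2"
        proof (rule frac_le)
          have "psi n \<le> psi N" using n by (intro psi_mono) auto
          then show "\<delta> * real N \<le> real n - psi n" using psiN n2 by (simp add: algebra_simps)
          then show "0 \<le> real n - psi n" using dN by linarith
          show "(real n)\<^sup>2 \<le> (real N)\<^sup>2" using n by (intro power_mono) auto
        qed (use \<open>real n > 0\<close> in auto)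
        also have "\<dots> = - f n" by (simp add: f_def minus_divide_left)
        finally show "f n \<le> - (\<delta> / real N)" by linarith
      qed
      also have "\<dots> = - (real K * (\<delta> / real N))" using KN by simp
      finally have "sum f {N-K..<N} \<le> - (real K * (\<delta> / real N))" .
      moreover have "real K * (\<delta> / real N) \<ge> (\<delta> * real N / 2) * (\<delta> / real N)"
        using K1 dN assms N by (intro mult_right_mono) auto
      moreover have "(\<delta> * real N / 2) * (\<delta> / real N) = \<delta>\<^sup>2 / 2" using N by (simp add: power2_eq_square)
      ultimately show False using M[OF \<open>N - K \<ge> M\<close>, of N] by simp
    qed
  qed
qed

theorem psi_asymp: "(\<lambda>n. psi n / real n) \<longlonglongrightarrow> 1"
proof (rule tendstoI)
  fix r :: real assume "r > 0"
  define \<delta> where "\<delta> = min (r / 3) (1 / 2)"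
  have d: "\<delta> > 0" "\<delta> < 1" "2 * \<delta> < r" using \<open>r > 0\<close> by (auto simp: \<delta>_def min_def)
  show "\<forall>\<^sub>F n in sequentially. dist (psi n / real n) 1 < r"
    using psi_upper[OF d(1)] psi_lower[OF d(1,2)] eventually_gt_at_top[of 0]
  proof eventually_elim
    case (elim n)
    then have "psi n / real n \<le> 1 + 2 * \<delta>" "psi n / real n \<ge> 1 - 2 * \<delta>" by (simp_all add: field_simps)
    then show ?case using d(3) by (simp add: dist_real_def)
  qed
qed

lemma psi_asymp_real: "((\<lambda>x. psi (nat \<lfloor>x\<rfloor>) / x) \<longlongrightarrow> 1) at_top"
proof -
  have 1: "((\<lambda>x. psi (nat \<lfloor>x\<rfloor>) / real (nat \<lfloor>x\<rfloor>)) \<longlongrightarrow> 1) at_top"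
    by (rule filterlim_compose[OF psi_asymp])
      (rule filterlim_compose[OF filterlim_nat_sequentially filterlim_floor_sequentially])
  have 2: "((\<lambda>x. real (nat \<lfloor>x\<rfloor>) / x) \<longlongrightarrow> 1) at_top"
  proof (rule tendsto_sandwich)
    show "\<forall>\<^sub>F x in at_top. (x - 1) / x \<le> real (nat \<lfloor>x\<rfloor>) / x"
      using eventually_ge_at_top[of 1] by eventually_elim (auto intro!: divide_right_mono)
    show "\<forall>\<^sub>F x in at_top. real (nat \<lfloor>x\<rfloor>) / x \<le> 1"
      using eventually_ge_at_top[of 1] by eventually_elim auto
    show "((\<lambda>x::real. (x - 1) / x) \<longlongrightarrow> 1) at_top" by real_asymp
  qed auto
  have "((\<lambda>x. psi (nat \<lfloor>x\<rfloor>) / real (nat \<lfloor>x\<rfloor>) * (real (nat \<lfloor>x\<rfloor>) / x)) \<longlongrightarrow> 1 * 1) at_top"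
    by (rule tendsto_mult[OF 1 2])
  moreover have "\<forall>\<^sub>F x in at_top. psi (nat \<lfloor>x\<rfloor>) / real (nat \<lfloor>x\<rfloor>) * (real (nat \<lfloor>x\<rfloor>) / x) = psi (nat \<lfloor>x\<rfloor>) / x"
    using eventually_ge_at_top[of 1] by eventually_elim (auto simp: le_nat_iff)
  ultimately have "((\<lambda>x. psi (nat \<lfloor>x\<rfloor>) / x) \<longlongrightarrow> 1 * 1) at_top"
    by (rule Lim_transform_eventually)
  then show ?thesis by simp
qed

section \<open>Counting primes\<close>

definition primes_le :: "real \<Rightarrow> nat set" where
  "primes_le x = {p. prime p \<and> real p \<le> x}"

lemma finite_primes_le [simp]: "finite (primes_le x)"
proof (rule finite_subset)
  show "primes_le x \<subseteq> {..nat \<lfloor>x\<rfloor>}" by (auto simp: primes_le_def le_nat_floor)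
qed simp

text \<open>The prime \<open>p\<close> has at most \<open>ln n / ln p\<close> powers up to
  \<open>n\<close>, each contributing \<open>ln p\<close>, so its total is at most
  \<open>ln n\<close>.\<close>

lemma psi_le_card_primes:
  assumes "n \<ge> 1"
  shows "psi n \<le> real (card (primes_le (real n))) * ln (real n)"
proof -
  let ?Q = "{m\<in>{..n}. primepow m}" and ?P = "primes_le (real n)"
  have "psi n = (\<Sum>m\<in>?Q. ln (real (aprimedivisor m)))"
    unfolding psi_def by (intro sum.mono_neutral_cong_right) (auto simp: mangoldt_def)
  also have "\<dots> = (\<Sum>p\<in>?P. \<Sum>m | m \<in> ?Q \<and> aprimedivisor m = p. ln (real (aprimedivisor m)))"
  proof (rule sum.group[symmetric])
    show "aprimedivisor ` ?Q \<subseteq> ?P"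
    proof safe
      fix m assume m: "m \<le> n" "primepow m"
      then have "m > 1" by (simp add: primepow_gt_Suc_0)
      then have "prime (aprimedivisor m)" "aprimedivisor m \<le> m"
        by (auto intro!: prime_aprimedivisor' aprimedivisor_le_nat)
      then show "aprimedivisor m \<in> ?P" using m by (auto simp: primes_le_def)
    qed
  qed auto
  also have "\<dots> \<le> (\<Sum>p\<in>?P. ln (real n))"
  proof (rule sum_mono)
    fix p assume p: "p \<in> ?P"
    then have pp: "prime p" "p \<le> n" by (auto simp: primes_le_def)
    then have lp: "ln (real p) > 0" using prime_gt_1_nat[OF pp(1)] by simp
    define K where "K = nat \<lfloor>ln (real n) / ln (real p)\<rfloor>"
    have "{m. m \<in> ?Q \<and> aprimedivisor m = p} \<subseteq> (\<lambda>k. p ^ k) ` {1..K}"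
    proof safe
      fix m assume m: "m \<le> n" "primepow m" "p = aprimedivisor m"
      then obtain q k where qk: "prime q" "k > 0" "m = q ^ k" by (auto simp: primepow_def)
      then have "p = q" using m by (simp add: aprimedivisor_prime_power)
      have "real k * ln (real p) = ln (real m)" using qk \<open>p = q\<close> pp by (simp add: ln_realpow prime_gt_0_nat)
      also have "\<dots> \<le> ln (real n)" using m assms qk prime_gt_0_nat[OF qk(1)] by (subst ln_le_cancel_iff) auto
      finally have "real k \<le> ln (real n) / ln (real p)" using lp by (simp add: field_simps)
      then have "k \<le> K" unfolding K_def by (simp add: le_nat_floor)
      then show "m \<in> (\<lambda>k. aprimedivisor m ^ k) ` {1..K}" using qk \<open>p = q\<close> m by (intro image_eqI[of _ _ k]) auto
    qed
    then have "card {m. m \<in> ?Q \<and> aprimedivisor m = p} \<le> card {1..K}"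
      by (meson card_image_le card_mono finite_atLeastAtMost finite_imageI le_trans)
    then have "real (card {m. m \<in> ?Q \<and> aprimedivisor m = p}) \<le> real K" by simp
    also have "\<dots> \<le> ln (real n) / ln (real p)"
      unfolding K_def using lp assms by (simp add: of_nat_floor)
    finally have "real (card {m. m \<in> ?Q \<and> aprimedivisor m = p}) * ln (real p) \<le> ln (real n)"
      using lp by (simp add: field_simps)
    moreover have "(\<Sum>m | m \<in> ?Q \<and> aprimedivisor m = p. ln (real (aprimedivisor m))) =
        real (card {m. m \<in> ?Q \<and> aprimedivisor m = p}) * ln (real p)"
      by simp
    ultimately show "(\<Sum>m | m \<in> ?Q \<and> aprimedivisor m = p. ln (real (aprimedivisor m))) \<le> ln (real n)" by simp
  qed
  finally show ?thesis by simp
qed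

text \<open>Primes above \<open>y\<close> contribute at least \<open>ln y\<close> each to
  \<open>psi\<close>, and at most \<open>y\<close> primes are left over.\<close>

lemma card_primes_le_psi:
  assumes "1 < y" "y \<le> x"
  shows "real (card (primes_le x)) * ln y \<le> y * ln y + psi (nat \<lfloor>x\<rfloor>)"
proof -
  have ly: "ln y > 0" using assms by simp
  have "card (primes_le y) \<le> card {1..nat \<lfloor>y\<rfloor>}"
    by (rule card_mono) (auto simp: primes_le_def le_nat_floor prime_ge_1_nat Suc_leI prime_gt_0_nat)
  then have c: "real (card (primes_le y)) \<le> y" using assms by simp linarith
  have "primes_le y \<subseteq> primes_le x" using assms by (auto simp: primes_le_def)
  then have "card (primes_le x) = card (primes_le y) + card (primes_le x - primes_le y)"
    by (metis card_Diff_subset card_mono finite_primes_le le_add_diff_inverse)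
  then have "real (card (primes_le x)) * ln y = real (card (primes_le y)) * ln y + real (card (primes_le x - primes_le y)) * ln y"
    by (simp add: distrib_right)
  also have "real (card (primes_le x - primes_le y)) * ln y = (\<Sum>p\<in>primes_le x - primes_le y. ln y)" by simp
  also have "\<dots> \<le> (\<Sum>p\<in>primes_le x - primes_le y. mangoldt p)"
    by (rule sum_mono) (use assms in \<open>auto simp: primes_le_def\<close>)
  also have "\<dots> \<le> psi (nat \<lfloor>x\<rfloor>)"
    unfolding psi_def by (rule sum_mono2) (auto simp: primes_le_def mangoldt_nonneg le_nat_floor)
  finally show ?thesis using mult_right_mono[OF c, of "ln y"] ly by linarith
qed

theorem prime_number_theorem: "((\<lambda>x. real (card (primes_le x)) * ln x / x) \<longlongrightarrow> 1) at_top"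
proof (rule tendsto_sandwich)
  show "\<forall>\<^sub>F x in at_top. psi (nat \<lfloor>x\<rfloor>) / x \<le> real (card (primes_le x)) * ln x / x"
    using eventually_ge_at_top[of 1]
  proof eventually_elim
    case (elim x)
    let ?n = "nat \<lfloor>x\<rfloor>"
    have n: "?n \<ge> 1" "real ?n \<le> x" using elim by (auto simp: le_nat_iff)
    have "psi ?n \<le> real (card (primes_le (real ?n))) * ln (real ?n)" by (rule psi_le_card_primes[OF n(1)])
    also have "\<dots> \<le> real (card (primes_le x)) * ln x"
    proof (intro mult_mono)
      have "primes_le (real ?n) \<subseteq> primes_le x" using n by (auto simp: primes_le_def)
      then show "real (card (primes_le (real ?n))) \<le> real (card (primes_le x))" by (simp add: card_mono)
      show "ln (real ?n) \<le> ln x" using n elim by (subst ln_le_cancel_iff) auto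
    qed (use n in auto)
    finally show ?case using elim by (intro divide_right_mono) auto
  qed
  show "\<forall>\<^sub>F x in at_top. real (card (primes_le x)) * ln x / x \<le> 1 / ln x + psi (nat \<lfloor>x\<rfloor>) / x * (ln x / ln (x / (ln x)\<^sup>2))"
  proof -
    have "\<forall>\<^sub>F x in at_top. x / (ln x)\<^sup>2 > (1::real)" "\<forall>\<^sub>F x in at_top. ln x > (1::real)" by real_asymp+
    then show ?thesis using eventually_gt_at_top[of 1]
    proof eventually_elim
      case (elim x)
      \<comment> \<open>With this \<open>y\<close> the trivial count contributes only
        \<open>1 / ln x\<close>, while \<open>ln y\<close> is still asymptotic to
        \<open>ln x\<close>.\<close>
      let ?y = "x / (ln x)\<^sup>2"
      have "x * 1 \<le> x * (ln x)\<^sup>2" using elim by (intro mult_left_mono) auto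
      then have "?y \<le> x" using elim by (simp add: divide_le_eq)
      have ly: "ln ?y > 0" using elim by simp
      have "real (card (primes_le x)) * ln ?y \<le> ?y * ln ?y + psi (nat \<lfloor>x\<rfloor>)"
        by (rule card_primes_le_psi[OF elim(1) \<open>?y \<le> x\<close>])
      then have "real (card (primes_le x)) \<le> ?y + psi (nat \<lfloor>x\<rfloor>) / ln ?y"
        using ly by (simp add: field_simps)
      then have "real (card (primes_le x)) * (ln x / x) \<le> (?y + psi (nat \<lfloor>x\<rfloor>) / ln ?y) * (ln x / x)"
        using elim by (intro mult_right_mono) auto
      also have "\<dots> = ?y * (ln x / x) + psi (nat \<lfloor>x\<rfloor>) / x * (ln x / ln ?y)"
        by (subst distrib_right) (simp only: times_divide_times_eq mult.commute)
      also have "?y * (ln x / x) = 1 / ln x" using elim by (simp add: power2_eq_square)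
      finally show ?case by simp
    qed
  qed
  have "((\<lambda>x::real. ln x / ln (x / (ln x)\<^sup>2)) \<longlongrightarrow> 1) at_top" "((\<lambda>x::real. 1 / ln x) \<longlongrightarrow> 0) at_top" by real_asymp+
  from tendsto_add[OF this(2) tendsto_mult[OF psi_asymp_real this(1)]]
  show "((\<lambda>x. 1 / ln x + psi (nat \<lfloor>x\<rfloor>) / x * (ln x / ln (x / (ln x)\<^sup>2))) \<longlongrightarrow> 1) at_top" by simp
qed (rule psi_asymp_real)

text \<open>Scaling does not change the logarithm asymptotically. The value \<open>c = 0\<close> is
  included as the left end of a partition of \<open>[0, x]\<close>.\<close>

lemma prime_count_scaled:
  assumes "c \<ge> 0"
  shows "((\<lambda>x. real (card (primes_le (c * x))) * ln x / x) \<longlongrightarrow> c) at_top"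
proof (cases "c = 0")
  case True
  have "primes_le 0 = {}" by (auto simp: primes_le_def dest: prime_gt_0_nat)
  then show ?thesis using True by simp
next
  case False
  then have c: "c > 0" using assms by simp
  have "filterlim (\<lambda>x. c * x) at_top at_top" using c by real_asymp
  from filterlim_compose[OF prime_number_theorem this]
  have 1: "((\<lambda>x. real (card (primes_le (c * x))) * ln (c * x) / (c * x)) \<longlongrightarrow> 1) at_top" .
  have 2: "((\<lambda>x. ln x / ln (c * x)) \<longlongrightarrow> 1) at_top" using c by real_asymp
  have "((\<lambda>x. real (card (primes_le (c * x))) * ln (c * x) / (c * x) * (c * (ln x / ln (c * x)))) \<longlongrightarrow> 1 * (c * 1)) at_top"
    by (intro tendsto_mult 1 2 tendsto_const)
  moreover have "\<forall>\<^sub>F x in at_top. real (card (primes_le (c * x))) * ln (c * x) / (c * x) * (c * (ln x / ln (c * x))) =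
     real (card (primes_le (c * x))) * ln x / x"
  proof -
    have "\<forall>\<^sub>F x in at_top. ln (c * x) > 0" using c by real_asymp
    then show ?thesis using eventually_gt_at_top[of 0]
    proof eventually_elim
      case (elim x)
      then show ?case using c by (simp add: field_simps)
    qed
  qed
  ultimately have "((\<lambda>x. real (card (primes_le (c * x))) * ln x / x) \<longlongrightarrow> 1 * (c * 1)) at_top"
    by (rule Lim_transform_eventually)
  then show ?thesis by simp
qed

section \<open>Sums of powers of primes\<close>

lemma riemann_sum_powr:
  assumes "\<alpha> > 0"
  shows "(\<Sum>j<K. real j powr \<alpha>) \<le> real K powr (1 + \<alpha>) / (1 + \<alpha>)"
    and "real K powr (1 + \<alpha>) / (1 + \<alpha>) \<le> (\<Sum>j<K. real (Suc j) powr \<alpha>)"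
proof -
  have *: "real j powr \<alpha> \<le> (real (Suc j) powr (1 + \<alpha>) - real j powr (1 + \<alpha>)) / (1 + \<alpha>) \<and>
     (real (Suc j) powr (1 + \<alpha>) - real j powr (1 + \<alpha>)) / (1 + \<alpha>) \<le> real (Suc j) powr \<alpha>" for j
  proof (cases "j = 0")
    case False
    then obtain \<xi> where xi: "real j < \<xi>" "\<xi> < real (Suc j)"
      "real (Suc j) powr (1 + \<alpha>) - real j powr (1 + \<alpha>) = (real (Suc j) - real j) * ((1 + \<alpha>) * \<xi> powr (1 + \<alpha> - 1))"
      using powr_mvt[of "real j" "real (Suc j)" "1 + \<alpha>"] by (metis of_nat_0_less_iff of_nat_less_iff lessI not_gr0)
    then have "(real (Suc j) powr (1 + \<alpha>) - real j powr (1 + \<alpha>)) / (1 + \<alpha>) = \<xi> powr \<alpha>"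
      using assms by simp
    then show ?thesis using xi assms by (auto intro!: powr_mono2)
  qed (use assms in auto)
  have t: "(\<Sum>j<K. (real (Suc j) powr (1 + \<alpha>) - real j powr (1 + \<alpha>)) / (1 + \<alpha>)) = real K powr (1 + \<alpha>) / (1 + \<alpha>)"
    using sum_lessThan_telescope[of "\<lambda>j. real j powr (1 + \<alpha>)" K]
    by (simp only: sum_divide_distrib[symmetric]) simp
  show "(\<Sum>j<K. real j powr \<alpha>) \<le> real K powr (1 + \<alpha>) / (1 + \<alpha>)"
    "real K powr (1 + \<alpha>) / (1 + \<alpha>) \<le> (\<Sum>j<K. real (Suc j) powr \<alpha>)"
    unfolding t[symmetric] by (intro sum_mono; use * in blast)+
qed

lemma prime_powr_sum_bounds:
  assumes "\<alpha> > 0" "0 \<le> y" "y \<le> x"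
  shows "(real (card (primes_le x)) - real (card (primes_le y))) * y powr \<alpha>
       \<le> (\<Sum>p\<in>primes_le x. real p powr \<alpha>) - (\<Sum>p\<in>primes_le y. real p powr \<alpha>)"
    and "(\<Sum>p\<in>primes_le x. real p powr \<alpha>) - (\<Sum>p\<in>primes_le y. real p powr \<alpha>)
       \<le> (real (card (primes_le x)) - real (card (primes_le y))) * x powr \<alpha>"
proof -
  have sub: "primes_le y \<subseteq> primes_le x" using assms by (auto simp: primes_le_def)
  have d: "(\<Sum>p\<in>primes_le x. real p powr \<alpha>) - (\<Sum>p\<in>primes_le y. real p powr \<alpha>) = (\<Sum>p\<in>primes_le x - primes_le y. real p powr \<alpha>)"
    using sub by (simp add: sum_diff)
  have c: "real (card (primes_le x)) - real (card (primes_le y)) = real (card (primes_le x - primes_le y))"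
    using sub by (simp add: card_Diff_subset card_mono of_nat_diff)
  show "(real (card (primes_le x)) - real (card (primes_le y))) * y powr \<alpha>
       \<le> (\<Sum>p\<in>primes_le x. real p powr \<alpha>) - (\<Sum>p\<in>primes_le y. real p powr \<alpha>)"
    unfolding d c using assms by (intro sum_bounded_below) (auto simp: primes_le_def intro!: powr_mono2)
  show "(\<Sum>p\<in>primes_le x. real p powr \<alpha>) - (\<Sum>p\<in>primes_le y. real p powr \<alpha>)
       \<le> (real (card (primes_le x)) - real (card (primes_le y))) * x powr \<alpha>"
    unfolding d c using assms by (intro sum_bounded_above) (auto simp: primes_le_def intro!: powr_mono2)
qed

text \<open>The interval up to \<open>x\<close> is cut into \<open>K\<close> equal parts, each with
  asymptotically \<open>x / (K ln x)\<close> primes; bounding \<open>p powr \<alpha>\<close> by its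
  end values gives Riemann sums for the integral of \<open>u powr \<alpha>\<close> over
  \<open>[0, 1]\<close>.\<close>

theorem prime_powr_sum_asymp:
  assumes "\<alpha> > 0"
  shows "((\<lambda>x. (\<Sum>p\<in>primes_le x. real p powr \<alpha>) * ln x / x powr (1 + \<alpha>)) \<longlongrightarrow> 1 / (1 + \<alpha>)) at_top"
proof (rule tendstoI)
  fix r :: real assume r: "r > 0"
  obtain K :: nat where K: "K > 0" "1 / real K < r / 2"
    using r real_arch_inverse[of "r/2"] by (auto simp: inverse_eq_divide)
  define T where "T = (\<lambda>x. \<Sum>p\<in>primes_le x. real p powr \<alpha>)"
  define d where "d = (\<lambda>x j. (real (card (primes_le (real (Suc j) / real K * x))) - real (card (primes_le (real j / real K * x)))) * ln x / x)"
  have d: "((\<lambda>x. d x j) \<longlongrightarrow> 1 / real K) at_top" for j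
  proof -
    have "((\<lambda>x. real (card (primes_le (real (Suc j) / real K * x))) * ln x / x - real (card (primes_le (real j / real K * x))) * ln x / x)
      \<longlongrightarrow> real (Suc j) / real K - real j / real K) at_top"
      by (intro tendsto_diff prime_count_scaled) auto
    then show ?thesis by (simp add: d_def diff_divide_distrib left_diff_distrib add_divide_distrib)
  qed
  define L where "L = (\<Sum>j<K. 1 / real K * (real j / real K) powr \<alpha>)"
  define U where "U = (\<Sum>j<K. 1 / real K * (real (Suc j) / real K) powr \<alpha>)"
  have "L = (\<Sum>j<K. real j powr \<alpha>) / real K powr (1 + \<alpha>)"
    using K(1) unfolding L_def sum_divide_distrib by (intro sum.cong) (auto simp: powr_divide powr_add)
  also have "\<dots> \<le> (real K powr (1 + \<alpha>) / (1 + \<alpha>)) / real K powr (1 + \<alpha>)"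
    by (intro divide_right_mono riemann_sum_powr assms) auto
  finally have L: "L \<le> 1 / (1 + \<alpha>)" using K(1) by simp
  have "(real K powr (1 + \<alpha>) / (1 + \<alpha>)) / real K powr (1 + \<alpha>) \<le> (\<Sum>j<K. real (Suc j) powr \<alpha>) / real K powr (1 + \<alpha>)"
    by (intro divide_right_mono riemann_sum_powr assms) auto
  also have "\<dots> = U"
    using K(1) unfolding U_def sum_divide_distrib by (intro sum.cong) (auto simp: powr_divide powr_add)
  finally have U: "1 / (1 + \<alpha>) \<le> U" using K(1) by simp
  \<comment> \<open>Upper and lower sum differ by exactly \<open>1 / K\<close>, by
    telescoping.\<close>
  have "U - L = (\<Sum>j<K. 1 / real K * (real (Suc j) / real K) powr \<alpha> - 1 / real K * (real j / real K) powr \<alpha>)"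
    by (simp add: U_def L_def sum_subtractf)
  also have "\<dots> = 1 / real K * (real K / real K) powr \<alpha> - 1 / real K * (real 0 / real K) powr \<alpha>"
    using sum_lessThan_telescope[of "\<lambda>j. 1 / real K * (real j / real K) powr \<alpha>" K] by (simp only:)
  finally have UL: "U - L = 1 / real K" using K(1) by simp
  have "((\<lambda>x. \<Sum>j<K. d x j * (real j / real K) powr \<alpha>) \<longlongrightarrow> L) at_top" unfolding L_def
    by (intro tendsto_sum tendsto_mult d tendsto_const)
  then have e1: "\<forall>\<^sub>F x in at_top. (\<Sum>j<K. d x j * (real j / real K) powr \<alpha>) > L - r / 2"
    by (rule order_tendstoD) (use r in simp)
  have "((\<lambda>x. \<Sum>j<K. d x j * (real (Suc j) / real K) powr \<alpha>) \<longlongrightarrow> U) at_top" unfolding U_def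
    by (intro tendsto_sum tendsto_mult d tendsto_const)
  then have e2: "\<forall>\<^sub>F x in at_top. (\<Sum>j<K. d x j * (real (Suc j) / real K) powr \<alpha>) < U + r / 2"
    by (rule order_tendstoD) (use r in simp)
  show "\<forall>\<^sub>F x in at_top. dist ((\<Sum>p\<in>primes_le x. real p powr \<alpha>) * ln x / x powr (1 + \<alpha>)) (1 / (1 + \<alpha>)) < r"
    using e1 e2 eventually_gt_at_top[of 1]
  proof eventually_elim
    case (elim x)
    have x: "x > 1" by fact
    define w where "w = ln x / x powr (1 + \<alpha>)"
    have w: "w \<ge> 0" using x by (simp add: w_def)
    have "primes_le 0 = {}" by (auto simp: primes_le_def dest: prime_gt_0_nat)
    then have tele: "T x = (\<Sum>j<K. T (real (Suc j) / real K * x) - T (real j / real K * x))"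
      using K(1) sum_lessThan_telescope[of "\<lambda>j. T (real j / real K * x)" K] by (simp add: T_def)
    have scale: "(real (card (primes_le (real (Suc j) / real K * x))) - real (card (primes_le (real j / real K * x)))) * (real i / real K * x) powr \<alpha> * w
        = d x j * (real i / real K) powr \<alpha>" for i j
    proof -
      have "(real i / real K * x) powr \<alpha> * w = (real i / real K) powr \<alpha> * (ln x / x)"
      proof -
        have "(real i / real K * x) powr \<alpha> = (real i / real K) powr \<alpha> * x powr \<alpha>"
          by (rule powr_mult)
        then have "(real i / real K * x) powr \<alpha> * w = (real i / real K) powr \<alpha> * (x powr \<alpha> * w)" by (simp only: mult.assoc)
        also have "x powr \<alpha> * w = ln x / x" using x by (simp add: w_def powr_add)
        finally show ?thesis .
      qed
      then show ?thesis unfolding d_def by (simp only: mult.assoc) (simp only: times_divide_eq_left times_divide_eq_right mult_ac)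
    qed
    have b: "real j / real K * x \<le> real (Suc j) / real K * x" "real j / real K * x \<ge> 0" for j
      using x by (auto intro!: mult_right_mono divide_right_mono)
    have bd: "d x j * (real j / real K) powr \<alpha> \<le> (T (real (Suc j) / real K * x) - T (real j / real K * x)) * w"
      "(T (real (Suc j) / real K * x) - T (real j / real K * x)) * w \<le> d x j * (real (Suc j) / real K) powr \<alpha>" for j
      unfolding scale[symmetric] T_def by (intro mult_right_mono prime_powr_sum_bounds assms b w)+
    have Tw: "T x * w = (\<Sum>j<K. (T (real (Suc j) / real K * x) - T (real j / real K * x)) * w)"
      by (subst tele) (rule sum_distrib_right)
    have "(\<Sum>j<K. d x j * (real j / real K) powr \<alpha>) \<le> T x * w"
      unfolding Tw by (intro sum_mono bd)
    moreover have "T x * w \<le> (\<Sum>j<K. d x j * (real (Suc j) / real K) powr \<alpha>)"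
      unfolding Tw by (intro sum_mono bd)
    ultimately have "T x * w > L - r / 2" "T x * w < U + r / 2" using elim by linarith+
    then have "\<bar>T x * w - 1 / (1 + \<alpha>)\<bar> < r" using L U UL K(2) by linarith
    then show ?case by (simp add: T_def w_def dist_real_def)
  qed
qed

section \<open>Asymptotics\<close>

text \<open>The counting bound together with the estimate of the binomial coefficient by
  \<open>(h + k) ^ k / fact k\<close>.\<close>

lemma h_cyc_lower:
  assumes k: "1 \<le> k" and N: "N \<ge> (2 ^ k + 1) ^ k"
  shows "root k (fact k) * root k (real N) \<le> real (h_cyc N k) + real k"
proof -
  obtain A where A: "A \<subseteq> {1..<N}" "card A = k" "zsumset N (h_cyc N k) (insert 0 A) = {0..<N}"
    using h_cyc_spec(3)[OF assms] by blast
  have "finite A" "0 \<notin> A" using A(1) finite_subset by auto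
  then have "N \<le> (h_cyc N k + k) choose k" using zsumset_full_card[OF A(3)] A(2) by simp
  then have "N * fact k \<le> ((h_cyc N k + k) choose k) * fact k" by simp
  also have "\<dots> \<le> (h_cyc N k + k) ^ k" by (rule binomial_fact_pow)
  finally have "real (N * fact k) \<le> real ((h_cyc N k + k) ^ k)" by (rule of_nat_mono)
  then have "fact k * real N \<le> (real (h_cyc N k) + real k) ^ k" by (simp add: mult.commute)
  then have "root k (fact k * real N) \<le> root k ((real (h_cyc N k) + real k) ^ k)"
    using k by (intro real_root_le_mono) auto
  also have "\<dots> = real (h_cyc N k) + real k" using k by (intro real_root_power_cancel) auto
  finally show ?thesis by (simp add: real_root_mult)
qed

text \<open>The counting bound tends to \<open>root k (fact k) / k\<close>, which exceeds
  \<open>1 / exp 1\<close> strictly; the additive \<open>k\<close> disappears in the limit. The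
  upper bound is the digit construction.\<close>

lemma R_low_bounds:
  assumes k: "1 \<le> k"
  shows "ereal (1 / exp 1) < R_low k" "R_low k \<le> 1"
proof -
  let ?N0 = "(2 ^ k + 1) ^ k :: nat"
  have N0: "?N0 > 0" by simp
  define c where "c = root k (fact k) / real k"
  have "(real k / exp 1) ^ k < fact k" by (rule fact_gt_powr[OF k])
  then have "root k ((real k / exp 1) ^ k) < root k (fact k)" using k by (intro real_root_less_mono) auto
  then have "real k / exp 1 < root k (fact k)" using k by (simp add: real_root_power_cancel)
  then have c: "1 / exp 1 < c" using k by (simp add: c_def field_simps)
  \<comment> \<open>A limit inferior preserves only weak inequalities; a value strictly in between
    saves the strict one.\<close>
  define d where "d = (c + 1 / exp 1) / 2"
  have d: "1 / exp 1 < d" "d < c" using c by (auto simp: d_def)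
  have "\<forall>\<^sub>F N in sequentially. 1 / (c - d) \<le> root k (real N)"
  proof -
    have "\<forall>\<^sub>F N in sequentially. (1 / (c - d)) ^ k \<le> real N" by real_asymp
    then show ?thesis
    proof eventually_elim
      case (elim N)
      have "1 / (c - d) = root k ((1 / (c - d)) ^ k)" using k d by (simp add: real_root_power_cancel)
      also have "\<dots> \<le> root k (real N)" using k elim by (intro real_root_le_mono) auto
      finally show ?case .
    qed
  qed
  then have "\<forall>\<^sub>F N in sequentially. ereal d \<le> ereal (real (h_cyc N k) / (real k * root k (real N)))"
    using eventually_ge_at_top[of ?N0]
  proof eventually_elim
    case (elim N)
    have "real N > 0" using elim(2) N0 by linarith
    then have r0: "root k (real N) > 0" using k by simp
    have "1 \<le> (c - d) * root k (real N)" using elim(1) d by (simp add: divide_le_eq mult.commute)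
    then have "real k * 1 \<le> real k * ((c - d) * root k (real N))" by (intro mult_left_mono) auto
    moreover have "real k * c * root k (real N) \<le> real (h_cyc N k) + real k"
      using h_cyc_lower[OF k elim(2)] k by (simp add: c_def)
    ultimately have "d * (real k * root k (real N)) \<le> real (h_cyc N k)" by (simp add: algebra_simps)
    then show ?case using r0 k by (simp add: le_divide_eq)
  qed
  then have "ereal d \<le> R_low k" unfolding R_low_def by (rule Liminf_bounded)
  moreover have "ereal (1 / exp 1) < ereal d" using d by simp
  ultimately show "ereal (1 / exp 1) < R_low k" by (rule less_le_trans[rotated])
  have "\<forall>\<^sub>F N in sequentially. ereal (real (h_cyc N k) / (real k * root k (real N))) \<le> 1"
    using eventually_ge_at_top[of ?N0]
  proof eventually_elim
    case (elim N)
    have "real N > 0" using elim N0 by linarith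
    then have "real k * root k (real N) > 0" using k by simp
    then show ?case using h_cyc_spec(2)[OF k elim] by (simp add: divide_le_eq)
  qed
  then have "limsup (\<lambda>N. ereal (real (h_cyc N k) / (real k * root k (real N)))) \<le> 1" by (rule Limsup_bounded)
  moreover have "R_low k \<le> limsup (\<lambda>N. ereal (real (h_cyc N k) / (real k * root k (real N))))"
    unfolding R_low_def by (rule Liminf_le_Limsup) simp
  ultimately show "R_low k \<le> 1" by (rule order_trans[rotated])
qed

text \<open>For \<open>\<kappa> = 1 / (1 + \<alpha>)\<close> this is the asymptotic solution
  \<open>x\<close> of \<open>x powr (1 + \<alpha>) / ((1 + \<alpha>) * ln x) = t\<close>, because
  \<open>ln x\<close> is about \<open>\<kappa> * ln t\<close>. So the primes up to the cutoff use up
  a budget \<open>t\<close> for the sum of \<open>p powr \<alpha>\<close>.\<close>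

definition prime_cutoff :: "real \<Rightarrow> real \<Rightarrow> real" where
  "prime_cutoff \<kappa> t = (t * ln t) powr \<kappa>"

lemma prime_cutoff_at_top: "\<kappa> > 0 \<Longrightarrow> filterlim (prime_cutoff \<kappa>) at_top at_top"
  unfolding prime_cutoff_def by real_asymp

lemma ln_prime_cutoff: "\<kappa> > 0 \<Longrightarrow> ((\<lambda>t. ln t / ln (prime_cutoff \<kappa> t)) \<longlongrightarrow> 1 / \<kappa>) at_top"
  unfolding prime_cutoff_def inverse_eq_divide[symmetric] by real_asymp

lemma card_primes_cutoff:
  assumes "\<kappa> > 0"
  shows "((\<lambda>t. real (card (primes_le (prime_cutoff \<kappa> t))) / (prime_cutoff \<kappa> t / ln t)) \<longlongrightarrow> 1 / \<kappa>) at_top"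
proof -
  let ?y = "prime_cutoff \<kappa>"
  have "((\<lambda>t. real (card (primes_le (?y t))) * ln (?y t) / ?y t * (ln t / ln (?y t))) \<longlongrightarrow> 1 * (1 / \<kappa>)) at_top"
    by (intro tendsto_mult ln_prime_cutoff assms filterlim_compose[OF prime_number_theorem prime_cutoff_at_top])
  moreover have "\<forall>\<^sub>F t in at_top. real (card (primes_le (?y t))) * ln (?y t) / ?y t * (ln t / ln (?y t)) = real (card (primes_le (?y t))) / (?y t / ln t)"
    using filterlim_at_top_dense[THEN iffD1, OF prime_cutoff_at_top[OF assms], rule_format, of 1]
  proof eventually_elim
    case (elim t)
    then have "ln (?y t) > 0" by simp
    then show ?case by simp
  qed
  ultimately have "((\<lambda>t. real (card (primes_le (?y t))) / (?y t / ln t)) \<longlongrightarrow> 1 * (1 / \<kappa>)) at_top"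
    by (rule Lim_transform_eventually)
  then show ?thesis by simp
qed

lemma prime_powr_sum_cutoff:
  assumes "\<alpha> > 0" "\<kappa> = 1 / (1 + \<alpha>)"
  shows "((\<lambda>t. (\<Sum>p\<in>primes_le (prime_cutoff \<kappa> t). real p powr \<alpha>) / t) \<longlongrightarrow> 1) at_top"
proof -
  let ?y = "prime_cutoff \<kappa>"
  have \<kappa>: "\<kappa> > 0" using assms by simp
  have "((\<lambda>t. (\<Sum>p\<in>primes_le (?y t). real p powr \<alpha>) * ln (?y t) / ?y t powr (1 + \<alpha>) * (ln t / ln (?y t))) \<longlongrightarrow> 1 / (1 + \<alpha>) * (1 / \<kappa>)) at_top"
    by (intro tendsto_mult ln_prime_cutoff \<kappa> filterlim_compose[OF prime_powr_sum_asymp prime_cutoff_at_top] assms)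
  moreover have "\<forall>\<^sub>F t in at_top. (\<Sum>p\<in>primes_le (?y t). real p powr \<alpha>) * ln (?y t) / ?y t powr (1 + \<alpha>) * (ln t / ln (?y t))
      = (\<Sum>p\<in>primes_le (?y t). real p powr \<alpha>) / t"
    using filterlim_at_top_dense[THEN iffD1, OF prime_cutoff_at_top[OF \<kappa>], rule_format, of 1] eventually_gt_at_top[of 1]
  proof eventually_elim
    case (elim t)
    then have 1: "ln (?y t) > 0" "ln t > 0" by simp_all
    have "?y t powr (1 + \<alpha>) = t * ln t"
      using elim(2) assms by (simp add: prime_cutoff_def powr_powr)
    then show ?case using 1 by simp
  qed
  ultimately have "((\<lambda>t. (\<Sum>p\<in>primes_le (?y t). real p powr \<alpha>) / t) \<longlongrightarrow> 1 / (1 + \<alpha>) * (1 / \<kappa>)) at_top"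
    by (rule Lim_transform_eventually)
  then show ?thesis using assms by simp
qed

text \<open>Among primes the weight \<open>p powr \<alpha> - x powr \<alpha>\<close> is nonpositive
  exactly on \<open>primes_le x\<close>, so this set minimises the total weight over finite sets of
  primes; the inequality is this fact solved for \<open>card T\<close>.\<close>

lemma card_primes_exchange:
  assumes T: "finite T" "\<And>p. p \<in> T \<Longrightarrow> prime p" and "x > 0" "\<alpha> > 0"
  shows "real (card T) \<le> real (card (primes_le x)) + ((\<Sum>p\<in>T. real p powr \<alpha>) - (\<Sum>p\<in>primes_le x. real p powr \<alpha>)) / x powr \<alpha>"
proof -
  have "(\<Sum>p\<in>primes_le x. real p powr \<alpha> - x powr \<alpha>) \<le> (\<Sum>p\<in>T. real p powr \<alpha> - x powr \<alpha>)"
  proof -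
    have "(\<Sum>p\<in>primes_le x. real p powr \<alpha> - x powr \<alpha>) = (\<Sum>p\<in>primes_le x - T. real p powr \<alpha> - x powr \<alpha>) + (\<Sum>p\<in>primes_le x \<inter> T. real p powr \<alpha> - x powr \<alpha>)"
      by (subst add.commute, rule sum.Int_Diff) simp
    also have "(\<Sum>p\<in>primes_le x - T. real p powr \<alpha> - x powr \<alpha>) \<le> 0"
      using assms by (intro sum_nonpos) (auto simp: primes_le_def intro!: powr_mono2)
    also have "0 + (\<Sum>p\<in>primes_le x \<inter> T. real p powr \<alpha> - x powr \<alpha>) \<le> (\<Sum>p\<in>T. real p powr \<alpha> - x powr \<alpha>)"
    proof -
      have "(\<Sum>p\<in>primes_le x \<inter> T. real p powr \<alpha> - x powr \<alpha>) \<le> (\<Sum>p\<in>T. real p powr \<alpha> - x powr \<alpha>)"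
        using assms by (intro sum_mono2) (auto simp: primes_le_def intro!: powr_mono2)
      then show ?thesis by simp
    qed
    finally show ?thesis by simp
  qed
  then have "real (card T) * x powr \<alpha> \<le> real (card (primes_le x)) * x powr \<alpha> + ((\<Sum>p\<in>T. real p powr \<alpha>) - (\<Sum>p\<in>primes_le x. real p powr \<alpha>))"
    by (simp add: sum_subtractf)
  then have "real (card T) \<le> (real (card (primes_le x)) * x powr \<alpha> + ((\<Sum>p\<in>T. real p powr \<alpha>) - (\<Sum>p\<in>primes_le x. real p powr \<alpha>))) / x powr \<alpha>"
    using assms(3) by (simp add: le_divide_eq)
  then show ?thesis using assms(3) by (simp add: add_divide_distrib)
qed

section \<open>Comparison with f(h,k)\<close>

lemma f_hk_eq:
  assumes "1 \<le> k" "ln (real h) > 0"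
  shows "f_hk h k = (real k + 1) / real k * real k powr (- (real k / (real k + 1))) * (real h powr (real k / (real k + 1)) * ln (real h) powr (- 1 / (real k + 1)))"
proof -
  have h: "real h > 0" using assms(2) by (cases h) auto
  have "((real h) ^ k / ln (real h)) powr (1 / (real k + 1)) = real h powr (real k / (real k + 1)) * ln (real h) powr (- 1 / (real k + 1))"
  proof -
    have "(real h) ^ k = real h powr real k" using h by (simp add: powr_realpow)
    moreover have "(real h powr real k / ln (real h)) powr (1 / (real k + 1)) = (real h powr real k) powr (1 / (real k + 1)) / ln (real h) powr (1 / (real k + 1))"
      by (rule powr_divide)
    ultimately show ?thesis by (simp add: powr_powr powr_minus_divide)
  qed
  moreover have "(real k + 1) / (real k)^2 * root (k + 1) (real k) = (real k + 1) / real k * real k powr (- (real k / (real k + 1)))"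
  proof -
    have "root (k + 1) (real k) = real k powr (1 / (real k + 1))"
      using assms(1) by (simp add: root_powr_inverse add.commute)
    also have "1 / (real k + 1) = 1 + - (real k / (real k + 1))" by (simp add: field_simps)
    also have "real k powr \<dots> = real k * real k powr (- (real k / (real k + 1)))"
      using assms(1) by (subst powr_add) simp
    finally show ?thesis using assms(1) by (simp add: power2_eq_square)
  qed
  ultimately show ?thesis by (simp add: f_hk_def)
qed

lemma f_hk_pos:
  assumes "1 \<le> k" "ln (real h) > 0"
  shows "f_hk h k > 0"
proof -
  have "real h > 0" using assms(2) by (cases h) auto
  then show ?thesis using assms by (simp add: f_hk_eq)
qed

text \<open>Since \<open>\<kappa> - 1 = - 1 / (k + 1)\<close>, numerator and \<open>f_hk h k\<close>
  are constant multiples of \<open>h powr \<kappa>\<close> times a logarithm to the power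
  \<open>\<kappa> - 1\<close>, and the logarithms of \<open>a * h\<close> and \<open>h\<close> agree
  asymptotically.\<close>

lemma cutoff_over_f_hk:
  assumes k: "1 \<le> k" and a: "a > 0"
  defines "\<kappa> \<equiv> real k / (real k + 1)"
  shows "(\<lambda>h. prime_cutoff \<kappa> (a * real h) / ln (a * real h) / f_hk h k) \<longlonglongrightarrow> \<kappa> * (a * real k) powr \<kappa>"
proof -
  have "(\<lambda>h. \<kappa> * (a * real k) powr \<kappa> * (ln (a * real h) / ln (real h)) powr (- 1 / (real k + 1))) \<longlonglongrightarrow> \<kappa> * (a * real k) powr \<kappa> * 1 powr (- 1 / (real k + 1))"
  proof (intro tendsto_mult tendsto_const tendsto_powr)
    show "(\<lambda>h. ln (a * real h) / ln (real h)) \<longlonglongrightarrow> 1" using a by real_asymp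
  qed simp
  moreover have "\<forall>\<^sub>F h in sequentially. \<kappa> * (a * real k) powr \<kappa> * (ln (a * real h) / ln (real h)) powr (- 1 / (real k + 1))
      = prime_cutoff \<kappa> (a * real h) / ln (a * real h) / f_hk h k"
  proof -
    have "\<forall>\<^sub>F h in sequentially. ln (real h) > 0" "\<forall>\<^sub>F h in sequentially. ln (a * real h) > 0" using a by real_asymp+
    then show ?thesis
    proof eventually_elim
      case (elim h)
      have h: "real h > 0" using elim(1) by (cases h) auto
      have e: "- 1 / (real k + 1) = \<kappa> - 1" by (simp add: \<kappa>_def field_simps)
      have "prime_cutoff \<kappa> (a * real h) / ln (a * real h) = a powr \<kappa> * (real h powr \<kappa> * ln (a * real h) powr (\<kappa> - 1))"
        using elim by (simp add: prime_cutoff_def powr_mult powr_diff)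
      moreover have "f_hk h k = 1 / (\<kappa> * real k powr \<kappa>) * (real h powr \<kappa> * ln (real h) powr (\<kappa> - 1))"
        unfolding f_hk_eq[OF k elim(1)] e[symmetric] by (simp add: \<kappa>_def powr_minus field_simps)
      moreover have "(ln (a * real h) / ln (real h)) powr (\<kappa> - 1) = ln (a * real h) powr (\<kappa> - 1) / ln (real h) powr (\<kappa> - 1)"
        by (rule powr_divide)
      ultimately show ?case unfolding e using h k elim(1) by (simp add: powr_mult)
    qed
  qed
  ultimately have "(\<lambda>h. prime_cutoff \<kappa> (a * real h) / ln (a * real h) / f_hk h k) \<longlonglongrightarrow> \<kappa> * (a * real k) powr \<kappa> * 1 powr (- 1 / (real k + 1))"
    by (rule Lim_transform_eventually)
  then show ?thesis by simp
qed

text \<open>A smaller power of \<open>h\<close> is negligible, logarithms included; this disposes of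
  the overlapping members and of additive constants.\<close>

lemma powr_over_f_hk:
  assumes k: "1 \<le> k" and "\<theta> < real k / (real k + 1)"
  shows "(\<lambda>h. real h powr \<theta> / f_hk h k) \<longlonglongrightarrow> 0"
proof -
  define \<kappa> where "\<kappa> = real k / (real k + 1)"
  define d where "d = \<kappa> - \<theta>"
  define b where "b = 1 / (real k + 1)"
  define C where "C = 1 / ((real k + 1) / real k * real k powr (- \<kappa>))"
  have "d > 0" "b > 0" using assms by (auto simp: d_def \<kappa>_def b_def)
  then have "(\<lambda>h. C * (real h powr (-d) * ln (real h) powr b)) \<longlonglongrightarrow> 0" by real_asymp
  moreover have "\<forall>\<^sub>F h in sequentially. C * (real h powr (-d) * ln (real h) powr b) = real h powr \<theta> / f_hk h k"
  proof -
    have "\<forall>\<^sub>F h in sequentially. ln (real h) > 0" by real_asymp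
    then show ?thesis
    proof eventually_elim
      case (elim h)
      have h: "real h > 0" using elim(1) by (cases h) auto
      have b: "- 1 / (real k + 1) = - b" by (simp add: b_def)
      have "real h powr (-d) = real h powr \<theta> / real h powr \<kappa>" by (simp add: d_def powr_diff)
      then show ?case unfolding f_hk_eq[OF k elim] b \<kappa>_def[symmetric] C_def
        using elim by (simp add: powr_minus divide_inverse mult_ac)
    qed
  qed
  ultimately show ?thesis by (rule Lim_transform_eventually)
qed

text \<open>For \<open>a = 1 / k\<close> the limit is 1: asymptotically \<open>f_hk h k\<close> is
  the number of primes that a budget \<open>h\<close> affords at the price
  \<open>k * p powr (1 / k)\<close>.\<close>

lemma card_primes_cutoff_over_f_hk:
  assumes k: "1 \<le> k" and a: "a > 0"
  defines "\<kappa> \<equiv> real k / (real k + 1)"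
  shows "(\<lambda>h. real (card (primes_le (prime_cutoff \<kappa> (a * real h)))) / f_hk h k) \<longlonglongrightarrow> (a * real k) powr \<kappa>"
proof -
  have \<kappa>: "\<kappa> > 0" using k by (simp add: \<kappa>_def)
  have at: "filterlim (\<lambda>h. a * real h) at_top sequentially" using a by real_asymp
  let ?y = "\<lambda>h. prime_cutoff \<kappa> (a * real h)"
  have "(\<lambda>h. real (card (primes_le (?y h))) / (?y h / ln (a * real h)) * (?y h / ln (a * real h) / f_hk h k))
      \<longlonglongrightarrow> 1 / \<kappa> * (\<kappa> * (a * real k) powr \<kappa>)"
    unfolding \<kappa>_def by (intro tendsto_mult cutoff_over_f_hk k a filterlim_compose[OF card_primes_cutoff at]) (use k in auto)
  moreover have "\<forall>\<^sub>F h in sequentially. real (card (primes_le (?y h))) / (?y h / ln (a * real h)) * (?y h / ln (a * real h) / f_hk h k)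
      = real (card (primes_le (?y h))) / f_hk h k"
  proof -
    have "\<forall>\<^sub>F h in sequentially. ln (a * real h) > 0" using a by real_asymp
    moreover have "\<forall>\<^sub>F h in sequentially. ?y h > 0"
      using filterlim_compose[OF prime_cutoff_at_top[OF \<kappa>] at] by (simp add: filterlim_at_top_dense)
    ultimately show ?thesis by eventually_elim simp
  qed
  ultimately have "(\<lambda>h. real (card (primes_le (?y h))) / f_hk h k) \<longlonglongrightarrow> 1 / \<kappa> * (\<kappa> * (a * real k) powr \<kappa>)"
    by (rule Lim_transform_eventually)
  then show ?thesis using \<kappa> by simp
qed

lemma prime_powr_sum_cutoff_seq:
  assumes k: "1 \<le> k" and a: "a > 0"
  defines "\<kappa> \<equiv> real k / (real k + 1)"
  shows "(\<lambda>h. (\<Sum>p\<in>primes_le (prime_cutoff \<kappa> (a * real h)). real p powr (1 / real k)) / (a * real h)) \<longlonglongrightarrow> 1"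
proof -
  have at: "filterlim (\<lambda>h. a * real h) at_top sequentially" using a by real_asymp
  show ?thesis
    by (rule filterlim_compose[OF prime_powr_sum_cutoff at]) (use k in \<open>auto simp: \<kappa>_def field_simps\<close>)
qed

lemma root_eq_powr: "1 \<le> k \<Longrightarrow> root k (real n) = real n powr (1 / real k)"
  by (cases "n = 0") (simp_all add: root_powr_inverse)

lemma const_over_f_hk:
  assumes "1 \<le> k"
  shows "(\<lambda>h. c / f_hk h k) \<longlonglongrightarrow> 0"
proof -
  have "(\<lambda>h. c * (real h powr 0 / f_hk h k)) \<longlonglongrightarrow> c * 0"
    using assms by (intro tendsto_mult tendsto_const powr_over_f_hk) auto
  moreover have "\<forall>\<^sub>F h in sequentially. c * (real h powr 0 / f_hk h k) = c / f_hk h k"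
    using eventually_gt_at_top[of 0] by eventually_elim simp
  ultimately have "(\<lambda>h. c / f_hk h k) \<longlonglongrightarrow> c * 0" by (rule Lim_transform_eventually)
  then show ?thesis by simp
qed

lemma E_max_lower:
  assumes k: "1 \<le> k" and c: "0 < c" "c < 1"
  shows "\<forall>\<^sub>F h in sequentially. c \<le> real (E_max h k) / f_hk h k"
proof -
  define \<kappa> where "\<kappa> = real k / (real k + 1)"
  define \<delta> where "\<delta> = (1 - c) / 2"
  \<comment> \<open>The budget \<open>h / k\<close> is reduced by the factor
    \<open>1 - \<delta>\<close>, so that an error factor \<open>1 + \<delta>\<close> in the prime
    sum still keeps the total cost below \<open>h\<close>.\<close>
  define a where "a = (1 - \<delta>) / real k"
  let ?N0 = "(2 ^ k + 1) ^ k :: nat"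
  let ?y = "\<lambda>h. prime_cutoff \<kappa> (a * real h)"
  have \<delta>: "0 < \<delta>" "\<delta> < 1" "c < 1 - \<delta>" using c by (auto simp: \<delta>_def field_simps)
  have a: "a > 0" using \<delta> k by (simp add: a_def)
  have "(1 - \<delta>) powr 1 \<le> (1 - \<delta>) powr \<kappa>" using \<delta> k by (intro powr_mono') (auto simp: \<kappa>_def)
  then have c2: "c < (a * real k) powr \<kappa>" using \<delta> k by (simp add: a_def)
  have "(\<lambda>h. real (card (primes_le (?y h))) / f_hk h k - real ?N0 / f_hk h k) \<longlonglongrightarrow> (a * real k) powr \<kappa> - 0"
    unfolding \<kappa>_def by (intro tendsto_diff card_primes_cutoff_over_f_hk const_over_f_hk k a)
  then have "\<forall>\<^sub>F h in sequentially. c < real (card (primes_le (?y h))) / f_hk h k - real ?N0 / f_hk h k"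
    by (rule order_tendstoD) (use c2 in simp)
  moreover have "\<forall>\<^sub>F h in sequentially. (\<Sum>p\<in>primes_le (?y h). real p powr (1 / real k)) / (a * real h) < 1 + \<delta>"
    by (rule order_tendstoD[OF prime_powr_sum_cutoff_seq[OF k a, folded \<kappa>_def]]) (use \<delta> in simp)
  moreover have "\<forall>\<^sub>F h in sequentially. ln (real h) > 0" by real_asymp
  ultimately show ?thesis
  proof eventually_elim
    case (elim h)
    have h: "real h > 0" using elim(3) by (cases h) auto
    have f: "f_hk h k > 0" by (rule f_hk_pos[OF k elim(3)])
    \<comment> \<open>Primes below the threshold of \<open>h_cyc_spec\<close> are dropped; at most
      \<open>?N0\<close> of them are lost, which is negligible.\<close>
    define S where "S = {p\<in>primes_le (?y h). ?N0 \<le> p}"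
    have "real (\<Sum>p\<in>S. h_cyc p k) \<le> (\<Sum>p\<in>S. real k * real p powr (1 / real k))"
      unfolding of_nat_sum using h_cyc_spec(2)[OF k] by (intro sum_mono) (auto simp: S_def root_eq_powr[OF k])
    also have "\<dots> \<le> (\<Sum>p\<in>primes_le (?y h). real k * real p powr (1 / real k))"
      by (intro sum_mono2) (auto simp: S_def)
    also have "\<dots> = real k * (\<Sum>p\<in>primes_le (?y h). real p powr (1 / real k))" by (simp add: sum_distrib_left)
    also have "\<dots> < real k * ((1 + \<delta>) * (a * real h))"
      using elim(2) a h k by (intro mult_strict_left_mono) (auto simp: divide_less_eq)
    also have "\<dots> = (1 + \<delta>) * (real k * a) * real h" by (simp only: mult_ac)
    also have "real k * a = 1 - \<delta>" using k by (simp add: a_def)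
    also have "(1 + \<delta>) * (1 - \<delta>) * real h = (1 - \<delta>\<^sup>2) * real h" by (simp add: power2_eq_square algebra_simps)
    also have "\<dots> \<le> real h" using h by (simp add: mult_left_le_one_le mult_le_cancel_right1)
    finally have "(\<Sum>p\<in>S. h_cyc p k) < h" by (simp only: of_nat_less_iff)
    then have "card S \<le> E_max h k"
      by (intro card_primes_le_E_max[OF k]) (auto simp: S_def primes_le_def[symmetric], auto simp: primes_le_def)
    moreover have "card (primes_le (?y h)) \<le> card (S \<union> {..<?N0})" by (intro card_mono) (auto simp: S_def)
    moreover have "card (S \<union> {..<?N0}) \<le> card S + ?N0" using card_Un_le[of S "{..<?N0}"] by simp
    ultimately have "card (primes_le (?y h)) \<le> E_max h k + ?N0" by linarith
    then have "real (card (primes_le (?y h))) \<le> real (E_max h k + ?N0)" by (rule of_nat_mono)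
    then have "(real (card (primes_le (?y h))) - real ?N0) / f_hk h k \<le> real (E_max h k) / f_hk h k"
      using f by (intro divide_right_mono) auto
    then show ?case using elim(1) by (simp add: diff_divide_distrib)
  qed
qed

lemma h_cyc_eventually_ge:
  assumes k: "1 \<le> k" and \<rho>: "0 < \<rho>" "ereal \<rho> < R_low k"
  shows "\<forall>\<^sub>F N in sequentially. \<rho> * real k * real N powr (1 / real k) \<le> real (h_cyc N k - 1)"
proof -
  \<comment> \<open>The room between \<open>\<rho>\<close> and \<open>\<rho>'\<close> absorbs the
    subtracted 1.\<close>
  obtain \<rho>' where \<rho>': "ereal \<rho> < ereal \<rho>'" "ereal \<rho>' < R_low k" using ereal_dense2[OF \<rho>(2)] by blast
  have d: "\<rho>' - \<rho> > 0" using \<rho>'(1) by simp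
  have "\<forall>\<^sub>F N in sequentially. ereal \<rho>' < ereal (real (h_cyc N k) / (real k * root k (real N)))"
    using \<rho>'(2) unfolding R_low_def by (rule less_LiminfD)
  moreover have "\<forall>\<^sub>F N in sequentially. 1 \<le> (\<rho>' - \<rho>) * real k * real N powr (1 / real k)"
    using d k by real_asymp
  ultimately show ?thesis using eventually_gt_at_top[of 0]
  proof eventually_elim
    case (elim N)
    have "real k * real N powr (1 / real k) > 0" using elim(3) k by simp
    then have "\<rho>' * (real k * real N powr (1 / real k)) < real (h_cyc N k)"
      using elim(1) by (simp add: root_eq_powr[OF k] less_divide_eq)
    then have "\<rho> * (real k * real N powr (1 / real k)) \<le> real (h_cyc N k) - 1"
      using elim(2) by (simp add: algebra_simps)
    then show ?case by (simp add: mult.assoc)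
  qed
qed

text \<open>The primes \<open>T\<close> from \<open>essential_family_bound\<close> have a sum of
  \<open>p powr \<alpha>\<close> at most \<open>a * h\<close> up to a constant, where
  \<open>a = 1 / (\<rho> * k)\<close>. By the exchange lemma their number exceeds that of the primes
  up to the cutoff for \<open>a * h\<close> only by errors of smaller order.\<close>

lemma E_max_upper:
  assumes k: "1 \<le> k" and \<rho>: "0 < \<rho>" "ereal \<rho> < R_low k" and c: "(1 / \<rho>) powr (real k / (real k + 1)) < c"
  shows "\<forall>\<^sub>F h in sequentially. real (E_max h k) / f_hk h k \<le> c"
proof -
  define \<kappa> where "\<kappa> = real k / (real k + 1)"
  define \<alpha> where "\<alpha> = 1 / real k"
  define a where "a = 1 / (\<rho> * real k)"
  define \<theta> where "\<theta> = (2 * real k - 1) / (2 * real k + 1)"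
  let ?y = "\<lambda>h. prime_cutoff \<kappa> (a * real h)"
  let ?S = "\<lambda>h. \<Sum>p\<in>primes_le (?y h). real p powr \<alpha>"
  have "1 + \<alpha> = (real k + 1) / real k" using k by (simp add: \<alpha>_def add_divide_distrib)
  then have \<kappa>: "\<kappa> > 0" "\<kappa> * (1 + \<alpha>) = 1" using k by (simp_all add: \<kappa>_def)
  have \<alpha>: "\<alpha> > 0" using k by (simp add: \<alpha>_def)
  have a: "a > 0" using k \<rho> by (simp add: a_def)
  have ak: "a * real k = 1 / \<rho>" using k by (simp add: a_def)
  have \<theta>: "\<theta> < real k / (real k + 1)" by (simp add: \<theta>_def field_simps)
  obtain N1 where N1: "\<And>N. N \<ge> N1 \<Longrightarrow> \<rho> * real k * real N powr \<alpha> \<le> real (h_cyc N k - 1)"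
    using h_cyc_eventually_ge[OF k \<rho>] unfolding eventually_sequentially \<alpha>_def by blast
  \<comment> \<open>Primes below \<open>N1\<close>, where the bound for \<open>h_cyc\<close> may
    fail, contribute at most \<open>C1\<close> to the sum.\<close>
  define C1 where "C1 = real N1 * real N1 powr \<alpha>"
  define K where "K = exp 2 * (2::real) ^ k"
  define U where "U = (\<lambda>h. real (card (primes_le (?y h))) + (a * real h + C1 - ?S h) / ?y h powr \<alpha> + real k + K * real h powr \<theta>)"
  have at: "filterlim (\<lambda>h. a * real h) at_top sequentially" using a by real_asymp
  have y0: "\<forall>\<^sub>F h in sequentially. ?y h > 0"
    using filterlim_compose[OF prime_cutoff_at_top[OF \<kappa>(1)] at] by (simp add: filterlim_at_top_dense)
  have ln0: "\<forall>\<^sub>F h in sequentially. ln (real h) > 0" "\<forall>\<^sub>F h in sequentially. ln (a * real h) > 0" using a by real_asymp+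
  \<comment> \<open>The exchange error vanishes relative to \<open>f_hk h k\<close>: the prime sum
    up to the cutoff is asymptotic to \<open>a * h\<close>, and dividing \<open>a * h\<close> by
    \<open>?y h powr \<alpha>\<close> gives \<open>?y h / ln (a * h)\<close>, which is of the order
    of \<open>f_hk h k\<close>.\<close>
  have "(\<lambda>h. (1 + C1 / (a * real h) - ?S h / (a * real h)) * (?y h / ln (a * real h) / f_hk h k)) \<longlonglongrightarrow> (1 + 0 - 1) * (\<kappa> * (a * real k) powr \<kappa>)"
  proof (intro tendsto_mult tendsto_diff tendsto_add tendsto_const)
    show "(\<lambda>h. C1 / (a * real h)) \<longlonglongrightarrow> 0" using a by real_asymp
    show "(\<lambda>h. ?S h / (a * real h)) \<longlonglongrightarrow> 1"
      using prime_powr_sum_cutoff_seq[OF k a] unfolding \<kappa>_def \<alpha>_def .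
    show "(\<lambda>h. ?y h / ln (a * real h) / f_hk h k) \<longlonglongrightarrow> \<kappa> * (a * real k) powr \<kappa>"
      unfolding \<kappa>_def by (rule cutoff_over_f_hk[OF k a])
  qed
  moreover have "\<forall>\<^sub>F h in sequentially. (1 + C1 / (a * real h) - ?S h / (a * real h)) * (?y h / ln (a * real h) / f_hk h k)
      = (a * real h + C1 - ?S h) / ?y h powr \<alpha> / f_hk h k"
    using y0 ln0
  proof eventually_elim
    case (elim h)
    have t: "a * real h > 0" using elim(2) a by (cases h) auto
    have "?y h powr (1 + \<alpha>) = a * real h * ln (a * real h)"
      using t elim(3) \<kappa>(2) by (simp add: prime_cutoff_def powr_powr)
    then have "?y h * ?y h powr \<alpha> = a * real h * ln (a * real h)" using elim(1) by (simp add: powr_add)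
    then have "?y h / ln (a * real h) = a * real h / ?y h powr \<alpha>"
      using elim t by (simp add: frac_eq_eq)
    moreover have "(1 + c / t - s / t) * (t / p / f) = (t + c - s) / p / f" if "t > 0" for c s t p f :: real
    proof -
      have "(1 + c / t - s / t) * t = t + c - s" using that by (simp add: left_diff_distrib distrib_right)
      then show ?thesis by simp
    qed
    ultimately show ?case using t by (simp only:)
  qed
  ultimately have l1: "(\<lambda>h. (a * real h + C1 - ?S h) / ?y h powr \<alpha> / f_hk h k) \<longlonglongrightarrow> (1 + 0 - 1) * (\<kappa> * (a * real k) powr \<kappa>)"
    by (rule Lim_transform_eventually)
  have "(\<lambda>h. real (card (primes_le (?y h))) / f_hk h k + (a * real h + C1 - ?S h) / ?y h powr \<alpha> / f_hk h k + real k / f_hk h k + K * (real h powr \<theta> / f_hk h k))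
     \<longlonglongrightarrow> (a * real k) powr \<kappa> + (1 + 0 - 1) * (\<kappa> * (a * real k) powr \<kappa>) + 0 + K * 0"
    by (intro tendsto_add tendsto_mult tendsto_const l1 const_over_f_hk k powr_over_f_hk \<theta> card_primes_cutoff_over_f_hk[OF k a, folded \<kappa>_def])
  then have lim: "(\<lambda>h. U h / f_hk h k) \<longlonglongrightarrow> (1 / \<rho>) powr \<kappa>"
    by (simp add: U_def add_divide_distrib ak)
  have "\<forall>\<^sub>F h in sequentially. U h / f_hk h k < c" using lim c unfolding \<kappa>_def by (rule order_tendstoD)
  moreover have "\<forall>\<^sub>F h in sequentially. U h / f_hk h k > 0" using lim by (rule order_tendstoD) (use \<rho> in simp)
  ultimately show ?thesis using y0 ln0(1)
  proof eventually_elim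
    case (elim h)
    have f: "f_hk h k > 0" by (rule f_hk_pos[OF k elim(4)])
    have "real (E_max h k) \<le> U h"
    proof (rule E_max_le)
      show "0 \<le> U h" using elim(2) f by (simp add: zero_less_divide_iff)
      fix A assume A: "basis_of_order A h"
      let ?F = "{E. essential_subset A E \<and> card E = k}"
      obtain T where T: "finite T" "\<forall>p\<in>T. prime p" "(\<Sum>p\<in>T. h_cyc p k - 1) \<le> h"
        "real (card ?F) \<le> real (card T) + real k + K * real h powr \<theta>"
        using essential_family_bound[OF A k finite_essential_subsets[OF A k]] unfolding K_def \<theta>_def by auto
      have "(\<Sum>p\<in>T. \<rho> * real k * real p powr \<alpha>) \<le> (\<Sum>p\<in>T. real (h_cyc p k - 1)) + (\<Sum>p\<in>{p\<in>T. p < N1}. \<rho> * real k * real p powr \<alpha>)"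
      proof -
        have "(\<Sum>p\<in>T. \<rho> * real k * real p powr \<alpha>) = (\<Sum>p\<in>{p\<in>T. N1 \<le> p}. \<rho> * real k * real p powr \<alpha>) + (\<Sum>p\<in>{p\<in>T. p < N1}. \<rho> * real k * real p powr \<alpha>)"
          using T(1) by (subst sum.union_disjoint[symmetric]) (auto intro!: sum.cong)
        moreover have "(\<Sum>p\<in>{p\<in>T. N1 \<le> p}. \<rho> * real k * real p powr \<alpha>) \<le> (\<Sum>p\<in>{p\<in>T. N1 \<le> p}. real (h_cyc p k - 1))"
          using N1 by (intro sum_mono) auto
        moreover have "\<dots> \<le> (\<Sum>p\<in>T. real (h_cyc p k - 1))" using T(1) by (intro sum_mono2) auto
        ultimately show ?thesis by linarith
      qed
      also have "(\<Sum>p\<in>T. real (h_cyc p k - 1)) \<le> real h" using T(3) unfolding of_nat_sum[symmetric] by (rule of_nat_mono)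
      also have "(\<Sum>p\<in>{p\<in>T. p < N1}. \<rho> * real k * real p powr \<alpha>) \<le> (\<Sum>p\<in>{..<N1}. \<rho> * real k * real N1 powr \<alpha>)"
      proof -
        have "(\<Sum>p\<in>{p\<in>T. p < N1}. \<rho> * real k * real p powr \<alpha>) \<le> (\<Sum>p\<in>{p\<in>T. p < N1}. \<rho> * real k * real N1 powr \<alpha>)"
          using \<rho> \<alpha> by (intro sum_mono mult_left_mono powr_mono2) auto
        also have "\<dots> \<le> (\<Sum>p\<in>{..<N1}. \<rho> * real k * real N1 powr \<alpha>)" using \<rho> by (intro sum_mono2) auto
        finally show ?thesis .
      qed
      also have "(\<Sum>p\<in>{..<N1}. \<rho> * real k * real N1 powr \<alpha>) = \<rho> * real k * C1" by (simp add: C1_def)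
      finally have "\<rho> * real k * (\<Sum>p\<in>T. real p powr \<alpha>) \<le> real h + \<rho> * real k * C1"
        by (simp add: sum_distrib_left)
      then have "(\<Sum>p\<in>T. real p powr \<alpha>) \<le> a * real h + C1" using \<rho> k by (simp add: a_def field_simps)
      then have "((\<Sum>p\<in>T. real p powr \<alpha>) - ?S h) / ?y h powr \<alpha> \<le> (a * real h + C1 - ?S h) / ?y h powr \<alpha>"
        by (intro divide_right_mono) auto
      moreover have "real (card T) \<le> real (card (primes_le (?y h))) + ((\<Sum>p\<in>T. real p powr \<alpha>) - ?S h) / ?y h powr \<alpha>"
        using T(1,2) elim(3) \<alpha> by (intro card_primes_exchange) auto
      ultimately show "real (card ?F) \<le> U h" using T(4) unfolding U_def by linarith
    qed
    then have "real (E_max h k) / f_hk h k \<le> U h / f_hk h k" using f by (intro divide_right_mono) auto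
    then show ?case using elim(1) by linarith
  qed
qed

theorem theorem1p2:
  fixes k :: nat
  assumes "1 \<le> k"
  shows "liminf (\<lambda>h. ereal (real (E_max h k) / f_hk h k)) \<ge> 1
    \<and> ereal (1 / exp 1) < R_low k \<and> R_low k \<le> 1
    \<and> limsup (\<lambda>h. ereal (real (E_max h k) /
          ((1 / real_of_ereal (R_low k)) powr (real k / (real k + 1)) * f_hk h k))) \<le> 1"
proof (intro conjI)
  show R: "ereal (1 / exp 1) < R_low k" "R_low k \<le> 1"
    using R_low_bounds[OF assms] by auto
  show "1 \<le> liminf (\<lambda>h. ereal (real (E_max h k) / f_hk h k))"
  proof (rule ccontr)
    assume "\<not> 1 \<le> liminf (\<lambda>h. ereal (real (E_max h k) / f_hk h k))"
    \<comment> \<open>The maximum with 0 makes \<open>c\<close> positive, as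
      \<open>E_max_lower\<close> requires.\<close>
    then have "max 0 (liminf (\<lambda>h. ereal (real (E_max h k) / f_hk h k))) < ereal 1" by (simp add: one_ereal_def)
    then obtain c where c: "max 0 (liminf (\<lambda>h. ereal (real (E_max h k) / f_hk h k))) < ereal c" "ereal c < ereal 1"
      using ereal_dense2 by blast
    then have "0 < c" "c < 1" by auto
    have "ereal c \<le> liminf (\<lambda>h. ereal (real (E_max h k) / f_hk h k))"
      by (rule Liminf_bounded) (use E_max_lower[OF assms \<open>0 < c\<close> \<open>c < 1\<close>] in simp)
    then show False using c(1) by auto
  qed
  define r where "r = real_of_ereal (R_low k)"
  have Rr: "R_low k = ereal r" using R unfolding r_def by (cases "R_low k") auto
  have "1 / exp 1 < r" using R(1) unfolding Rr by simp
  then have r: "r > 0" by (smt (verit) exp_gt_zero zero_less_divide_1_iff)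
  define \<kappa> where "\<kappa> = real k / (real k + 1)"
  have \<kappa>: "0 < \<kappa>" "\<kappa> \<le> 1" using assms by (auto simp: \<kappa>_def)
  show "limsup (\<lambda>h. ereal (real (E_max h k) /
          ((1 / real_of_ereal (R_low k)) powr (real k / (real k + 1)) * f_hk h k))) \<le> 1"
  proof (rule ccontr)
    let ?L = "limsup (\<lambda>h. ereal (real (E_max h k) / ((1 / r) powr \<kappa> * f_hk h k)))"
    assume "\<not> limsup (\<lambda>h. ereal (real (E_max h k) /
          ((1 / real_of_ereal (R_low k)) powr (real k / (real k + 1)) * f_hk h k))) \<le> 1"
    then have "ereal 1 < ?L" unfolding r_def \<kappa>_def by (simp add: one_ereal_def)
    then obtain c where c: "ereal 1 < ereal c" "ereal c < ?L" using ereal_dense2 by blast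
    then have "c > 1" by simp
    define c' where "c' = (1 + c) / 2"
    have c': "1 < c'" "c' < c" using \<open>c > 1\<close> by (auto simp: c'_def)
    \<comment> \<open>Slightly below \<open>r\<close>, as \<open>E_max_upper\<close> requires; the
      loss is a factor \<open>c' powr \<kappa> \<le> c' < c\<close>.\<close>
    define \<rho> where "\<rho> = r / c'"
    have \<rho>: "0 < \<rho>" "\<rho> < r" using r c' by (auto simp: \<rho>_def divide_less_eq)
    have "(1 / \<rho>) powr \<kappa> = c' powr \<kappa> * (1 / r) powr \<kappa>"
      using powr_mult[of c' "1 / r" \<kappa>] by (simp add: \<rho>_def)
    also have "c' powr \<kappa> \<le> c' powr 1" using c' \<kappa> by (intro powr_mono) auto
    finally have "(1 / \<rho>) powr \<kappa> \<le> c' * (1 / r) powr \<kappa>" using c' by (simp add: mult_right_mono)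
    also have "\<dots> < c * (1 / r) powr \<kappa>" using c' r by simp
    finally have "(1 / \<rho>) powr (real k / (real k + 1)) < c * (1 / r) powr \<kappa>" by (simp add: \<kappa>_def)
    from E_max_upper[OF assms \<rho>(1) _ this] \<rho>(2)
    have "\<forall>\<^sub>F h in sequentially. real (E_max h k) / f_hk h k \<le> c * (1 / r) powr \<kappa>" unfolding Rr by simp
    then have "\<forall>\<^sub>F h in sequentially. ereal (real (E_max h k) / ((1 / r) powr \<kappa> * f_hk h k)) \<le> ereal c"
    proof eventually_elim
      case (elim h)
      have "real (E_max h k) / f_hk h k / (1 / r) powr \<kappa> \<le> c"
        using elim r by (subst pos_divide_le_eq) auto
      then show ?case by (simp add: mult.commute)
    qed
    then have "?L \<le> ereal c" by (rule Limsup_bounded)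
    then show False using c(2) by auto
  qed
qed

end
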